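(* Let $A$ be either $K\{X\}_\infty$ or $K\{X\}$, and let $W=\mathrm{Prim}\,A=\bigoplus_{k\ge1}\mathrm{Prim}\,A^{(k)}$ be its space of primitive elements of positive degree, graded by $W^{(k)}=\mathrm{Prim}\,A^{(k)}$. (i) The unitary commutative associative algebra $(A,\sqcup\!\sqcup)$ is freely generated by $W$ with respect to the shuffle multiplication, i.e. the unital algebra homomorphism from the symmetric algebra $S(W)$ to $(A,\sqcup\!\sqcup)$ extending the inclusion $W\subset A$ is an isomorphism. (ii) Writing $f^{\mathcal P}(t)=\sum_{n\ge1}\frac{\dim\mathcal P(n)}{n!}t^n$, one has $f^{\mathrm{Prim}\,\mathcal Mag_\omega}(t)=\log\bigl(1+f^{\mathcal Mag_\omega}(t)\bigr)$ and $f^{\mathrm{Prim}\,\mathcal Mag}(t)=\log\bigl(1+f^{\mathcal Mag}(t)\bigr)$. (iii) Let $n\ge2$ and let $B^{(n)}$ be the orthogonal complement of $\mathrm{Prim}\,A^{(n)}$ in $A^{(n)}$ with respect to $\langle\,,\rangle$. If $f_1,\dots,f_r$ is a basis consisting of homogeneous elements of $\bigoplus_{k=1}^{n-1}\mathrm{Prim}\,A^{(k)}$, then the elements $f_{i_1}\sqcup\!\sqcup f_{i_2}\sqcup\!\sqcup\cdots\sqcup\!\sqcup f_{i_k}$ with $1\le i_1\le\dots\le i_k\le r$ and $\sum_{j=1}^k\deg f_{i_j}=n$ form a basis of $B^{(n)}$.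
   Context: $K$ is a field of characteristic $0$ and $X=\{x_1,x_2,\dots\}$ a finite or countable set of variables. A planar rooted tree is reduced if no vertex has exactly one incoming edge. $K\{X\}_\infty$ is the $K$-vector space with basis the "monomials": the empty tree $1$ together with all finite planar reduced rooted trees whose leaves are labelled by elements of $X$. For $k\ge2$, the $k$-ary operation $\vee^k$ sends nonempty monomials $T^1,\dots,T^k$ to the tree obtained by grafting $T^1,\dots,T^k$ (in this order) onto a new root, extended multilinearly, with the unit conventions that an argument equal to $1$ is omitted ($\vee^k$ with some arguments $1$ equals $\vee^{k'}$ of the remaining arguments, $\vee^1=\mathrm{id}$, $\vee^k(1,\dots,1)=1$). $K\{X\}_\infty$ is the free unitary $\mathcal Mag_\omega$-algebra on $X$ ($\mathcal Mag_\omega$ = the operad freely generated by one $k$-ary operation $\vee^k$ for each $k\ge2$, symmetrized), graded by number of leaves: $K\{X\}_\infty^{(n)}$. $K\{X\}\subset K\{X\}_\infty$ is the span of $1$ and the binary trees; with $a\cdot b=\vee^2(a,b)$ it is the free unitary magma algebra on $X$ (free $\mathcal Mag$-algebra, $\mathcal Mag$ the operad freely generated by one binary operation). $\langle\,,\rangle$ is the bilinear form on $A$ for which the monomials form an orthonormal basis; on $A\otimes A$, $\langle f_1\otimes f_2,g_1\otimes g_2\rangle=\langle f_1,g_1\rangle\langle f_2,g_2\rangle$. $A\otimes A$ carries the operations componentwise: $\vee^k(a_1\otimes b_1,\dots,a_k\otimes b_k)=\vee^k(a_1,\dots,a_k)\otimes\vee^k(b_1,\dots,b_k)$ (with the unit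 conventions). The co-addition $\Delta_a:A\to A\otimes A$ is the unique unital homomorphism for the operations $\vee^k$ (resp. $\cdot$) with $\Delta_a(x_i)=x_i\otimes1+1\otimes x_i$; $f$ is primitive if $\Delta_a(f)=f\otimes1+1\otimes f$. The shuffle multiplication $\sqcup\!\sqcup$ on $A$ is the transpose of $\Delta_a$: $\langle g_1\sqcup\!\sqcup g_2,h\rangle=\langle g_1\otimes g_2,\Delta_a(h)\rangle$ for all $h\in A$; it is commutative, associative with unit $1$. For an operad $\mathcal P$, $f^{\mathcal P}(t)=\sum_{n\ge1}\frac{\dim\mathcal P(n)}{n!}t^n$; $\mathcal Mag(n)$ (resp. $\mathcal Mag_\omega(n)$) is the space of multilinear elements of degree $n$ in $x_1,\dots,x_n$ of $K\{X\}$ (resp. $K\{X\}_\infty$), and $\mathrm{Prim}\,\mathcal Mag(n)$ (resp. $\mathrm{Prim}\,\mathcal Mag_\omega(n)$) is the subspace of its primitive elements; $\mathrm{Prim}\,\mathcal Mag$, $\mathrm{Prim}\,\mathcal Mag_\omega$ are operads with composition given by substitution of primitive elements for variables. *)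

theory Defs
  imports Main "HOL-Library.Function_Algebras" "HOL-Library.Countable"
    "HOL-Library.Multiset" "HOL-Computational_Algebra.Formal_Power_Series"
begin

datatype 'x ptree = Lf 'x | Nd "'x ptree list"

text \<open>A monomial is either the empty tree (None, the unit 1) or a tree (Some t).\<close>
type_synonym 'x mono = "'x ptree option"

primrec reduced :: "'x ptree \<Rightarrow> bool" where
  "reduced (Lf x) = True"
| "reduced (Nd ts) = (2 \<le> length ts \<and> list_all id (map reduced ts))"

primrec binary :: "'x ptree \<Rightarrow> bool" where
  "binary (Lf x) = True"
| "binary (Nd ts) = (length ts = 2 \<and> list_all id (map binary ts))"

primrec leaves :: "'x ptree \<Rightarrow> 'x list" where
  "leaves (Lf x) = [x]"
| "leaves (Nd ts) = concat (map leaves ts)"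

definition mdeg :: "'x mono \<Rightarrow> nat" where
  "mdeg m = (case m of None \<Rightarrow> 0 | Some t \<Rightarrow> length (leaves t))"

text \<open>Monomial basis of A: omega = True gives K{X}_infinity (all reduced trees),
  omega = False gives K{X} (binary trees).\<close>
definition mon_basis :: "bool \<Rightarrow> 'x mono set" where
  "mon_basis omega = insert None (Some ` {t. if omega then reduced t else binary t})"

definition supp :: "('m \<Rightarrow> 'k::zero) \<Rightarrow> 'm set" where
  "supp f = {m. f m \<noteq> 0}"

definition sc :: "'k::times \<Rightarrow> ('m \<Rightarrow> 'k) \<Rightarrow> ('m \<Rightarrow> 'k)" where
  "sc c f = (\<lambda>m. c * f m)"

definition delta :: "'m \<Rightarrow> ('m \<Rightarrow> 'k::{zero,one})" where
  "delta m = (\<lambda>m'. if m' = m then 1 else 0)"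

definition Aspace :: "bool \<Rightarrow> ('x mono \<Rightarrow> 'k::field) set" where
  "Aspace omega = {f. finite (supp f) \<and> supp f \<subseteq> mon_basis omega}"

definition Agr :: "bool \<Rightarrow> nat \<Rightarrow> ('x mono \<Rightarrow> 'k::field) set" where
  "Agr omega n = {f \<in> Aspace omega. \<forall>m \<in> supp f. mdeg m = n}"

definition pair :: "('m \<Rightarrow> 'k::comm_ring_1) \<Rightarrow> ('m \<Rightarrow> 'k) \<Rightarrow> 'k" where
  "pair f g = (\<Sum>m \<in> supp f. f m * g m)"

definition tens :: "('m \<Rightarrow> 'k::times) \<Rightarrow> ('m \<Rightarrow> 'k) \<Rightarrow> ('m \<times> 'm \<Rightarrow> 'k)" where
  "tens f g = (\<lambda>(a, b). f a * g b)"

definition veeM :: "'x mono list \<Rightarrow> 'x mono" where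
  "veeM ms = (let ts = map the (filter (\<lambda>m. m \<noteq> None) ms) in
     if ts = [] then None else if length ts = 1 then Some (hd ts) else Some (Nd ts))"

text \<open>Componentwise vee^k on pairs of monomials (basis of A tensor A).\<close>
definition veeT :: "('x mono \<times> 'x mono) list \<Rightarrow> 'x mono \<times> 'x mono" where
  "veeT ps = (veeM (map fst ps), veeM (map snd ps))"

definition mlext :: "('m list \<Rightarrow> 'm) \<Rightarrow> ('m \<Rightarrow> 'k::comm_ring_1) list \<Rightarrow> ('m \<Rightarrow> 'k)" where
  "mlext op fs = (\<lambda>m. \<Sum>ms \<in> listset (map supp fs).
      (\<Prod>i<length fs. (fs ! i) (ms ! i)) * (if op ms = m then 1 else 0))"

text \<open>D is a unital homomorphism A \<rightarrow> A \<otimes> A for the operations (all vee^k, k \<ge> 2, for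
  K{X}_infinity; only the product vee^2 for K{X}) with D(x) = x\<otimes>1 + 1\<otimes>x.\<close>
definition is_coadd :: "bool \<Rightarrow> (('x mono \<Rightarrow> 'k::field) \<Rightarrow> ('x mono \<times> 'x mono \<Rightarrow> 'k)) \<Rightarrow> bool" where
  "is_coadd omega D \<longleftrightarrow>
     (\<forall>f \<in> Aspace omega. \<forall>g \<in> Aspace omega. \<forall>c. D (f + g) = D f + D g \<and> D (sc c f) = sc c (D f))
   \<and> D (delta None) = delta (None, None)
   \<and> (\<forall>x. D (delta (Some (Lf x))) = delta (Some (Lf x), None) + delta (None, Some (Lf x)))
   \<and> (\<forall>fs. set fs \<subseteq> Aspace omega \<and> 2 \<le> length fs \<and> (\<not> omega \<longrightarrow> length fs = 2)
          \<longrightarrow> D (mlext veeM fs) = mlext veeT (map D fs))"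

definition coadd :: "bool \<Rightarrow> ('x mono \<Rightarrow> 'k::field) \<Rightarrow> ('x mono \<times> 'x mono \<Rightarrow> 'k)" where
  "coadd omega = (SOME D. is_coadd omega D)"

definition prim :: "bool \<Rightarrow> ('x mono \<Rightarrow> 'k::field) \<Rightarrow> bool" where
  "prim omega f \<longleftrightarrow> f \<in> Aspace omega \<and>
     coadd omega f = tens f (delta None) + tens (delta None) f"

definition PrimGr :: "bool \<Rightarrow> nat \<Rightarrow> ('x mono \<Rightarrow> 'k::field) set" where
  "PrimGr omega n = {f \<in> Agr omega n. prim omega f}"

text \<open>Shuffle product: the transpose of the co-addition,
  <g1 sh g2, h> = <g1 \<otimes> g2, coadd h> for every monomial h of A.\<close>
definition shuffle :: "bool \<Rightarrow> ('x mono \<Rightarrow> 'k::field) \<Rightarrow> ('x mono \<Rightarrow> 'k) \<Rightarrow> ('x mono \<Rightarrow> 'k)" where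
  "shuffle omega g1 g2 = (\<lambda>h. if h \<in> mon_basis omega then pair (tens g1 g2) (coadd omega (delta h)) else 0)"

definition shuffle_list :: "bool \<Rightarrow> ('x mono \<Rightarrow> 'k::field) list \<Rightarrow> ('x mono \<Rightarrow> 'k)" where
  "shuffle_list omega fs = foldr (shuffle omega) fs (delta None)"

definition shuffle_mset :: "bool \<Rightarrow> ('x mono \<Rightarrow> 'k::field) multiset \<Rightarrow> ('x mono \<Rightarrow> 'k)" where
  "shuffle_mset omega M = fold_mset (shuffle omega) (delta None) M"

definition multilin_monos :: "bool \<Rightarrow> nat \<Rightarrow> nat mono set" where
  "multilin_monos omega n = {Some t | t. Some t \<in> mon_basis omega \<and> mset (leaves t) = mset [1..<n+1]}"

definition OpComp :: "bool \<Rightarrow> nat \<Rightarrow> (nat mono \<Rightarrow> 'k::field) set" where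
  "OpComp omega n = module.span sc (delta ` multilin_monos omega n)"

definition PrimOpComp :: "bool \<Rightarrow> nat \<Rightarrow> (nat mono \<Rightarrow> 'k::field) set" where
  "PrimOpComp omega n = {f \<in> OpComp omega n. prim omega f}"

definition gen_series :: "(nat \<Rightarrow> nat) \<Rightarrow> 'k::field_char_0 fps" where
  "gen_series d = Abs_fps (\<lambda>n. if n = 0 then 0 else of_nat (d n) / fact n)"

end

(* The co-addition splits a tree T into the pairs (T|S, T|S') of contractions of T to
   complementary sets of leaves, so it is cocommutative and coassociative.

   Freeness: for a primitive p the transpose D_p of the left multiplication h |-> p . h is a
   derivation of the shuffle product, and the constant term of D_p f is <f, p>. The form is
   nondegenerate on the primitive elements, because they are defined over the rational numbers.
   Given a nontrivial relation of minimal length among shuffle monomials in linearly independent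
   primitive elements b, applying all D_p gives sum_b G_b D_p(b) = 0, where the G_b are the partial
   derivatives of the relation. The constant terms of D_p(b) are <b, p>, so all G_b vanish, which
   contradicts minimality in characteristic 0.

   Generation: the decomposable elements and the primitive elements are orthogonal complements of
   each other, and by nondegeneracy they span.

   Generating series: in the multilinear part, a shuffle monomial with leaves T, where t is in T,
   has exactly one factor containing t. This gives a(T) = sum over t in S in T of w(S) a(T - S) for
   the dimensions a and w of the multilinear parts of A and of the primitive elements, that is,
   F' = g' F for the exponential generating series. *)

theory Submission
  imports Defs
begin

text \<open>Three obstacles shape the proof. With infinitely many variables a degree component of A
  has infinite dimension. The dual-space argument for generation and the dimension counts therefore
  take place in the span of the monomials with one fixed leaf multiset, which is finite-dimensional
  because every node of a reduced tree has at least two branches; statements about degrees follow by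
  coarsening. The form is bilinear, so over a field such as the complex numbers a nonzero vector can
  be orthogonal to itself, and positivity is available only after passing to rational coefficients.
  The co-addition is given only by its homomorphism property, and omitted units change the shape of
  trees. It is therefore realized by explicit lists of splittings, and its laws are identities
  between sums of an arbitrary function over these lists: the lists keep multiplicities, and the
  arbitrary function absorbs the other subtrees during an induction. In the freeness argument no
  inverse matrix is formed: the coefficients of the G_b are shown to vanish degree by degree, since
  at the lowest degree only the constant terms <b, p> contribute.\<close>

section \<open>The co-addition on monomials\<close>

text \<open>\<open>cop t\<close> lists the summands of the co-addition of the tree \<open>t\<close> with multiplicity.\<close>

primrec cop :: "'x ptree \<Rightarrow> ('x mono \<times> 'x mono) list" where
  "cop (Lf x) = [(Some (Lf x), None), (None, Some (Lf x))]"
| "cop (Nd ts) = map veeT (product_lists (map cop ts))"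

definition copm :: "'x mono \<Rightarrow> ('x mono \<times> 'x mono) list" where
  "copm m = (case m of None \<Rightarrow> [(None, None)] | Some t \<Rightarrow> cop t)"

definition cont :: "'x mono \<Rightarrow> 'x multiset" where
  "cont m = (case m of None \<Rightarrow> {#} | Some t \<Rightarrow> mset (leaves t))"

lemma copm_simps [simp]: "copm None = [(None, None)]" "copm (Some t) = cop t"
  by (simp_all add: copm_def)

lemma cont_simps [simp]: "cont None = {#}" "cont (Some t) = mset (leaves t)"
  by (simp_all add: cont_def)

lemma size_cont: "size (cont m) = mdeg m"
  by (cases m) (simp_all add: mdeg_def)

lemma sum_list_exchange:
  fixes f :: "'a \<Rightarrow> 'b \<Rightarrow> 'c::comm_monoid_add"
  shows "(\<Sum>x\<leftarrow>xs. \<Sum>y\<leftarrow>ys. f x y) = (\<Sum>y\<leftarrow>ys. \<Sum>x\<leftarrow>xs. f x y)"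
  by (induction xs) (simp_all add: sum_list_addf)

lemma sum_product_lists_Cons:
  fixes f :: "'a list \<Rightarrow> 'c::comm_monoid_add"
  shows "(\<Sum>ys\<leftarrow>product_lists (xs # xss). f ys) = (\<Sum>x\<leftarrow>xs. \<Sum>ys\<leftarrow>product_lists xss. f (x # ys))"
  by (induction xs) (simp_all add: o_def)

lemma filter_product_lists:
  "filter (list_all P) (product_lists xss) = product_lists (map (filter P) xss)"
proof (induction xss)
  case (Cons xs xss)
  show ?case
    by (induction xs) (simp_all add: filter_map o_def flip: Cons.IH)
qed simp

lemma veeM_Nil [simp]: "veeM [] = None"
  by (simp add: veeM_def)

lemma veeM_single [simp]: "veeM [m] = m"
  by (cases m) (simp_all add: veeM_def)

lemma veeM_map_Some: "2 \<le> length ts \<Longrightarrow> veeM (map Some ts) = Some (Nd ts)"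
  by (auto simp: veeM_def Let_def filter_map o_def)

lemma veeM_None_iff: "veeM ms = None \<longleftrightarrow> list_all (\<lambda>m. m = None) ms"
  by (auto simp: veeM_def Let_def filter_empty_conv list_all_iff)

lemma veeT_single [simp]: "veeT [p] = p"
  by (simp add: veeT_def)

lemma cont_veeM: "cont (veeM ms) = (\<Sum>m\<leftarrow>ms. cont m)"
proof -
  define ts where "ts = map the (filter (\<lambda>m. m \<noteq> None) ms)"
  have "(\<Sum>m\<leftarrow>ms. cont m) = (\<Sum>t\<leftarrow>ts. mset (leaves t))"
    unfolding ts_def by (induction ms) auto
  moreover have "mset (concat (map leaves ts)) = (\<Sum>t\<leftarrow>ts. mset (leaves t))"
    by (induction ts) auto
  moreover have "cont (veeM ms) = (if ts = [] then {#} else if length ts = 1 then mset (leaves (hd ts)) else mset (concat (map leaves ts)))"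
    unfolding veeM_def ts_def[symmetric] Let_def by simp
  ultimately show ?thesis
    by (cases ts) auto
qed

section \<open>Splittings and grafting; cocommutativity and coassociativity\<close>

text \<open>Contracting unit arguments commutes with splitting, because the unit splits only as
  \<open>(1, 1)\<close>.\<close>

lemma sum_product_copm_filter:
  fixes \<psi> :: "'x mono list \<Rightarrow> 'x mono list \<Rightarrow> 'c::comm_monoid_add"
  defines "F \<equiv> filter (\<lambda>m::'x mono. m \<noteq> None)"
  shows "(\<Sum>ps\<leftarrow>product_lists (map copm ms). \<psi> (F (map fst ps)) (F (map snd ps)))
       = (\<Sum>ps\<leftarrow>product_lists (map cop (map the (F ms))). \<psi> (F (map fst ps)) (F (map snd ps)))"
proof (induction ms arbitrary: \<psi>)
  case (Cons m ms)
  show ?case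
  proof (cases m)
    case None
    then show ?thesis
      by (simp add: sum_product_lists_Cons F_def del: product_lists.simps)
        (use Cons[of \<psi>] in \<open>simp add: F_def\<close>)
  next
    case (Some t)
    have *: "(\<Sum>ps\<leftarrow>product_lists (map copm ms). \<psi> (F (fst x # map fst ps)) (F (snd x # map snd ps)))
        = (\<Sum>ps\<leftarrow>product_lists (map cop (map the (F ms))). \<psi> (F (fst x # map fst ps)) (F (snd x # map snd ps)))"
      for x
    proof -
      \<comment> \<open>\<open>F\<close> acts entrywise, so the head contributes only a fixed
        prefix, which the arbitrary \<open>\<psi>\<close> of the induction hypothesis
        absorbs.\<close>
      have F: "F (a # as) = F [a] @ F as" for a as by (simp add: F_def)
      show ?thesis
        unfolding F[of _ "map _ _"] by (rule Cons[unfolded F_def[symmetric]])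
    qed
    have F: "F (Some t # ms) = Some t # F ms" by (simp add: F_def)
    show ?thesis
      by (simp only: Some F list.map sum_product_lists_Cons copm_simps option.sel *)
  qed
qed (simp add: F_def)

text \<open>The homomorphism property of the co-addition on monomials, with the unit conventions:
  \<open>veeM\<close> adds no root when at most one argument is nonempty, so these cases are
  separate from that of a genuine node.\<close>

lemma sum_copm_veeM:
  fixes \<phi> :: "'x mono \<times> 'x mono \<Rightarrow> 'c::comm_monoid_add"
  shows "(\<Sum>q\<leftarrow>copm (veeM ms). \<phi> q) = (\<Sum>ps\<leftarrow>product_lists (map copm ms). \<phi> (veeT ps))"
proof -
  define F where "F = filter (\<lambda>m::'x mono. m \<noteq> None)"
  define ts where "ts = map the (F ms)"
  have FF: "F (F ms) = F ms" for ms by (simp add: F_def)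
  have V: "veeM (F ms) = veeM ms" for ms by (simp add: F_def veeM_def)
  define \<psi> where "\<psi> u v = \<phi> (veeM u, veeM v)" for u v
  have eq: "\<phi> (veeT ps) = \<psi> (F (map fst ps)) (F (map snd ps))" for ps
    by (simp add: \<psi>_def veeT_def V)
  have "(\<Sum>ps\<leftarrow>product_lists (map copm ms). \<phi> (veeT ps)) = (\<Sum>ps\<leftarrow>product_lists (map cop ts). \<phi> (veeT ps))"
    unfolding eq ts_def F_def by (rule sum_product_copm_filter)
  moreover have "(\<Sum>q\<leftarrow>copm (veeM ms). \<phi> q) = (\<Sum>ps\<leftarrow>product_lists (map cop ts). \<phi> (veeT ps))"
  proof -
    have v: "veeM ms = (if ts = [] then None else if length ts = 1 then Some (hd ts) else Some (Nd ts))"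
      unfolding veeM_def ts_def F_def Let_def by simp
    consider "ts = []" | t where "ts = [t]" | "length ts \<ge> 2"
      by (cases ts rule: list.exhaust; cases "tl ts") auto
    then show ?thesis
    proof cases
      case 2
      then show ?thesis using v by (simp add: o_def)
    next
      case 3
      then have "veeM ms = Some (Nd ts)" using v by auto
      then show ?thesis by (simp add: o_def)
    qed (use v in \<open>simp add: veeT_def\<close>)
  qed
  ultimately show ?thesis by simp
qed

lemma sum_cop_Nd:
  fixes \<phi> :: "'x mono \<times> 'x mono \<Rightarrow> 'c::comm_monoid_add"
  shows "(\<Sum>q\<leftarrow>cop (Nd ts). \<phi> q) = (\<Sum>ps\<leftarrow>product_lists (map cop ts). \<phi> (veeT ps))"
  by (simp add: o_def)

text \<open>Cocommutativity. A sum over the splittings of a node is an iterated sum over its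
  subtrees, and the two sides can be exchanged in one subtree at a time, the others being part of
  the summed function.\<close>

lemma cop_commute:
  fixes \<phi> :: "'x mono \<Rightarrow> 'x mono \<Rightarrow> 'c::comm_monoid_add"
  shows "(\<Sum>(a, b)\<leftarrow>cop t. \<phi> a b) = (\<Sum>(a, b)\<leftarrow>cop t. \<phi> b a)"
proof (induction t arbitrary: \<phi>)
  case (Lf x)
  show ?case by (simp add: add.commute)
next
  case (Nd ts)
  have "(\<Sum>ps\<leftarrow>product_lists (map cop us). \<psi> (map fst ps) (map snd ps))
      = (\<Sum>ps\<leftarrow>product_lists (map cop us). \<psi> (map snd ps) (map fst ps))"
    if "set us \<subseteq> set ts" for us and \<psi> :: "'x mono list \<Rightarrow> 'x mono list \<Rightarrow> 'c"
    using that
  proof (induction us arbitrary: \<psi>)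
    case (Cons u us)
    have "(\<Sum>p\<leftarrow>cop u. \<Sum>ps\<leftarrow>product_lists (map cop us). \<psi> (fst p # map fst ps) (snd p # map snd ps))
      = (\<Sum>p\<leftarrow>cop u. \<Sum>ps\<leftarrow>product_lists (map cop us). \<psi> (fst p # map snd ps) (snd p # map fst ps))"
      using Cons.prems by (intro arg_cong[where f = sum_list] map_cong refl Cons.IH) auto
    also have "\<dots> = (\<Sum>p\<leftarrow>cop u. \<Sum>ps\<leftarrow>product_lists (map cop us). \<psi> (snd p # map snd ps) (fst p # map fst ps))"
      using Nd.IH[of u "\<lambda>a b. \<Sum>ps\<leftarrow>product_lists (map cop us). \<psi> (a # map snd ps) (b # map fst ps)"]
        Cons.prems by (simp add: case_prod_unfold)
    finally show ?case by (simp add: sum_product_lists_Cons del: product_lists.simps)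
  qed simp
  from this[of ts "\<lambda>u v. \<phi> (veeM u) (veeM v)"] show ?case
    unfolding sum_cop_Nd by (simp add: veeT_def)
qed

lemma copm_commute:
  fixes \<phi> :: "'x mono \<Rightarrow> 'x mono \<Rightarrow> 'c::comm_monoid_add"
  shows "(\<Sum>(a, b)\<leftarrow>copm m. \<phi> a b) = (\<Sum>(a, b)\<leftarrow>copm m. \<phi> b a)"
  using cop_commute by (cases m) auto

text \<open>Coassociativity and cocommutativity in one law. It yields left commutativity of the
  shuffle product, which together with commutativity gives associativity. As before, the exchange is
  made in one subtree at a time.\<close>

lemma cop_left_commute:
  fixes \<phi> :: "'x mono \<Rightarrow> 'x mono \<Rightarrow> 'x mono \<Rightarrow> 'c::comm_monoid_add"
  shows "(\<Sum>(a, q)\<leftarrow>cop t. \<Sum>(b, c)\<leftarrow>copm q. \<phi> a b c) = (\<Sum>(a, q)\<leftarrow>cop t. \<Sum>(b, c)\<leftarrow>copm q. \<phi> b a c)"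
proof (induction t arbitrary: \<phi>)
  case (Lf x)
  show ?case by (simp add: ac_simps)
next
  case (Nd ts)
  define L where "L us \<psi> = (\<Sum>ps\<leftarrow>product_lists (map cop us). \<Sum>rs\<leftarrow>product_lists (map copm (map snd ps)).
      \<psi> (map fst ps) (map fst rs) (map snd rs))" for us and \<psi> :: "'x mono list \<Rightarrow> 'x mono list \<Rightarrow> 'x mono list \<Rightarrow> 'c"
  \<comment> \<open>Both splittings of the head are summed first, so that those of the tail become
    part of the function to which the hypothesis for \<open>u\<close> applies.\<close>
  have L_Cons: "L (u # us) \<psi> = (\<Sum>p\<leftarrow>cop u. \<Sum>r\<leftarrow>copm (snd p). L us (\<lambda>as bs cs. \<psi> (fst p # as) (fst r # bs) (snd r # cs)))"
    for u us \<psi>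
    unfolding L_def
    by (simp add: sum_product_lists_Cons del: product_lists.simps, subst sum_list_exchange, rule refl)
  have "L us \<psi> = L us (\<lambda>a b. \<psi> b a)" if "set us \<subseteq> set ts" for us \<psi>
    using that
  proof (induction us arbitrary: \<psi>)
    case (Cons u us)
    have "L (u # us) \<psi> = (\<Sum>p\<leftarrow>cop u. \<Sum>r\<leftarrow>copm (snd p). L us (\<lambda>as bs cs. \<psi> (fst p # bs) (fst r # as) (snd r # cs)))"
      unfolding L_Cons
      using Cons.prems by (intro arg_cong[where f = sum_list] map_cong refl Cons.IH) auto
    also have "\<dots> = (\<Sum>p\<leftarrow>cop u. \<Sum>r\<leftarrow>copm (snd p). L us (\<lambda>as bs cs. \<psi> (fst r # bs) (fst p # as) (snd r # cs)))"
      using Nd.IH[of u "\<lambda>a b c. L us (\<lambda>as bs cs. \<psi> (a # bs) (b # as) (c # cs))"] Cons.prems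
      by (simp add: case_prod_unfold)
    finally show ?case by (simp add: L_Cons)
  qed (simp add: L_def)
  from this[of ts "\<lambda>u v w. \<phi> (veeM u) (veeM v) (veeM w)"] show ?case
    unfolding sum_cop_Nd case_prod_unfold L_def veeT_def fst_conv snd_conv sum_copm_veeM by simp
qed

lemma copm_left_commute:
  fixes \<phi> :: "'x mono \<Rightarrow> 'x mono \<Rightarrow> 'x mono \<Rightarrow> 'c::comm_monoid_add"
  shows "(\<Sum>(a, q)\<leftarrow>copm m. \<Sum>(b, c)\<leftarrow>copm q. \<phi> a b c) = (\<Sum>(a, q)\<leftarrow>copm m. \<Sum>(b, c)\<leftarrow>copm q. \<phi> b a c)"
  using cop_left_commute by (cases m) auto

section \<open>Leaf multisets, the two monomial bases, the counit and finiteness\<close>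

lemma cop_cont: "(a, b) \<in> set (cop t) \<Longrightarrow> cont a + cont b = mset (leaves t)"
proof (induction t arbitrary: a b)
  case (Nd ts)
  then obtain ps where ps: "ps \<in> set (product_lists (map cop ts))" "a = veeM (map fst ps)" "b = veeM (map snd ps)"
    by (auto simp: veeT_def)
  have "ps \<in> set (product_lists (map cop us)) \<Longrightarrow> set us \<subseteq> set ts \<Longrightarrow>
      (\<Sum>m\<leftarrow>map fst ps. cont m) + (\<Sum>m\<leftarrow>map snd ps. cont m) = mset (concat (map leaves us))" for us
  proof (induction us arbitrary: ps)
    case (Cons u us)
    then obtain p ps' where p: "ps = p # ps'" "p \<in> set (cop u)" "ps' \<in> set (product_lists (map cop us))"
      by auto
    have "cont (fst p) + cont (snd p) = mset (leaves u)"
      using Nd.IH[of u "fst p" "snd p"] p Cons.prems by auto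
    moreover have "(\<Sum>m\<leftarrow>map fst ps'. cont m) + (\<Sum>m\<leftarrow>map snd ps'. cont m) = mset (concat (map leaves us))"
      using Cons.IH[OF p(3)] Cons.prems by simp
    moreover have "(a + x) + (b + y) = (a + b) + (x + y)" for a b x y :: "'a multiset"
      by (simp add: ac_simps)
    ultimately show ?case
      unfolding p(1) list.map sum_list.Cons concat.simps mset_append by metis
  qed simp
  from this[OF ps(1)] show ?case by (simp add: ps cont_veeM)
qed auto

lemma copm_cont: "(a, b) \<in> set (copm m) \<Longrightarrow> cont a + cont b = cont m"
  using cop_cont by (cases m) auto

lemma mon_basis_None [simp]: "None \<in> mon_basis omega"
  by (simp add: mon_basis_def)

lemma mon_basis_Lf [simp]: "Some (Lf x) \<in> mon_basis omega"
  by (simp add: mon_basis_def)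

text \<open>The two monomial bases differ only in the allowed arities, so one induction serves both
  algebras.\<close>

lemma mon_basis_Nd:
  "Some (Nd ts) \<in> mon_basis omega \<longleftrightarrow>
     2 \<le> length ts \<and> (\<not> omega \<longrightarrow> length ts = 2) \<and> (\<forall>t\<in>set ts. Some t \<in> mon_basis omega)"
  by (auto simp: mon_basis_def list_all_iff image_iff)

lemma mon_basis_Nd_length: "Some (Nd ts) \<in> mon_basis omega \<Longrightarrow> 2 \<le> length ts"
  by (simp add: mon_basis_Nd)

text \<open>Omitting units can only shorten the argument list; from at most two arguments it leaves
  1, a single tree or a binary node.\<close>

lemma mon_basis_veeM:
  assumes "set ms \<subseteq> mon_basis omega" "\<not> omega \<Longrightarrow> length ms \<le> 2"
  shows "veeM ms \<in> mon_basis omega"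
proof -
  define ts where "ts = map the (filter (\<lambda>m. m \<noteq> None) ms)"
  have l: "length ts \<le> length ms" by (simp add: ts_def)
  have b: "\<forall>t\<in>set ts. Some t \<in> mon_basis omega"
    using assms(1) by (auto simp: ts_def)
  have v: "veeM ms = (if ts = [] then None else if length ts = 1 then Some (hd ts) else Some (Nd ts))"
    unfolding veeM_def ts_def[symmetric] Let_def by simp
  show ?thesis
  proof (cases "length ts \<ge> 2")
    case True
    then have "veeM ms = Some (Nd ts)" using v by auto
    then show ?thesis using b True l assms(2) by (auto simp: mon_basis_Nd)
  next
    case False
    then consider "ts = []" | t where "ts = [t]"
      by (cases ts) (auto simp: numeral_2_eq_2 not_le less_Suc_eq)
    then show ?thesis using b v by cases auto
  qed
qed

lemma cop_mon_basis:
  "Some t \<in> mon_basis omega \<Longrightarrow> (a, b) \<in> set (cop t) \<Longrightarrow> a \<in> mon_basis omega \<and> b \<in> mon_basis omega"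
proof (induction t arbitrary: a b)
  case (Nd ts)
  then obtain ps where ps: "ps \<in> set (product_lists (map cop ts))" "a = veeM (map fst ps)" "b = veeM (map snd ps)"
    by (auto simp: veeT_def)
  have len: "length ps = length ts"
    using in_set_product_lists_length[OF ps(1)] by simp
  have sub: "\<forall>t\<in>set ts. Some t \<in> mon_basis omega" and two: "\<not> omega \<Longrightarrow> length ts = 2"
    using Nd.prems(1) by (auto simp: mon_basis_Nd)
  have mem: "fst p \<in> mon_basis omega \<and> snd p \<in> mon_basis omega" if p: "p \<in> set ps" for p
  proof -
    have l: "list_all2 (\<lambda>x ys. x \<in> set ys) ps (map cop ts)"
      using ps(1) by (simp add: product_lists_set)
    obtain i where i: "i < length ps" "p = ps ! i"
      using p by (auto simp: in_set_conv_nth)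
    define t where "t = ts ! i"
    have t: "t \<in> set ts" "p \<in> set (cop t)"
      using list_all2_nthD[OF l i(1)] i len by (simp_all add: t_def)
    show ?thesis
      by (rule Nd.IH[OF t(1)]) (use t sub in simp_all)
  qed
  have "veeM (map fst ps) \<in> mon_basis omega"
    by (rule mon_basis_veeM) (use mem len two in auto)
  moreover have "veeM (map snd ps) \<in> mon_basis omega"
    by (rule mon_basis_veeM) (use mem len two in auto)
  ultimately show ?case by (simp add: ps)
qed auto

lemma copm_mon_basis:
  "m \<in> mon_basis omega \<Longrightarrow> (a, b) \<in> set (copm m) \<Longrightarrow> a \<in> mon_basis omega \<and> b \<in> mon_basis omega"
  using cop_mon_basis by (cases m) auto

text \<open>The counit law. A component of a node is empty exactly when all its subtree components
  are, so the filter acts factorwise and leaves the single choice with every subtree on the left.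
  Arity at least two ensures that regrafting restores the node.\<close>

lemma cop_counit:
  "Some t \<in> mon_basis omega \<Longrightarrow> filter (\<lambda>p. snd p = None) (cop t) = [(Some t, None)]"
proof (induction t)
  case (Nd ts)
  have "filter (\<lambda>p. snd p = None) (cop (Nd ts)) = map veeT (filter (list_all (\<lambda>p. snd p = None)) (product_lists (map cop ts)))"
    by (simp add: filter_map o_def veeT_def veeM_None_iff list.pred_map)
  also have "\<dots> = map veeT (product_lists (map (\<lambda>t. [(Some t, None)]) ts))"
    unfolding filter_product_lists map_map o_def
    using Nd by (intro arg_cong[where f = "map veeT"] arg_cong[where f = product_lists] map_cong) (auto simp: mon_basis_Nd)
  also have "product_lists (map (\<lambda>t. [(Some t, None)]) ts) = [map (\<lambda>t. (Some t, None :: 'a mono)) ts]"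
    by (induction ts) auto
  finally show ?case
    using mon_basis_Nd_length[OF Nd.prems] by (simp add: veeT_def o_def veeM_map_Some veeM_None_iff list_all_iff)
qed simp

lemma copm_counit:
  "m \<in> mon_basis omega \<Longrightarrow> filter (\<lambda>p. snd p = None) (copm m) = [(m, None)]"
  using cop_counit by (cases m) auto

lemma mon_basis_leaves_nonempty: "Some t \<in> mon_basis omega \<Longrightarrow> leaves t \<noteq> []"
proof (induction t)
  case (Nd ts)
  then show ?case by (cases ts) (auto simp: mon_basis_Nd)
qed simp

lemma cont_eq_empty_iff: "m \<in> mon_basis omega \<Longrightarrow> cont m = {#} \<longleftrightarrow> m = None"
  using mon_basis_leaves_nonempty by (cases m) auto

lemma mdeg_eq_0_iff: "m \<in> mon_basis omega \<Longrightarrow> mdeg m = 0 \<longleftrightarrow> m = None"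
  by (metis cont_eq_empty_iff size_cont size_eq_0_iff_empty)

text \<open>Every child of a node has fewer leaves than the node, because there is another child and
  it carries at least one leaf; for the same reason the number of children is bounded by the number
  of leaves.\<close>

lemma finite_trees:
  assumes "finite F"
  shows "finite {t. Some t \<in> mon_basis omega \<and> length (leaves t) \<le> n \<and> set (leaves t) \<subseteq> F}"
proof (induction n)
  case 0
  have "{t. Some t \<in> mon_basis omega \<and> length (leaves t) \<le> 0 \<and> set (leaves t) \<subseteq> F} = {}"
    using mon_basis_leaves_nonempty by auto
  then show ?case by (metis finite.emptyI)
next
  case (Suc n)
  let ?S = "\<lambda>n. {t. Some t \<in> mon_basis omega \<and> length (leaves t) \<le> n \<and> set (leaves t) \<subseteq> F}"
  have "?S (Suc n) \<subseteq> Lf ` F \<union> Nd ` {ts. set ts \<subseteq> ?S n \<and> length ts \<le> Suc n}"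
  proof
    fix t assume t: "t \<in> ?S (Suc n)"
    show "t \<in> Lf ` F \<union> Nd ` {ts. set ts \<subseteq> ?S n \<and> length ts \<le> Suc n}"
    proof (cases t)
      case (Nd ts)
      have b: "2 \<le> length ts" "\<forall>u\<in>set ts. Some u \<in> mon_basis omega"
        using t Nd by (auto simp: mon_basis_Nd)
      have ge: "length (concat (map leaves us)) \<ge> length us" if "set us \<subseteq> set ts" for us
        using that
      proof (induction us)
        case (Cons u us)
        have "length (leaves u) \<ge> 1"
          using mon_basis_leaves_nonempty[of u omega] b Cons.prems by (auto simp: Suc_le_eq)
        then show ?case using Cons by auto
      qed simp
      have "length (leaves u) \<le> n" if u: "u \<in> set ts" for u
      proof -
        obtain xs ys where ts: "ts = xs @ u # ys" using u by (meson split_list)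
        then have "length (concat (map leaves xs)) \<ge> length xs" "length (concat (map leaves ys)) \<ge> length ys"
          by (auto intro!: ge)
        moreover have "length xs + length ys \<ge> 1" using b ts by auto
        ultimately show ?thesis using t Nd ts by auto
      qed
      moreover have "length ts \<le> Suc n"
        using ge[OF order.refl] t Nd by auto
      moreover have "set (leaves u) \<subseteq> F" if "u \<in> set ts" for u
        using t Nd that by auto
      ultimately have "ts \<in> {ts. set ts \<subseteq> ?S n \<and> length ts \<le> Suc n}"
        using b by blast
      then show ?thesis using Nd by blast
    qed (use t in auto)
  qed
  moreover have "finite {ts. set ts \<subseteq> ?S n \<and> length ts \<le> Suc n}"
    using Suc.IH by (rule finite_lists_length_le)
  ultimately show ?case
    by (rule finite_subset[OF _ finite_UnI[OF finite_imageI[OF assms] finite_imageI]])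
qed

text \<open>A leaf multiset mentions finitely many variables, even if X is infinite, and fixes the
  number of leaves.\<close>

lemma finite_cont: "finite {m \<in> mon_basis omega. cont m = c}"
proof -
  have "{m \<in> mon_basis omega. cont m = c} \<subseteq>
      insert None (Some ` {t. Some t \<in> mon_basis omega \<and> length (leaves t) \<le> size c \<and> set (leaves t) \<subseteq> set_mset c})"
  proof
    fix m assume "m \<in> {m \<in> mon_basis omega. cont m = c}"
    then show "m \<in> insert None (Some ` {t. Some t \<in> mon_basis omega \<and> length (leaves t) \<le> size c \<and> set (leaves t) \<subseteq> set_mset c})"
      by (cases m) auto
  qed
  then show ?thesis
    by (rule finite_subset) (use finite_trees[of "set_mset c"] in auto)
qed

section \<open>The shuffle algebra\<close>

interpretation fv: vector_space "sc :: 'k::field \<Rightarrow> ('m \<Rightarrow> 'k) \<Rightarrow> ('m \<Rightarrow> 'k)"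
  by standard (auto simp: sc_def algebra_simps fun_eq_iff)

lemma sc_apply [simp]: "sc c f x = c * f x"
  by (simp add: sc_def)

lemma supp_delta [simp]: "supp (delta m :: 'm \<Rightarrow> 'k::zero_neq_one) = {m}"
  by (auto simp: supp_def delta_def)

lemma delta_same [simp]: "delta m m = 1"
  by (simp add: delta_def)

lemma sum_fun_apply: "(\<Sum>i\<in>I. f i) x = (\<Sum>i\<in>I. f i x)"
  by (induction I rule: infinite_finite_induct) auto

lemma pair_superset:
  assumes "finite S" "supp f \<subseteq> S"
  shows "pair f g = (\<Sum>m\<in>S. f m * g m)"
  unfolding pair_def using assms by (intro sum.mono_neutral_left) (auto simp: supp_def)

lemma pair_delta_left [simp]: "pair (delta m :: 'm \<Rightarrow> 'k::comm_ring_1) g = g m"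
  by (simp add: pair_def)

lemma pair_commute:
  assumes "finite (supp f)" "finite (supp g)"
  shows "pair f g = pair g f"
  using assms by (simp add: pair_superset[of "supp f \<union> supp g"] mult.commute)

lemma supp_add: "supp (f + g :: 'm \<Rightarrow> 'k::comm_ring_1) \<subseteq> supp f \<union> supp g"
  by (auto simp: supp_def)

lemma supp_sc: "supp (sc c f :: 'm \<Rightarrow> 'k::comm_ring_1) \<subseteq> supp f"
  by (auto simp: supp_def)

lemma pair_add_left:
  assumes "finite (supp f)" "finite (supp g)"
  shows "pair (f + g) h = pair f h + pair g h"
  using assms supp_add[of f g]
  by (simp add: pair_superset[of "supp f \<union> supp g"] distrib_right sum.distrib)

lemma pair_sc_left:
  assumes "finite (supp f)"
  shows "pair (sc c f) h = c * pair f h"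
  using assms supp_sc[of c f]
  by (simp add: pair_superset[of "supp f"] sum_distrib_left mult.assoc)

lemma pair_add_right: "pair f (\<lambda>m. g m + h m) = pair f g + pair f h"
  by (simp add: pair_def distrib_left sum.distrib)

lemma pair_zero_right [simp]: "pair f (\<lambda>m. 0) = 0"
  by (simp add: pair_def)

lemma pair_mult_right: "pair f (\<lambda>m. c * g m) = c * pair f g"
  by (simp add: pair_def sum_distrib_left mult.left_commute)

lemma pair_sum_list_right: "pair f (\<lambda>m. \<Sum>x\<leftarrow>xs. g x m) = (\<Sum>x\<leftarrow>xs. pair f (g x))"
  by (induction xs) (simp_all add: pair_add_right)

lemma pair_sum_right: "pair f (\<lambda>m. \<Sum>x\<in>X. g x m) = (\<Sum>x\<in>X. pair f (g x))"
  by (induction X rule: infinite_finite_induct) (simp_all add: pair_add_right)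

section \<open>Multilinear extension as iterated pairing\<close>

text \<open>The linear extension of \<open>\<phi>\<close> evaluated at the tensor product of the functions in a list.\<close>

primrec mlev :: "('m \<Rightarrow> 'k::comm_ring_1) list \<Rightarrow> ('m list \<Rightarrow> 'k) \<Rightarrow> 'k" where
  "mlev [] \<phi> = \<phi> []"
| "mlev (f # fs) \<phi> = pair f (\<lambda>m. mlev fs (\<lambda>ms. \<phi> (m # ms)))"

lemma finite_listset: "(\<And>A. A \<in> set As \<Longrightarrow> finite A) \<Longrightarrow> finite (listset As)"
proof (induction As)
  case (Cons A As)
  have "listset (A # As) = (\<lambda>(x, xs). x # xs) ` (A \<times> listset As)"
    by (auto simp: set_Cons_def)
  then show ?case using Cons by simp
qed simp

text \<open>Turns the sum over \<open>listset\<close> into iterated pairings, which allow induction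
  over the list of arguments.\<close>

lemma sum_listset_eq_mlev:
  "(\<Sum>ms\<in>listset (map supp fs). (\<Prod>i<length fs. (fs ! i) (ms ! i)) * \<phi> ms) = mlev fs \<phi>"
proof (induction fs arbitrary: \<phi>)
  case (Cons f fs)
  let ?L = "listset (map supp fs)"
  have L: "listset (map supp (f # fs)) = (\<lambda>(x, xs). x # xs) ` (supp f \<times> ?L)"
    by (auto simp: set_Cons_def)
  have "(\<Sum>ms\<in>listset (map supp (f # fs)). (\<Prod>i<length (f # fs). ((f # fs) ! i) (ms ! i)) * \<phi> ms)
      = (\<Sum>(x, xs)\<in>supp f \<times> ?L. f x * ((\<Prod>i<length fs. (fs ! i) (xs ! i)) * \<phi> (x # xs)))"
    unfolding L by (subst sum.reindex) (auto simp: inj_on_def prod.lessThan_Suc_shift case_prod_unfold mult.assoc simp del: prod.lessThan_Suc)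
  also have "\<dots> = (\<Sum>x\<in>supp f. f x * mlev fs (\<lambda>ms. \<phi> (x # ms)))"
    by (simp add: sum.cartesian_product[symmetric] Cons sum_distrib_left[symmetric])
  finally show ?case by (simp add: pair_def)
qed simp

lemma mlext_eq_mlev: "mlext op fs m = mlev fs (\<lambda>ms. if op ms = m then 1 else 0)"
  unfolding mlext_def by (rule sum_listset_eq_mlev)

lemma mlev_delta: "mlev (map delta ms) \<phi> = \<phi> ms"
  by (induction ms arbitrary: \<phi>) simp_all

lemma mlext_delta: "mlext op (map delta ms) = (delta (op ms) :: _ \<Rightarrow> 'k::comm_ring_1)"
  by (auto simp: mlext_eq_mlev mlev_delta delta_def)

lemma supp_mlext_subset: "supp (mlext op fs) \<subseteq> op ` listset (map supp fs)"
proof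
  fix m assume "m \<in> supp (mlext op fs)"
  then obtain ms where "ms \<in> listset (map supp fs)"
      "(\<Prod>i<length fs. (fs ! i) (ms ! i)) * (if op ms = m then 1 else 0) \<noteq> 0"
    unfolding supp_def mlext_def mem_Collect_eq by (rule sum.not_neutral_contains_not_neutral)
  then show "m \<in> op ` listset (map supp fs)" by (auto split: if_splits)
qed

lemma pair_mlext:
  assumes "\<And>f. f \<in> set fs \<Longrightarrow> finite (supp f)"
  shows "pair (mlext op fs) \<psi> = mlev fs (\<lambda>ms. \<psi> (op ms))"
proof -
  let ?L = "listset (map supp fs)" and ?c = "\<lambda>ms. \<Prod>i<length fs. (fs ! i) (ms ! i)"
  have fin: "finite ?L" using assms by (auto intro!: finite_listset)
  have "pair (mlext op fs) \<psi> = (\<Sum>m\<in>op ` ?L. mlext op fs m * \<psi> m)"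
    by (intro pair_superset finite_imageI fin supp_mlext_subset)
  also have "\<dots> = (\<Sum>m\<in>op ` ?L. \<Sum>ms\<in>?L. if op ms = m then ?c ms * \<psi> m else 0)"
    unfolding mlext_def sum_distrib_right by (intro sum.cong refl) auto
  also have "\<dots> = (\<Sum>ms\<in>?L. \<Sum>m\<in>op ` ?L. if op ms = m then ?c ms * \<psi> m else 0)"
    by (rule sum.swap)
  also have "\<dots> = (\<Sum>ms\<in>?L. ?c ms * \<psi> (op ms))"
    using fin by (intro sum.cong refl) (simp add: sum.delta)
  finally show ?thesis by (simp add: sum_listset_eq_mlev)
qed

lemma mlev_add: "mlev fs (\<lambda>ms. \<phi> ms + \<psi> ms) = mlev fs \<phi> + mlev fs \<psi>"
  by (induction fs arbitrary: \<phi> \<psi>) (simp_all add: pair_add_right)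

lemma mlev_zero: "mlev fs (\<lambda>ms. 0) = 0"
  by (induction fs) simp_all

lemma mlev_sum_list: "mlev fs (\<lambda>ms. \<Sum>x\<leftarrow>xs. \<phi> x ms) = (\<Sum>x\<leftarrow>xs. mlev fs (\<phi> x))"
  by (induction xs) (simp_all add: mlev_zero mlev_add)

section \<open>Existence and uniqueness of the co-addition\<close>

lemma sum_list_conv_count:
  fixes \<phi> :: "'a \<Rightarrow> 'k::comm_ring_1"
  assumes "finite X" "set xs \<subseteq> X"
  shows "(\<Sum>x\<leftarrow>xs. \<phi> x) = (\<Sum>x\<in>X. of_nat (count_list xs x) * \<phi> x)"
  using assms(2)
proof (induction xs)
  case (Cons y xs)
  have "(\<Sum>x\<in>X. of_nat (count_list (y # xs) x) * \<phi> x)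
      = (\<Sum>x\<in>X. of_nat (count_list xs x) * \<phi> x + (if y = x then \<phi> x else 0))"
    by (intro sum.cong refl) (auto simp: algebra_simps)
  then show ?case using Cons assms(1) by (simp add: sum.distrib)
qed simp

lemma of_nat_count_list: "of_nat (count_list xs x) = (\<Sum>y\<leftarrow>xs. if y = x then 1 else (0::'k::comm_ring_1))"
  by (induction xs) simp_all

text \<open>The explicit co-addition: a monomial goes to the sum of its splittings, so the
  coefficient of a pair is its multiplicity in \<open>copm\<close>.\<close>

definition coa :: "('x mono \<Rightarrow> 'k::comm_ring_1) \<Rightarrow> ('x mono \<times> 'x mono \<Rightarrow> 'k)" where
  "coa f = (\<lambda>x. pair f (\<lambda>m. of_nat (count_list (copm m) x)))"

lemma coa_delta: "coa (delta m :: _ \<Rightarrow> 'k::comm_ring_1) = (\<lambda>x. of_nat (count_list (copm m) x))"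
  by (simp add: coa_def)

lemma supp_coa: "supp (coa f) \<subseteq> (\<Union>m\<in>supp f. set (copm m))"
proof
  fix x assume "x \<in> supp (coa f)"
  then have "(\<Sum>m\<in>supp f. f m * of_nat (count_list (copm m) x)) \<noteq> 0"
    by (simp add: supp_def coa_def pair_def)
  then obtain m where "m \<in> supp f" "f m * of_nat (count_list (copm m) x) \<noteq> 0"
    by (rule sum.not_neutral_contains_not_neutral)
  then show "x \<in> (\<Union>m\<in>supp f. set (copm m))"
    by (auto intro!: bexI[of _ m]) (metis count_notin mult_zero_right of_nat_0)
qed

text \<open>Moves statements about the tensor square back to sums over lists of splittings.\<close>

lemma pair_coa:
  assumes "finite (supp f)"
  shows "pair (coa f) \<psi> = pair f (\<lambda>m. \<Sum>x\<leftarrow>copm m. \<psi> x)"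
proof -
  let ?X = "\<Union>m\<in>supp f. set (copm m)"
  have X: "finite ?X" using assms by auto
  have "pair (coa f) \<psi> = (\<Sum>x\<in>?X. coa f x * \<psi> x)"
    by (rule pair_superset[OF X supp_coa])
  also have "\<dots> = (\<Sum>x\<in>?X. \<Sum>m\<in>supp f. f m * (of_nat (count_list (copm m) x) * \<psi> x))"
    by (simp add: coa_def pair_def sum_distrib_right mult.assoc)
  also have "\<dots> = (\<Sum>m\<in>supp f. f m * (\<Sum>x\<in>?X. of_nat (count_list (copm m) x) * \<psi> x))"
    by (subst sum.swap) (simp add: sum_distrib_left)
  also have "\<dots> = (\<Sum>m\<in>supp f. f m * (\<Sum>x\<leftarrow>copm m. \<psi> x))"
    by (intro sum.cong refl arg_cong2[where f = "(*)"] sum_list_conv_count[symmetric] X) auto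
  finally show ?thesis by (simp add: pair_def)
qed

lemma mlev_coa:
  assumes "\<And>f. f \<in> set fs \<Longrightarrow> finite (supp f)"
  shows "mlev (map coa fs) \<psi> = mlev fs (\<lambda>ms. \<Sum>ps\<leftarrow>product_lists (map copm ms). \<psi> ps)"
  using assms
proof (induction fs arbitrary: \<psi>)
  case (Cons f fs)
  then show ?case
    by (simp add: pair_coa sum_product_lists_Cons mlev_sum_list del: product_lists.simps)
qed simp

lemma Aspace_finite: "f \<in> Aspace omega \<Longrightarrow> finite (supp f)"
  by (simp add: Aspace_def)

lemma Aspace_outside: "f \<in> Aspace omega \<Longrightarrow> m \<notin> mon_basis omega \<Longrightarrow> f m = 0"
  by (auto simp: Aspace_def supp_def)

lemma subspace_Aspace: "fv.subspace (Aspace omega :: ('x mono \<Rightarrow> 'k::field) set)"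
proof (rule fv.subspaceI)
  show "0 \<in> (Aspace omega :: ('x mono \<Rightarrow> 'k) set)" by (simp add: Aspace_def supp_def)
  fix f g :: "'x mono \<Rightarrow> 'k" and c
  assume "f \<in> Aspace omega" "g \<in> Aspace omega"
  then show "f + g \<in> Aspace omega"
    using supp_add[of f g] by (auto simp: Aspace_def intro: finite_subset)
next
  fix f :: "'x mono \<Rightarrow> 'k" and c
  assume "f \<in> Aspace omega"
  then show "sc c f \<in> Aspace omega"
    using supp_sc[of c f] by (auto simp: Aspace_def intro: finite_subset)
qed

lemma delta_in_Aspace [simp]: "(delta m :: _ \<Rightarrow> 'k::field) \<in> Aspace omega \<longleftrightarrow> m \<in> mon_basis omega"
  by (auto simp: Aspace_def)

text \<open>Existence. Both sides of the homomorphism property are multilinear in the arguments, and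
  on monomials they agree by \<open>sum_copm_veeM\<close>.\<close>

lemma is_coadd_coa: "is_coadd omega (coa :: ('x mono \<Rightarrow> 'k::field) \<Rightarrow> _)"
  unfolding is_coadd_def
proof (intro conjI ballI allI impI)
  fix f g :: "'x mono \<Rightarrow> 'k" and c
  assume "f \<in> Aspace omega" "g \<in> Aspace omega"
  then show "coa (f + g) = coa f + coa g" "coa (sc c f) = sc c (coa f)"
    by (auto simp: coa_def pair_add_left pair_sc_left Aspace_finite fun_eq_iff)
next
  show "coa (delta None :: 'x mono \<Rightarrow> 'k) = delta (None, None)"
    unfolding coa_delta by (auto simp: delta_def fun_eq_iff)
next
  fix x :: 'x
  show "coa (delta (Some (Lf x)) :: 'x mono \<Rightarrow> 'k) = delta (Some (Lf x), None) + delta (None, Some (Lf x))"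
    unfolding coa_delta by (auto simp: delta_def fun_eq_iff)
next
  fix fs :: "('x mono \<Rightarrow> 'k) list"
  assume "set fs \<subseteq> Aspace omega \<and> 2 \<le> length fs \<and> (\<not> omega \<longrightarrow> length fs = 2)"
  then have fin: "finite (supp f)" if "f \<in> set fs" for f using that Aspace_finite by blast
  show "coa (mlext veeM fs) = mlext veeT (map coa fs)"
  proof
    fix x
    have "coa (mlext veeM fs) x = mlev fs (\<lambda>ms. of_nat (count_list (copm (veeM ms)) x))"
      unfolding coa_def by (rule pair_mlext[OF fin])
    also have "\<dots> = mlev fs (\<lambda>ms. \<Sum>ps\<leftarrow>product_lists (map copm ms). if veeT ps = x then 1 else 0)"
      by (simp add: of_nat_count_list sum_copm_veeM)
    also have "\<dots> = mlext veeT (map coa fs) x"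
      unfolding mlext_eq_mlev by (rule mlev_coa[OF fin, symmetric])
    finally show "coa (mlext veeM fs) x = mlext veeT (map coa fs) x" .
  qed
qed

lemma is_coadd_coadd: "is_coadd omega (coadd omega :: ('x mono \<Rightarrow> 'k::field) \<Rightarrow> _)"
  unfolding coadd_def by (rule someI[where P = "is_coadd omega", OF is_coadd_coa])

lemma is_coadd_unique_delta:
  fixes D D' :: "('x mono \<Rightarrow> 'k::field) \<Rightarrow> ('x mono \<times> 'x mono \<Rightarrow> 'k)"
  assumes D: "is_coadd omega D" and D': "is_coadd omega D'"
  shows "Some t \<in> mon_basis omega \<Longrightarrow> D (delta (Some t)) = D' (delta (Some t))"
proof (induction t)
  case (Lf x)
  then show ?case using D D' by (simp add: is_coadd_def)
next
  case (Nd ts)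
  define fs where "fs = map (\<lambda>t. delta (Some t) :: 'x mono \<Rightarrow> 'k) ts"
  have b: "2 \<le> length ts" "\<not> omega \<longrightarrow> length ts = 2" "\<forall>t\<in>set ts. Some t \<in> mon_basis omega"
    using Nd.prems by (auto simp: mon_basis_Nd)
  have fs: "set fs \<subseteq> Aspace omega \<and> 2 \<le> length fs \<and> (\<not> omega \<longrightarrow> length fs = 2)"
    using b by (auto simp: fs_def)
  have "fs = map delta (map Some ts)" by (simp add: fs_def)
  then have "mlext veeM fs = delta (Some (Nd ts))"
    using b(1) by (simp only: mlext_delta veeM_map_Some)
  moreover have "D (mlext veeM fs) = mlext veeT (map D fs)" "D' (mlext veeM fs) = mlext veeT (map D' fs)"
    using D D' fs unfolding is_coadd_def by blast+
  moreover have "map D fs = map D' fs"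
    using Nd.IH b(3) by (simp add: fs_def)
  ultimately show ?case by simp
qed

text \<open>The conditions of \<open>is_coadd\<close> concern only functions in
  \<open>Aspace\<close>, so nothing is claimed about the chosen \<open>coadd\<close> elsewhere.
  Linearity reduces to monomials, which grafting builds from the variables.\<close>

lemma is_coadd_unique:
  fixes D D' :: "('x mono \<Rightarrow> 'k::field) \<Rightarrow> ('x mono \<times> 'x mono \<Rightarrow> 'k)"
  assumes D: "is_coadd omega D" and D': "is_coadd omega D'" and f: "f \<in> Aspace omega"
  shows "D f = D' f"
proof -
  have del: "D (delta m) = D' (delta m)" if "m \<in> mon_basis omega" for m
    using that is_coadd_unique_delta[OF D D'] D D' by (cases m) (auto simp: is_coadd_def)
  have add: "D (f + g) = D f + D g" "D' (f + g) = D' f + D' g"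
    and scl: "D (sc c f) = sc c (D f)" "D' (sc c f) = sc c (D' f)"
    if "f \<in> Aspace omega" "g \<in> Aspace omega" for f g c
    using D D' that unfolding is_coadd_def by blast+
  have "finite S \<Longrightarrow> supp f = S \<Longrightarrow> f \<in> Aspace omega \<Longrightarrow> D f = D' f" for S f
  proof (induction S arbitrary: f rule: finite_induct)
    case empty
    then have "f = sc 0 f" by (auto simp: supp_def fun_eq_iff)
    moreover have "D (sc 0 f) = D' (sc 0 f)"
      unfolding scl[OF empty.prems(2) empty.prems(2)] by (simp add: fun_eq_iff)
    ultimately show ?case by metis
  next
    case (insert m S)
    define g where "g = f(m := 0)"
    have g: "supp g = S" using insert by (auto simp: g_def supp_def)
    have m: "m \<in> mon_basis omega" using insert.prems by (auto simp: Aspace_def)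
    have gA: "g \<in> Aspace omega"
      using insert.prems insert.hyps g by (auto simp: Aspace_def)
    have dA: "delta m \<in> Aspace omega" "sc (f m) (delta m) \<in> Aspace omega"
      using m subspace_Aspace[of omega] by (auto intro: fv.subspace_scale)
    have f: "f = g + sc (f m) (delta m)"
      by (auto simp: g_def delta_def fun_eq_iff)
    have "D g = D' g" by (rule insert.IH[OF g gA])
    then have "D (g + sc (f m) (delta m)) = D' (g + sc (f m) (delta m))"
      using add[OF gA dA(2)] scl[OF dA(1) dA(1)] del[OF m] by simp
    then show ?case using f by metis
  qed
  then show ?thesis using f Aspace_finite by blast
qed

lemma coadd_eq: "f \<in> Aspace omega \<Longrightarrow> coadd omega f = coa f"
  by (rule is_coadd_unique[OF is_coadd_coadd is_coadd_coa])

text \<open>A version of the shuffle product without finiteness conditions: a monomial has finitely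
  many splittings, so the algebra laws hold for all functions, whereas \<open>pair\<close> in
  \<open>shuffle\<close> sums over a support.\<close>

definition sh :: "bool \<Rightarrow> ('x mono \<Rightarrow> 'k::comm_ring_1) \<Rightarrow> ('x mono \<Rightarrow> 'k) \<Rightarrow> ('x mono \<Rightarrow> 'k)" where
  "sh omega f g = (\<lambda>h. if h \<in> mon_basis omega then \<Sum>(a, b)\<leftarrow>copm h. f a * g b else 0)"

lemma sh_apply: "h \<in> mon_basis omega \<Longrightarrow> sh omega f g h = (\<Sum>(a, b)\<leftarrow>copm h. f a * g b)"
  by (simp add: sh_def)

lemma sh_outside: "h \<notin> mon_basis omega \<Longrightarrow> sh omega f g h = 0"
  by (simp add: sh_def)

lemma supp_tens: "supp (tens f g :: _ \<Rightarrow> 'k::field) = supp f \<times> supp g"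
  by (auto simp: supp_def tens_def)

lemma shuffle_eq_sh:
  fixes f g :: "'x mono \<Rightarrow> 'k::field"
  assumes "finite (supp f)" "finite (supp g)"
  shows "shuffle omega f g = sh omega f g"
proof
  fix h
  show "shuffle omega f g h = sh omega f g h"
  proof (cases "h \<in> mon_basis omega")
    case True
    let ?S = "supp (tens f g) \<union> set (copm h)"
    have fin: "finite ?S" using assms by (simp add: supp_tens)
    have "shuffle omega f g h = pair (tens f g) (\<lambda>x. of_nat (count_list (copm h) x))"
      using True by (simp add: shuffle_def coadd_eq coa_delta)
    also have "\<dots> = (\<Sum>x\<in>?S. of_nat (count_list (copm h) x) * tens f g x)"
      using fin by (subst pair_superset[of ?S]) (auto simp: mult.commute)
    also have "\<dots> = (\<Sum>x\<leftarrow>copm h. tens f g x)"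
      by (rule sum_list_conv_count[OF fin, symmetric]) simp
    finally show ?thesis using True by (simp add: sh_apply tens_def)
  qed (simp add: shuffle_def sh_def)
qed

lemma shuffle_infinite:
  fixes f g :: "'x mono \<Rightarrow> 'k::field"
  assumes "infinite (supp f) \<or> infinite (supp g)"
  shows "shuffle omega f g = 0"
proof -
  have "supp (tens f g) = {} \<or> infinite (supp (tens f g))"
    using assms unfolding supp_tens by (auto simp: finite_cartesian_product_iff)
  then show ?thesis by (auto simp: shuffle_def pair_def fun_eq_iff)
qed

lemma sh_commute: "sh omega f g = sh omega g f"
  unfolding sh_def using copm_commute[where \<phi> = "\<lambda>a b. f a * g b"] by (auto simp: mult.commute)

lemma sh_left_commute: "sh omega f (sh omega g h) = sh omega g (sh omega f h)"
proof
  fix m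
  show "sh omega f (sh omega g h) m = sh omega g (sh omega f h) m"
  proof (cases "m \<in> mon_basis omega")
    case True
    have *: "sh omega f (sh omega g h) m = (\<Sum>(a, q)\<leftarrow>copm m. \<Sum>(b, c)\<leftarrow>copm q. f a * g b * h c)" for f g
    proof -
      have "sh omega f (sh omega g h) m = (\<Sum>x\<leftarrow>copm m. f (fst x) * sh omega g h (snd x))"
        by (simp add: sh_apply[OF True] case_prod_unfold)
      also have "\<dots> = (\<Sum>x\<leftarrow>copm m. \<Sum>y\<leftarrow>copm (snd x). f (fst x) * g (fst y) * h (snd y))"
      proof (intro arg_cong[where f = sum_list] map_cong refl)
        fix x assume "x \<in> set (copm m)"
        then have "snd x \<in> mon_basis omega" using copm_mon_basis[OF True, of "fst x" "snd x"] by simp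
        then show "f (fst x) * sh omega g h (snd x) = (\<Sum>y\<leftarrow>copm (snd x). f (fst x) * g (fst y) * h (snd y))"
          by (simp add: sh_apply case_prod_unfold sum_list_const_mult mult.assoc)
      qed
      finally show ?thesis by (simp add: case_prod_unfold)
    qed
    show ?thesis
      unfolding * using copm_left_commute[of "\<lambda>a b c. f a * g b * h c" m]
      by (simp add: mult.commute)
  qed (simp add: sh_outside)
qed

lemma sh_assoc: "sh omega (sh omega f g) h = sh omega f (sh omega g h)"
  by (metis sh_commute sh_left_commute)

lemma sh_add_left: "sh omega (f + g) h = sh omega f h + sh omega g h"
  by (auto simp: sh_def fun_eq_iff case_prod_unfold distrib_right sum_list_addf)

lemma sh_sc_left: "sh omega (sc c f) h = sc c (sh omega f h)"
  by (auto simp: sh_def fun_eq_iff case_prod_unfold sum_list_const_mult mult.assoc)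

lemma sh_add_right: "sh omega h (f + g) = sh omega h f + sh omega h g"
  by (metis sh_add_left sh_commute)

lemma sh_sc_right: "sh omega h (sc c f) = sc c (sh omega h f)"
  by (metis sh_sc_left sh_commute)

lemma sh_zero_left [simp]: "sh omega 0 g = 0"
  by (auto simp: sh_def fun_eq_iff case_prod_unfold)

lemma sh_zero_right [simp]: "sh omega g 0 = 0"
  by (auto simp: sh_def fun_eq_iff case_prod_unfold)

lemma sh_sum_left: "sh omega (\<Sum>i\<in>I. f i) g = (\<Sum>i\<in>I. sh omega (f i) g)"
  by (induction I rule: infinite_finite_induct)
    (simp_all only: sum.infinite sum.empty sum.insert sh_add_left sh_zero_left not_False_eq_True)

lemma sum_list_counit:
  fixes \<psi> :: "'x mono \<Rightarrow> 'x mono \<Rightarrow> 'k::comm_monoid_add"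
  assumes m: "m \<in> mon_basis omega" and z: "\<And>a b. (a, b) \<in> set (copm m) \<Longrightarrow> b \<noteq> None \<Longrightarrow> \<psi> a b = 0"
  shows "(\<Sum>(a, b)\<leftarrow>copm m. \<psi> a b) = \<psi> m None"
proof -
  have "(\<Sum>x\<leftarrow>xs. \<psi> (fst x) (snd x)) = (\<Sum>x\<leftarrow>filter (\<lambda>p. snd p = None) xs. \<psi> (fst x) (snd x))"
    if "set xs \<subseteq> set (copm m)" for xs
    using that by (induction xs) (auto simp: z)
  from this[of "copm m"] show ?thesis
    using copm_counit[OF m] by (simp add: case_prod_unfold)
qed

lemma mdeg_add: "(a, b) \<in> set (copm m) \<Longrightarrow> mdeg a + mdeg b = mdeg m"
  using copm_cont by (metis size_cont size_union)

text \<open>Every splitting of \<open>m\<close> other than \<open>(m, 1)\<close> gives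
  \<open>f\<close> a monomial of smaller degree. This reads off the constant term of the second
  factor at the lowest degree of the first.\<close>

lemma sh_leading:
  assumes m: "m \<in> mon_basis omega"
    and f: "\<And>a. a \<in> mon_basis omega \<Longrightarrow> mdeg a < mdeg m \<Longrightarrow> f a = 0"
  shows "sh omega f g m = f m * g None"
  unfolding sh_apply[OF m]
proof (rule sum_list_counit[OF m])
  fix a b assume ab: "(a, b) \<in> set (copm m)" "b \<noteq> None"
  then have "a \<in> mon_basis omega" "b \<in> mon_basis omega" using copm_mon_basis[OF m] by blast+
  then have "mdeg a < mdeg m"
    using mdeg_add[OF ab(1)] mdeg_eq_0_iff[of b omega] ab(2) by auto
  then show "f a * g b = 0" using f \<open>a \<in> _\<close> by simp
qed

lemma sh_unit_right:
  assumes "\<And>m. m \<notin> mon_basis omega \<Longrightarrow> f m = 0"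
  shows "sh omega f (delta None) = f"
proof
  fix m
  show "sh omega f (delta None) m = f m"
  proof (cases "m \<in> mon_basis omega")
    case True
    have z: "f a * delta None b = 0" if "b \<noteq> None" for a b
      using that by (auto simp: delta_def)
    have "(\<Sum>(a, b)\<leftarrow>copm m. f a * delta None b) = f m"
      using sum_list_counit[OF True, of "\<lambda>a b. f a * delta None b", OF z] by simp
    then show ?thesis by (simp add: sh_apply[OF True])
  qed (simp add: sh_outside assms)
qed

lemma sh_None [simp]: "sh omega f g None = f None * g None"
  by (simp add: sh_def)

lemma sh_support:
  assumes "sh omega f g m \<noteq> 0"
  obtains a b where "f a \<noteq> 0" "g b \<noteq> 0" "(a, b) \<in> set (copm m)" "m \<in> mon_basis omega" "cont a + cont b = cont m"
proof -
  have m: "m \<in> mon_basis omega" using assms sh_outside by blast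
  have "\<exists>x\<in>set (copm m). f (fst x) * g (snd x) \<noteq> 0"
  proof (rule ccontr)
    assume "\<not> ?thesis"
    then have "map (\<lambda>x. f (fst x) * g (snd x)) (copm m) = map (\<lambda>x. 0) (copm m)"
      by (intro map_cong) auto
    then have "(\<Sum>x\<leftarrow>copm m. f (fst x) * g (snd x)) = 0"
      by (simp only: sum_list_0)
    then show False using assms by (simp add: sh_apply[OF m] case_prod_unfold)
  qed
  then obtain x where x: "x \<in> set (copm m)" "f (fst x) * g (snd x) \<noteq> 0" by blast
  show thesis
    by (rule that[of "fst x" "snd x"]) (use x m copm_cont[of "fst x" "snd x" m] in auto)
qed

text \<open>The leaf multisets occurring in a shuffle are sums of those of the factors, hence finite
  in number, and each belongs to finitely many monomials.\<close>

lemma finite_supp_sh: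
  assumes "finite (supp f)" "finite (supp g)"
  shows "finite (supp (sh omega f g))"
proof -
  have "supp (sh omega f g) \<subseteq> (\<Union>(a, b)\<in>supp f \<times> supp g. {m \<in> mon_basis omega. cont m = cont a + cont b})"
  proof
    fix m assume "m \<in> supp (sh omega f g)"
    then have "sh omega f g m \<noteq> 0" by (simp add: supp_def)
    then obtain a b where "f a \<noteq> 0" "g b \<noteq> 0" "m \<in> mon_basis omega" "cont a + cont b = cont m"
      by (rule sh_support)
    then show "m \<in> (\<Union>(a, b)\<in>supp f \<times> supp g. {m \<in> mon_basis omega. cont m = cont a + cont b})"
      by (force simp: supp_def)
  qed
  then show ?thesis
    by (rule finite_subset) (use assms in \<open>auto intro!: finite_cont\<close>)
qed

lemma sh_in_Aspace:
  fixes f g :: "'x mono \<Rightarrow> 'k::field"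
  assumes "f \<in> Aspace omega" "g \<in> Aspace omega"
  shows "sh omega f g \<in> Aspace omega"
proof -
  have "finite (supp (sh omega f g))"
    using assms by (intro finite_supp_sh Aspace_finite)
  then show ?thesis
    by (auto simp: Aspace_def supp_def sh_def split: if_splits)
qed

text \<open>\<open>fold_mset\<close> asks for commutation on all functions. If some support is
  infinite, both sides are 0, since a sum over an infinite set is 0 by convention.\<close>

lemma comp_fun_commute_shuffle: "comp_fun_commute (shuffle omega :: ('x mono \<Rightarrow> 'k::field) \<Rightarrow> _)"
proof
  fix f g :: "'x mono \<Rightarrow> 'k"
  have zero: "shuffle omega h 0 = 0" for h :: "'x mono \<Rightarrow> 'k"
    by (auto simp: shuffle_def fun_eq_iff pair_def supp_def tens_def)
  have "shuffle omega g (shuffle omega f h) = shuffle omega f (shuffle omega g h)" for h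
  proof (cases "finite (supp f) \<and> finite (supp g) \<and> finite (supp h)")
    case True
    then show ?thesis by (simp add: shuffle_eq_sh finite_supp_sh sh_left_commute)
  next
    case False
    then show ?thesis
      by (metis shuffle_infinite zero)
  qed
  then show "shuffle omega g \<circ> shuffle omega f = shuffle omega f \<circ> shuffle omega g"
    by (simp add: fun_eq_iff)
qed

lemma shuffle_mset_empty [simp]: "shuffle_mset omega {#} = delta None"
  by (simp add: shuffle_mset_def)

lemma shuffle_mset_add: "shuffle_mset omega (add_mset f M) = shuffle omega f (shuffle_mset omega M)"
  unfolding shuffle_mset_def by (rule comp_fun_commute.fold_mset_add_mset[OF comp_fun_commute_shuffle])

lemma shuffle_mset_in_Aspace: "set_mset M \<subseteq> Aspace omega \<Longrightarrow> shuffle_mset omega M \<in> Aspace omega"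
  by (induction M) (auto simp: shuffle_mset_add shuffle_eq_sh Aspace_finite sh_in_Aspace)

lemma shuffle_mset_add_sh:
  assumes "f \<in> Aspace omega" "set_mset M \<subseteq> Aspace omega"
  shows "shuffle_mset omega (add_mset f M) = sh omega f (shuffle_mset omega M)"
  unfolding shuffle_mset_add using assms
  by (intro shuffle_eq_sh Aspace_finite[of _ omega] shuffle_mset_in_Aspace) auto

lemma shuffle_list_eq_mset: "shuffle_list omega fs = shuffle_mset omega (mset fs)"
  by (induction fs) (simp_all add: shuffle_list_def shuffle_mset_add)

lemma shuffle_mset_union:
  assumes "set_mset M \<subseteq> Aspace omega" "set_mset N \<subseteq> Aspace omega"
  shows "shuffle_mset omega (M + N) = sh omega (shuffle_mset omega M) (shuffle_mset omega N)"
  using assms(1)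
proof (induction M)
  case empty
  have "sh omega (delta None) (shuffle_mset omega N) = shuffle_mset omega N"
    unfolding sh_commute[of _ "delta None"]
    by (rule sh_unit_right) (use shuffle_mset_in_Aspace[OF assms(2)] Aspace_outside in blast)
  then show ?case by simp
next
  case (add f M)
  then show ?case using assms(2) by (simp add: shuffle_mset_add_sh sh_assoc)
qed

section \<open>Primitive elements\<close>

text \<open>The structure constants: the coefficient of the tensor of \<open>a\<close> and
  \<open>b\<close> in the co-addition of \<open>m\<close>, and for \<open>m\<close> in the basis
  also that of \<open>m\<close> in the shuffle of \<open>a\<close> and \<open>b\<close>.\<close>

abbreviation cnt :: "'x mono \<Rightarrow> 'x mono \<Rightarrow> 'x mono \<Rightarrow> 'k::comm_ring_1" where
  "cnt a b m \<equiv> of_nat (count_list (copm m) (a, b))"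

lemma cnt_commute: "(cnt a b m :: 'k::comm_ring_1) = cnt b a m"
  using copm_commute[of "\<lambda>u v. if (u, v) = (a, b) then 1 else (0 :: 'k)" m]
  by (simp add: of_nat_count_list case_prod_unfold prod_eq_iff conj_commute)

lemma cnt_None_right:
  assumes "m \<in> mon_basis omega"
  shows "(cnt a None m :: 'k::comm_ring_1) = (if m = a then 1 else 0)"
proof -
  have z: "(if (u, v) = (a, None) then 1 else (0 :: 'k)) = 0" if "v \<noteq> None" for u v
    using that by auto
  show ?thesis
    using sum_list_counit[OF assms, of "\<lambda>u v. if (u, v) = (a, None) then 1 else (0 :: 'k)", OF z]
    by (simp add: of_nat_count_list case_prod_unfold prod_eq_iff)
qed

lemma cnt_nonzero: "(cnt a b m :: 'k::comm_ring_1) \<noteq> 0 \<Longrightarrow> (a, b) \<in> set (copm m)"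
  by (metis count_notin of_nat_0)

lemma sh_delta:
  "(sh omega (delta a) (delta b) h :: 'k::comm_ring_1) = (if h \<in> mon_basis omega then cnt a b h else 0)"
proof -
  have "(\<lambda>x. delta a (fst x) * delta b (snd x)) = (\<lambda>x. if x = (a, b) then 1 else (0 :: 'k))"
    by (auto simp: delta_def fun_eq_iff)
  then show ?thesis by (simp add: sh_def of_nat_count_list case_prod_unfold)
qed

lemma pair_cong: "(\<And>m. m \<in> supp f \<Longrightarrow> g m = h m) \<Longrightarrow> pair f g = pair f h"
  by (simp add: pair_def)

lemma tens_None: "(tens f (delta None) + tens (delta None) f) (a, b)
    = (if b = None then f a else 0) + (if a = None then f b else (0 :: 'k::comm_ring_1))"
  by (simp add: tens_def delta_def)

text \<open>Compare coefficients at each pair \<open>(a, b)\<close>. By the counit law those with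
  one empty component agree once the constant term is 0. What remains is a system of linear
  equations with natural coefficients: orthogonality to the shuffles of two nonempty
  monomials.\<close>

lemma prim_iff:
  fixes f :: "'x mono \<Rightarrow> 'k::field"
  shows "prim omega f \<longleftrightarrow> f \<in> Aspace omega \<and> f None = 0 \<and>
    (\<forall>a b. a \<noteq> None \<longrightarrow> b \<noteq> None \<longrightarrow> pair f (cnt a b) = 0)"
proof (cases "f \<in> Aspace omega")
  case True
  have None: "pair f (cnt a None) = f a" for a
  proof -
    have "pair f (cnt a None) = pair f (delta a)"
      using True by (intro pair_cong) (auto simp: Aspace_def cnt_None_right delta_def)
    also have "\<dots> = f a"
      by (subst pair_commute) (use True Aspace_finite in auto)
    finally show ?thesis .
  qed
  have None': "pair f (cnt None a) = f a" for a
  proof -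
    have "pair f (cnt None a) = pair f (cnt a None)" by (intro pair_cong cnt_commute)
    then show ?thesis using None by simp
  qed
  have "prim omega f \<longleftrightarrow> (\<forall>a b. pair f (cnt a b) = (if b = None then f a else 0) + (if a = None then f b else 0))"
    unfolding prim_def coadd_eq[OF True] fun_eq_iff split_paired_All tens_None coa_def using True by blast
  also have "\<dots> \<longleftrightarrow> f None = 0 \<and> (\<forall>a b. a \<noteq> None \<longrightarrow> b \<noteq> None \<longrightarrow> pair f (cnt a b) = 0)"
  proof
    assume *: "\<forall>a b. pair f (cnt a b) = (if b = None then f a else 0) + (if a = None then f b else 0)"
    \<comment> \<open>At the pair of two units the counit gives \<open>f None\<close> on the left,
      but both summands on the right contribute.\<close>
    have "f None = f None + f None"
      using *[rule_format, of None None] unfolding None by simp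
    then have "f None = 0" by (metis add_cancel_right_right)
    then show "f None = 0 \<and> (\<forall>a b. a \<noteq> None \<longrightarrow> b \<noteq> None \<longrightarrow> pair f (cnt a b) = 0)"
      using * by auto
  next
    assume *: "f None = 0 \<and> (\<forall>a b. a \<noteq> None \<longrightarrow> b \<noteq> None \<longrightarrow> pair f (cnt a b) = 0)"
    show "\<forall>a b. pair f (cnt a b) = (if b = None then f a else 0) + (if a = None then f b else 0)"
    proof (intro allI)
      fix a b
      show "pair f (cnt a b) = (if b = None then f a else 0) + (if a = None then f b else 0)"
        using * None[of a] None'[of b] by (cases a; cases b) auto
    qed
  qed
  finally show ?thesis using True by simp
qed (simp add: prim_def)

lemma prim_Aspace: "prim omega f \<Longrightarrow> f \<in> Aspace omega"
  by (simp add: prim_def)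

lemma prim_None: "prim omega f \<Longrightarrow> f None = 0"
  by (simp add: prim_iff)

lemma coa_prim: "prim omega f \<Longrightarrow> coa f = tens f (delta None) + tens (delta None) f"
  by (metis prim_def coadd_eq)

lemma subspace_prim: "fv.subspace {f :: 'x mono \<Rightarrow> 'k::field. prim omega f}"
proof (rule fv.subspaceI)
  show "0 \<in> {f :: 'x mono \<Rightarrow> 'k. prim omega f}"
    using fv.subspace_0[OF subspace_Aspace[of omega]] by (simp add: prim_iff pair_def)
next
  fix f g :: "'x mono \<Rightarrow> 'k"
  assume *: "f \<in> {f. prim omega f}" "g \<in> {f. prim omega f}"
  then have A: "f \<in> Aspace omega" "g \<in> Aspace omega" by (auto simp: prim_Aspace)
  then have "f + g \<in> Aspace omega" by (rule fv.subspace_add[OF subspace_Aspace])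
  with * show "f + g \<in> {f. prim omega f}"
    by (simp add: prim_iff pair_add_left Aspace_finite[OF A(1)] Aspace_finite[OF A(2)])
next
  fix f :: "'x mono \<Rightarrow> 'k" and c
  assume *: "f \<in> {f. prim omega f}"
  then have A: "f \<in> Aspace omega" by (simp add: prim_Aspace)
  then have "sc c f \<in> Aspace omega" by (rule fv.subspace_scale[OF subspace_Aspace])
  with * show "sc c f \<in> {f. prim omega f}"
    by (simp add: prim_iff pair_sc_left Aspace_finite[OF A])
qed

section \<open>Nondegeneracy of the form on primitive elements\<close>

lemma rat_functional:
  fixes x :: "'k::field_char_0"
  assumes "x \<noteq> 0"
  obtains l :: "'k \<Rightarrow> rat" where
    "\<And>a b. l (a + b) = l a + l b" "\<And>r a. l (of_rat r * a) = r * l a" "l x = 1"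
proof -
  \<comment> \<open>In characteristic 0 the field is a vector space over the rationals through
    \<open>of_rat\<close>.\<close>
  interpret vp: vector_space_pair "\<lambda>(r::rat) (a::'k). of_rat r * a" "(*) :: rat \<Rightarrow> rat \<Rightarrow> rat"
    by unfold_locales (auto simp: algebra_simps of_rat_add of_rat_mult)
  have "vp.vs1.independent {x}" using assms by simp
  from vp.linear_independent_extend[OF this, of "\<lambda>_. 1"]
  obtain l where l: "Vector_Spaces.linear (\<lambda>(r::rat) (a::'k). of_rat r * a) (*) l" "l x = 1"
    by auto
  interpret l: Vector_Spaces.linear "\<lambda>(r::rat) (a::'k). of_rat r * a" "(*)" l
    by (rule l(1))
  show thesis
    by (rule that[of l]) (simp_all add: l.add l.scale l(2))
qed

text \<open>A basis of the span of \<open>S\<close> stays independent when \<open>x\<close> is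
  adjoined, so the values 0 on the basis and 1 at \<open>x\<close> extend linearly.\<close>

lemma separating_functional:
  fixes x :: "'m \<Rightarrow> 'k::field"
  assumes "x \<notin> fv.span S"
  obtains l :: "('m \<Rightarrow> 'k) \<Rightarrow> 'k" where
    "\<And>f g. l (f + g) = l f + l g" "\<And>c f. l (sc c f) = c * l f" "\<And>s. s \<in> S \<Longrightarrow> l s = 0" "l x = 1"
proof -
  interpret vp: vector_space_pair "sc :: 'k \<Rightarrow> ('m \<Rightarrow> 'k) \<Rightarrow> ('m \<Rightarrow> 'k)" "(*) :: 'k \<Rightarrow> 'k \<Rightarrow> 'k"
    by unfold_locales (auto simp: algebra_simps)
  obtain B where B: "B \<subseteq> S" "fv.independent B" "S \<subseteq> fv.span B"
    using fv.maximal_independent_subset by blast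
  have "fv.span S \<subseteq> fv.span B" using B(3) fv.span_minimal fv.subspace_span by blast
  then have x: "x \<notin> fv.span B" using B(1) assms fv.span_mono by blast
  then have "fv.independent (insert x B)" using B(2) by (simp add: fv.independent_insert)
  from vp.linear_independent_extend[OF this, of "\<lambda>b. if b = x then 1 else 0"]
  obtain l where l: "Vector_Spaces.linear (sc :: 'k \<Rightarrow> ('m \<Rightarrow> 'k) \<Rightarrow> ('m \<Rightarrow> 'k)) (*) l"
      "\<forall>b\<in>insert x B. l b = (if b = x then 1 else 0)"
    by blast
  interpret l: Vector_Spaces.linear "sc :: 'k \<Rightarrow> ('m \<Rightarrow> 'k) \<Rightarrow> ('m \<Rightarrow> 'k)" "(*)" l
    by (rule l(1))
  have "x \<notin> B" using x fv.span_base by blast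
  then have "l b = 0" if "b \<in> B" for b using l(2) that by auto
  then have "l s = 0" if "s \<in> S" for s
    using vp.linear_eq_0_on_span[OF l(1), of B s] B(3) that by auto
  then show thesis
    by (intro that[of l]) (use l(2) in \<open>simp_all add: l.add l.scale\<close>)
qed

text \<open>Over an arbitrary field of characteristic 0 the form may have isotropic vectors, but the
  equations defining primitive elements have integer coefficients. Applying a rational-linear
  functional \<open>l\<close> to the coefficients of \<open>f\<close> therefore gives a primitive element \<open>p\<close> with
  rational coefficients, and \<open>l \<langle>f, p\<rangle>\<close> is a sum of rational squares.\<close>

lemma pair_nondegenerate:
  fixes f :: "'x mono \<Rightarrow> 'k::field_char_0"
  assumes f: "prim omega f" and nz: "f \<noteq> 0"
  obtains p where "prim omega p" "supp p \<subseteq> supp f" "pair f p \<noteq> 0"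
proof -
  obtain m0 where m0: "f m0 \<noteq> 0" using nz by (auto simp: fun_eq_iff)
  obtain l :: "'k \<Rightarrow> rat" where add: "\<And>a b. l (a + b) = l a + l b"
      and scale: "\<And>r a. l (of_rat r * a) = r * l a" and one: "l (f m0) = 1"
    using rat_functional[OF m0] by blast
  have zero: "l 0 = 0" using scale[of 0 0] by simp
  have sum: "l (\<Sum>i\<in>I. h i) = (\<Sum>i\<in>I. l (h i))" for h and I :: "'x mono set"
    by (induction I rule: infinite_finite_induct) (simp_all add: zero add)
  have nat: "l (a * of_nat n) = l a * of_nat n" for a n
    using scale[of "of_nat n" a] by (simp add: mult.commute)
  have fA: "f \<in> Aspace omega" using f by (rule prim_Aspace)
  have fin: "finite (supp f)" using fA by (rule Aspace_finite)
  define p where "p m = (of_rat (l (f m)) :: 'k)" for m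
  have supp: "supp p \<subseteq> supp f" by (auto simp: supp_def p_def zero)
  have "p \<in> Aspace omega"
    using fA supp by (auto simp: Aspace_def intro: finite_subset)
  moreover have "p None = 0" using prim_None[OF f] by (simp add: p_def zero)
  moreover have "pair p (cnt a b) = 0" if "a \<noteq> None" "b \<noteq> None" for a b
  proof -
    have "pair p (cnt a b) = (\<Sum>m\<in>supp f. of_rat (l (f m * cnt a b m)))"
      by (simp add: pair_superset[OF fin supp] p_def nat of_rat_mult)
    also have "\<dots> = of_rat (l (pair f (cnt a b)))"
      by (simp add: pair_def sum of_rat_sum)
    finally show ?thesis using f that by (simp add: prim_iff zero)
  qed
  ultimately have prim: "prim omega p" by (simp add: prim_iff)
  have "l (pair f p) = (\<Sum>m\<in>supp f. l (f m) * l (f m))"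
    by (simp add: pair_def sum p_def) (simp add: scale mult.commute[of _ "of_rat _"])
  also have "\<dots> > 0"
    by (rule sum_pos2[OF fin, of m0]) (use m0 one in \<open>auto simp: supp_def\<close>)
  finally have "pair f p \<noteq> 0" using zero by force
  then show thesis using prim supp that by blast
qed

lemma finite_support_expansion:
  fixes f :: "'m \<Rightarrow> 'k::comm_ring_1"
  assumes "finite (supp f)"
  shows "f = (\<Sum>m\<in>supp f. sc (f m) (delta m))"
proof
  fix x
  have "(\<Sum>m\<in>supp f. f m * delta m x) = (\<Sum>m\<in>supp f. if x = m then f m else 0)"
    by (intro sum.cong refl) (simp add: delta_def)
  also have "\<dots> = f x" using assms by (auto simp: supp_def)
  finally show "f x = (\<Sum>m\<in>supp f. sc (f m) (delta m)) x" by (simp add: sum_fun_apply)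
qed

lemma functional_eq_pair:
  fixes l :: "('m \<Rightarrow> 'k::field) \<Rightarrow> 'k"
  assumes add: "\<And>f g. l (f + g) = l f + l g" and scale: "\<And>c f. l (sc c f) = c * l f"
    and fin: "finite (supp f)"
  shows "l f = pair f (\<lambda>m. l (delta m))"
proof -
  have zero: "l 0 = 0" using scale[of 0 0] by (simp add: fv.scale_zero_left)
  have "l (\<Sum>i\<in>I. h i) = (\<Sum>i\<in>I. l (h i))" for h and I :: "'m set"
    by (induction I rule: infinite_finite_induct)
      (simp_all only: sum.infinite sum.empty sum.insert zero add not_False_eq_True)
  then have "l (\<Sum>m\<in>supp f. sc (f m) (delta m)) = pair f (\<lambda>m. l (delta m))"
    by (simp add: pair_def scale)
  then show ?thesis using finite_support_expansion[OF fin] by simp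
qed

text \<open>The annihilator of the decomposable elements consists of primitive elements, on which the
  form is nondegenerate; so no functional vanishes on both kinds of elements.\<close>

lemma delta_in_span_prim_decomposable:
  fixes m :: "'x mono" and omega :: bool
  defines "Pr \<equiv> {p :: 'x mono \<Rightarrow> 'k::field_char_0. prim omega p \<and> (\<forall>m'\<in>supp p. cont m' = cont m)}"
    and "De \<equiv> {sh omega (delta a) (delta b) | a b. a \<in> mon_basis omega \<and> b \<in> mon_basis omega
      \<and> a \<noteq> None \<and> b \<noteq> None \<and> cont a + cont b = cont m}"
  assumes m: "m \<in> mon_basis omega" and m_None: "m \<noteq> None"
  shows "delta m \<in> fv.span (Pr \<union> De)"
proof (rule ccontr)
  assume "delta m \<notin> fv.span (Pr \<union> De)"
  then obtain l :: "('x mono \<Rightarrow> 'k) \<Rightarrow> 'k" where add: "\<And>f g. l (f + g) = l f + l g"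
    and scale: "\<And>c f. l (sc c f) = c * l f" and van: "\<And>s. s \<in> Pr \<union> De \<Longrightarrow> l s = 0" and one: "l (delta m) = 1"
    using separating_functional[of "delta m" "Pr \<union> De"] by metis
  note lp = functional_eq_pair[of l, OF add scale]
  define S where "S = {m' \<in> mon_basis omega. cont m' = cont m}"
  have fin: "finite S" unfolding S_def by (rule finite_cont)
  \<comment> \<open>\<open>g\<close> represents \<open>l\<close> on the finite piece
    \<open>S\<close>; cutting off outside \<open>S\<close> makes its support finite. That
    \<open>l\<close> kills the decomposables says that \<open>g\<close> is primitive.\<close>
  define g where "g m' = (if m' \<in> S then l (delta m') else 0)" for m'
  have supp_g: "supp g \<subseteq> S" by (auto simp: supp_def g_def split: if_splits)
  have gA: "g \<in> Aspace omega"
    using supp_g fin by (auto simp: Aspace_def S_def intro: finite_subset)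
  have "pair g (cnt a b) = 0" if ab: "a \<noteq> None" "b \<noteq> None" for a b
  proof (cases "a \<in> mon_basis omega \<and> b \<in> mon_basis omega \<and> cont a + cont b = cont m")
    case True
    let ?u = "sh omega (delta a) (delta b) :: 'x mono \<Rightarrow> 'k"
    have u: "?u \<in> De" using True ab by (auto simp: De_def)
    have uA: "finite (supp ?u)" by (intro finite_supp_sh) simp_all
    have supp_u: "supp ?u \<subseteq> S"
    proof
      fix x assume "x \<in> supp ?u"
      then have "x \<in> mon_basis omega" "(cnt a b x :: 'k) \<noteq> 0"
        unfolding supp_def mem_Collect_eq sh_delta by (metis (full_types))+
      then show "x \<in> S"
        using True copm_cont[OF cnt_nonzero] unfolding S_def by (metis (mono_tags, lifting) mem_Collect_eq)
    qed
    have "pair g (cnt a b) = (\<Sum>m'\<in>S. ?u m' * l (delta m'))"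
      unfolding pair_superset[OF fin supp_g] by (intro sum.cong refl) (simp add: g_def S_def sh_delta)
    also have "\<dots> = l ?u" by (simp add: lp[OF uA] pair_superset[OF fin supp_u])
    finally show ?thesis using van u by simp
  next
    \<comment> \<open>Here the structure constants vanish on \<open>S\<close>, because splitting
      stays in the monomial basis and preserves the leaves.\<close>
    case False
    have "g m' * cnt a b m' = 0" if "m' \<in> S" for m'
      using that False copm_cont[of a b m'] copm_mon_basis[of m' omega a b] cnt_nonzero[where ?m = m' and ?a = a and ?b = b]
      unfolding S_def by fastforce
    then show ?thesis unfolding pair_superset[OF fin supp_g] by (rule sum.neutral[OF ballI])
  qed
  moreover have "g None = 0"
    using cont_eq_empty_iff[OF m] m_None by (auto simp: g_def S_def)
  ultimately have prim: "prim omega g" using gA by (simp add: prim_iff)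
  have "g m = 1" using m one by (simp add: g_def S_def)
  then have "g \<noteq> 0" by (metis zero_fun_apply zero_neq_one)
  \<comment> \<open>Since \<open>p\<close> lives inside the support of \<open>g\<close>, it has the
    same leaf multiset and is killed by \<open>l\<close>; but \<open>l p\<close> is the nonzero
    number \<open>pair g p\<close>.\<close>
  with prim obtain p where p: "prim omega p" "supp p \<subseteq> supp g" "pair g p \<noteq> 0"
    by (rule pair_nondegenerate)
  have finp: "finite (supp p)" using p(1) by (intro Aspace_finite prim_Aspace)
  have supp_p: "supp p \<subseteq> S" using p(2) supp_g by blast
  then have "p \<in> Pr" using p(1) by (auto simp: Pr_def S_def)
  then have "l p = 0" using van by blast
  moreover have "l p = pair p g"
    unfolding lp[OF finp] using supp_p by (intro pair_cong) (auto simp: g_def)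
  moreover have "pair p g = pair g p"
    using finp gA by (intro pair_commute) (auto intro: Aspace_finite)
  ultimately show False using p(3) by simp
qed

section \<open>Derivations and freeness\<close>

text \<open>The transpose of the left multiplication by \<open>p\<close>.\<close>

definition Dp :: "bool \<Rightarrow> ('x mono \<Rightarrow> 'k::comm_ring_1) \<Rightarrow> ('x mono \<Rightarrow> 'k) \<Rightarrow> ('x mono \<Rightarrow> 'k)" where
  "Dp omega p f = (\<lambda>h. if h \<in> mon_basis omega then pair p (\<lambda>m. f (veeM [m, h])) else 0)"

lemma veeM_None_left [simp]: "veeM [None, m] = m"
  by (cases m) (simp_all add: veeM_def)

lemma veeM_None_right [simp]: "veeM [m, None] = m"
  by (cases m) (simp_all add: veeM_def)

lemma pair_tens_None_right:
  fixes f :: "'m option \<Rightarrow> 'k::field"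
  shows "pair (tens f (delta None)) \<phi> = pair f (\<lambda>m. \<phi> (m, None))"
proof -
  have "supp f \<times> {None :: 'm option} = (\<lambda>m. (m, None)) ` supp f" by auto
  then have "pair (tens f (delta None)) \<phi> = (\<Sum>x\<in>(\<lambda>m. (m, None)) ` supp f. tens f (delta None) x * \<phi> x)"
    by (simp only: pair_def supp_tens supp_delta)
  also have "\<dots> = pair f (\<lambda>m. \<phi> (m, None))"
    by (subst sum.reindex) (simp_all add: inj_on_def pair_def tens_def)
  finally show ?thesis .
qed

lemma pair_tens_None_left:
  fixes f :: "'m option \<Rightarrow> 'k::field"
  shows "pair (tens (delta None) f) \<phi> = pair f (\<lambda>m. \<phi> (None, m))"
proof -
  have "{None :: 'm option} \<times> supp f = (\<lambda>m. (None, m)) ` supp f" by auto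
  then have "pair (tens (delta None) f) \<phi> = (\<Sum>x\<in>(\<lambda>m. (None, m)) ` supp f. tens (delta None) f x * \<phi> x)"
    by (simp only: pair_def supp_tens supp_delta)
  also have "\<dots> = pair f (\<lambda>m. \<phi> (None, m))"
    by (subst sum.reindex) (simp_all add: inj_on_def pair_def tens_def)
  finally show ?thesis .
qed

text \<open>Primitivity in transposed form: among all splittings of \<open>p\<close> only those with
  an empty side survive after summation.\<close>

lemma pair_prim_splittings:
  fixes p :: "'x mono \<Rightarrow> 'k::field"
  assumes "prim omega p"
  shows "pair p (\<lambda>m. \<Sum>x\<leftarrow>copm m. \<phi> x) = pair p (\<lambda>m. \<phi> (m, None)) + pair p (\<lambda>m. \<phi> (None, m))"
proof -
  have fin: "finite (supp p)" using assms by (intro Aspace_finite prim_Aspace)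
  have "pair p (\<lambda>m. \<Sum>x\<leftarrow>copm m. \<phi> x) = pair (tens p (delta None) + tens (delta None) p) \<phi>"
    by (simp add: pair_coa[OF fin, symmetric] coa_prim[OF assms])
  also have "\<dots> = pair (tens p (delta None)) \<phi> + pair (tens (delta None) p) \<phi>"
    using fin by (intro pair_add_left) (simp_all add: supp_tens)
  finally show ?thesis by (simp add: pair_tens_None_left pair_tens_None_right)
qed

text \<open>The splittings of a product of \<open>m\<close> and \<open>h\<close> are the products of
  their splittings. As \<open>p\<close> splits only with an empty side, it multiplies either the
  left or the right component of \<open>h\<close>, and these are the two Leibniz terms.\<close>

lemma Dp_derivation:
  fixes p :: "'x mono \<Rightarrow> 'k::field"
  assumes p: "prim omega p"
  shows "Dp omega p (sh omega f g) = sh omega (Dp omega p f) g + sh omega f (Dp omega p g)"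
proof
  fix h
  show "Dp omega p (sh omega f g) h = (sh omega (Dp omega p f) g + sh omega f (Dp omega p g)) h"
  proof (cases "h \<in> mon_basis omega")
    case True
    have split: "fst y \<in> mon_basis omega" "snd y \<in> mon_basis omega" if "y \<in> set (copm h)" for y
      using copm_mon_basis[OF True, of "fst y" "snd y"] that by simp_all
    define \<phi> where "\<phi> x = (\<Sum>y\<leftarrow>copm h. f (veeM [fst x, fst y]) * g (veeM [snd x, snd y]))" for x
    have "Dp omega p (sh omega f g) h = pair p (\<lambda>m. sh omega f g (veeM [m, h]))"
      using True by (simp add: Dp_def)
    also have "\<dots> = pair p (\<lambda>m. \<Sum>x\<leftarrow>copm m. \<phi> x)"
    proof (rule pair_cong)
      fix m assume "m \<in> supp p"
      then have "m \<in> mon_basis omega" using prim_Aspace[OF p] by (auto simp: Aspace_def)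
      then have "veeM [m, h] \<in> mon_basis omega" using True by (intro mon_basis_veeM) auto
      then show "sh omega f g (veeM [m, h]) = (\<Sum>x\<leftarrow>copm m. \<phi> x)"
        by (simp add: sh_apply sum_copm_veeM sum_product_lists_Cons veeT_def \<phi>_def case_prod_unfold del: product_lists.simps(2))
    qed
    also have "\<dots> = pair p (\<lambda>m. \<phi> (m, None)) + pair p (\<lambda>m. \<phi> (None, m))"
      by (rule pair_prim_splittings[OF p])
    also have "pair p (\<lambda>m. \<phi> (m, None)) = sh omega (Dp omega p f) g h"
    proof -
      have "pair p (\<lambda>m. \<phi> (m, None)) = (\<Sum>y\<leftarrow>copm h. pair p (\<lambda>m. g (snd y) * f (veeM [m, fst y])))"
        by (simp add: \<phi>_def pair_sum_list_right mult.commute)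
      also have "\<dots> = (\<Sum>y\<leftarrow>copm h. Dp omega p f (fst y) * g (snd y))"
        by (intro arg_cong[where f = sum_list] map_cong refl) (simp add: pair_mult_right Dp_def split)
      finally show ?thesis by (simp add: sh_apply[OF True] case_prod_unfold)
    qed
    also have "pair p (\<lambda>m. \<phi> (None, m)) = sh omega f (Dp omega p g) h"
    proof -
      have "pair p (\<lambda>m. \<phi> (None, m)) = (\<Sum>y\<leftarrow>copm h. pair p (\<lambda>m. f (fst y) * g (veeM [m, snd y])))"
        by (simp add: \<phi>_def pair_sum_list_right)
      also have "\<dots> = (\<Sum>y\<leftarrow>copm h. f (fst y) * Dp omega p g (snd y))"
        by (intro arg_cong[where f = sum_list] map_cong refl) (simp add: pair_mult_right Dp_def split)
      finally show ?thesis by (simp add: sh_apply[OF True] case_prod_unfold)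
    qed
    finally show ?thesis by simp
  qed (simp add: Dp_def sh_outside)
qed

lemma Dp_add: "Dp omega p (f + g) = Dp omega p f + Dp omega p g"
  by (auto simp: Dp_def fun_eq_iff pair_add_right)

lemma Dp_sc: "Dp omega p (sc c f) = sc c (Dp omega p f)"
  by (auto simp: Dp_def fun_eq_iff pair_mult_right)

lemma Dp_zero: "Dp omega p 0 = 0"
  by (auto simp: Dp_def fun_eq_iff)

lemma Dp_sum: "Dp omega p (\<Sum>i\<in>I. f i) = (\<Sum>i\<in>I. Dp omega p (f i))"
  by (induction I rule: infinite_finite_induct)
    (simp_all only: sum.infinite sum.empty sum.insert Dp_zero Dp_add not_False_eq_True)

lemma Dp_None: "Dp omega p f None = pair p f"
  by (simp add: Dp_def)

lemma Dp_unit: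
  assumes "prim omega p"
  shows "Dp omega p (delta None) = 0"
proof
  fix h
  have "pair p (\<lambda>m. delta None (veeM [m, h])) = pair p (\<lambda>m. 0)"
    using prim_None[OF assms] by (intro pair_cong) (auto simp: supp_def delta_def veeM_None_iff)
  then show "Dp omega p (delta None) h = 0 h" by (simp add: Dp_def)
qed

lemma Dp_shuffle_mset:
  fixes p :: "'x mono \<Rightarrow> 'k::field"
  assumes p: "prim omega p" and M: "set_mset M \<subseteq> Aspace omega"
  shows "Dp omega p (shuffle_mset omega M)
    = (\<Sum>b\<in>#M. sh omega (shuffle_mset omega (M - {#b#})) (Dp omega p b))"
  using M
proof (induction M)
  case empty
  then show ?case by (simp add: Dp_unit[OF p])
next
  case (add f M)
  let ?S = "shuffle_mset omega" and ?D = "Dp omega p"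
  have *: "?S (add_mset f M - {#b#}) = sh omega f (?S (M - {#b#}))" if "b \<in># M" for b
  proof -
    have "add_mset f M - {#b#} = add_mset f (M - {#b#})" using that by simp
    then show ?thesis using add.prems
      by (simp only:) (rule shuffle_mset_add_sh, auto dest: in_diffD)
  qed
  have dist: "sh omega f (\<Sum>b\<in>#N. \<psi> b) = (\<Sum>b\<in>#N. sh omega f (\<psi> b))" for N and \<psi> :: "('x mono \<Rightarrow> 'k) \<Rightarrow> _"
    by (induction N) (simp_all only: image_mset_empty sum_mset.empty sh_zero_right image_mset_add_mset sum_mset.add_mset sh_add_right)
  have "?D (?S (add_mset f M)) = sh omega (?D f) (?S M) + sh omega f (?D (?S M))"
    using add.prems by (simp add: shuffle_mset_add_sh Dp_derivation[OF p])
  also have "sh omega f (?D (?S M)) = (\<Sum>b\<in>#M. sh omega f (sh omega (?S (M - {#b#})) (?D b)))"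
    using add by (simp add: dist)
  also have "\<dots> = (\<Sum>b\<in>#M. sh omega (?S (add_mset f M - {#b#})) (?D b))"
    by (intro arg_cong[where f = sum_mset] image_mset_cong) (simp only: * sh_assoc)
  finally show ?case by (simp add: sh_commute[of omega "?D f"])
qed

lemma sum_mset_eq_sum_count:
  fixes \<phi> :: "'b \<Rightarrow> 'm \<Rightarrow> 'k::field"
  assumes "finite B" "set_mset M \<subseteq> B"
  shows "(\<Sum>b\<in>#M. \<phi> b) = (\<Sum>b\<in>B. sc (of_nat (count M b)) (\<phi> b))"
  using assms(2)
proof (induction M)
  case empty
  show ?case by (simp add: fv.scale_zero_left)
next
  case (add f M)
  have "(\<Sum>b\<in>B. sc (of_nat (count (add_mset f M) b)) (\<phi> b))
      = (\<Sum>b\<in>B. sc (of_nat (count M b)) (\<phi> b) + (if b = f then \<phi> b else 0))"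
    by (intro sum.cong refl) (auto simp: fun_eq_iff algebra_simps)
  also have "\<dots> = (\<Sum>b\<in>B. sc (of_nat (count M b)) (\<phi> b)) + \<phi> f"
    using assms(1) add.prems by (simp only: sum.distrib sum.delta) simp
  finally show ?case
    using add.IH add.prems by (simp only: image_mset_add_mset sum_mset.add_mset set_mset_add_mset_insert insert_subset add.commute)
qed

lemma fv_independentD:
  fixes B :: "('m \<Rightarrow> 'k::field) set"
  assumes "fv.independent B" "finite F" "F \<subseteq> B" "(\<Sum>b\<in>F. sc (u b) b) = 0" "b \<in> F"
  shows "u b = 0"
  using assms unfolding fv.dependent_explicit by blast

text \<open>The elements \<open>D\<^sub>p b\<close> form a matrix over \<open>A\<close> whose constant terms are the numbers
  \<open>\<langle>b, p\<rangle>\<close>; nondegeneracy of the form makes its kernel trivial, degree by degree.\<close>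

lemma derivation_matrix_kernel:
  fixes B :: "('x mono \<Rightarrow> 'k::field_char_0) set"
  assumes fin: "finite B" and indep: "fv.independent B" and prim: "\<And>b. b \<in> B \<Longrightarrow> prim omega b"
    and ker: "\<And>p. prim omega p \<Longrightarrow> (\<Sum>b\<in>B. sh omega (G b) (Dp omega p b)) = 0"
    and h: "h \<in> mon_basis omega" and b: "b \<in> B"
  shows "G b h = 0"
  using h b
proof (induction "mdeg h" arbitrary: h b rule: less_induct)
  case less
  have low: "G b a = 0" if "b \<in> B" "a \<in> mon_basis omega" "mdeg a < mdeg h" for a b
    using less.hyps that by blast
  \<comment> \<open>The coefficients of all \<open>G b\<close> at \<open>h\<close> are collected in
    one primitive element; the relation evaluated at \<open>h\<close> will say that \<open>v\<close>
    is orthogonal to every primitive \<open>p\<close>.\<close>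
  define v where "v = (\<Sum>b\<in>B. sc (G b h) b)"
  have v: "prim omega v"
    using fv.subspace_sum[OF subspace_prim, of B "\<lambda>b. sc (G b h) b" omega]
      fv.subspace_scale[OF subspace_prim, of _ omega] prim
    unfolding v_def by blast
  have "pair v p = 0" if p: "prim omega p" for p
  proof -
    have fv': "finite (supp v)" "finite (supp p)" "\<And>b. b \<in> B \<Longrightarrow> finite (supp b)"
      using v p prim by (auto intro: Aspace_finite prim_Aspace)
    have "pair v p = pair p v" using fv' by (intro pair_commute)
    also have "\<dots> = pair p (\<lambda>m. \<Sum>b\<in>B. G b h * b m)"
      by (intro pair_cong) (simp add: v_def sum_fun_apply)
    also have "\<dots> = (\<Sum>b\<in>B. G b h * Dp omega p b None)"
      by (simp add: pair_sum_right pair_mult_right Dp_None)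
    \<comment> \<open>By the induction hypothesis every \<open>G b\<close> vanishes below the degree
      of \<open>h\<close>, so only the constant term of \<open>Dp omega p b\<close>
      contributes.\<close>
    also have "\<dots> = (\<Sum>b\<in>B. sh omega (G b) (Dp omega p b) h)"
      by (intro sum.cong refl sh_leading[symmetric] less.prems(1) low)
    also have "\<dots> = (\<Sum>b\<in>B. sh omega (G b) (Dp omega p b)) h"
      by (simp add: sum_fun_apply)
    finally show ?thesis by (simp add: ker[OF p])
  qed
  then have "v = 0" using pair_nondegenerate[OF v] by metis
  then show "G b h = 0"
    unfolding v_def by (rule fv_independentD[OF indep fin order.refl _ less.prems(2)])
qed

text \<open>The bound \<open>n\<close> on the number of factors takes the place of minimal length:
  the partial derivatives of a relation satisfy the next smaller bound.\<close>

lemma shuffle_mset_relation_trivial: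
  fixes Bs :: "('x mono \<Rightarrow> 'k::field_char_0) set"
  assumes indep: "fv.independent Bs" and prim: "\<And>b. b \<in> Bs \<Longrightarrow> prim omega b"
  shows "finite F \<Longrightarrow> (\<And>M. M \<in> F \<Longrightarrow> set_mset M \<subseteq> Bs \<and> size M < n) \<Longrightarrow>
    (\<Sum>M\<in>F. sc (c M) (shuffle_mset omega M)) = 0 \<Longrightarrow> M \<in> F \<Longrightarrow> c M = 0"
proof (induction n arbitrary: F c M)
  case 0
  then show ?case by blast
next
  case (Suc n)
  note fin = Suc.prems(1) and F = Suc.prems(2) and rel = Suc.prems(3)
  let ?S = "shuffle_mset omega"
  define B where "B = (\<Union>M\<in>F. set_mset M)"
  have B: "finite B" "B \<subseteq> Bs" using fin F by (auto simp: B_def)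
  have sub: "set_mset M \<subseteq> B" if "M \<in> F" for M using that by (auto simp: B_def)
  have A: "b \<in> Aspace omega" if "b \<in> Bs" for b using prim[OF that] by (rule prim_Aspace)
  have MA: "set_mset M \<subseteq> Aspace omega" if "M \<in> F" for M using F[OF that] A by blast
  \<comment> \<open>The formal partial derivative of the relation with respect to \<open>b\<close>;
    the multiplicity of \<open>b\<close> is its exponent.\<close>
  define G where "G b = (\<Sum>M\<in>F. sc (c M * of_nat (count M b)) (?S (M - {#b#})))" for b
  have ker: "(\<Sum>b\<in>B. sh omega (G b) (Dp omega p b)) = 0" if p: "prim omega p" for p
  proof -
    have "0 = Dp omega p (\<Sum>M\<in>F. sc (c M) (?S M))"
      by (simp only: rel Dp_zero)
    also have "\<dots> = (\<Sum>M\<in>F. sc (c M) (\<Sum>b\<in>B. sc (of_nat (count M b)) (sh omega (?S (M - {#b#})) (Dp omega p b))))"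
      unfolding Dp_sum Dp_sc
      by (intro sum.cong refl arg_cong2[where f = sc])
        (simp only: Dp_shuffle_mset[OF p MA] sum_mset_eq_sum_count[OF B(1) sub])
    also have "\<dots> = (\<Sum>M\<in>F. \<Sum>b\<in>B. sh omega (sc (c M * of_nat (count M b)) (?S (M - {#b#}))) (Dp omega p b))"
      by (simp only: fv.scale_sum_right fv.scale_scale sh_sc_left)
    also have "\<dots> = (\<Sum>b\<in>B. sh omega (G b) (Dp omega p b))"
      by (subst sum.swap) (simp only: G_def sh_sum_left)
    finally show ?thesis by simp
  qed
  have indepB: "fv.independent B" using indep B(2) fv.independent_mono by blast
  have G0: "G b = 0" if b: "b \<in> B" for b
  proof
    fix h
    show "G b h = 0 h"
    proof (cases "h \<in> mon_basis omega")
      case True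
      show ?thesis
        using derivation_matrix_kernel[OF B(1) indepB _ ker True b] prim B(2) by auto
    next
      case False
      have "?S (M - {#b#}) h = 0" if "M \<in> F" for M
        using False by (intro Aspace_outside[where omega = omega] shuffle_mset_in_Aspace)
          (use MA[OF that] in \<open>auto dest: in_diffD\<close>)
      then show ?thesis by (simp add: G_def sum_fun_apply)
    qed
  qed
  have nonempty: "c M = 0" if M: "M \<in> F" "M \<noteq> {#}" for M
  proof -
    obtain b where b: "b \<in># M" using M(2) by blast
    then have bB: "b \<in> B" using sub M(1) by blast
    \<comment> \<open>Removing one \<open>b\<close> is injective on the multisets containing
      \<open>b\<close>, so \<open>G b = 0\<close> is again a relation with one coefficient per
      multiset, now with fewer factors.\<close>
    define F' where "F' = {M \<in> F. b \<in># M}"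
    have inj: "inj_on (\<lambda>M. M - {#b#}) F'"
      by (rule inj_onI) (metis (mono_tags, lifting) F'_def insert_DiffM mem_Collect_eq)
    define c' where "c' N = c (add_mset b N) * of_nat (count (add_mset b N) b)" for N
    have "0 = (\<Sum>M\<in>F'. sc (c M * of_nat (count M b)) (?S (M - {#b#})))"
      unfolding G0[OF bB, symmetric] G_def F'_def
      by (intro sum.mono_neutral_right fin)
        (auto simp: count_eq_zero_iff[THEN iffD2] fun_eq_iff)
    also have "\<dots> = (\<Sum>N\<in>(\<lambda>M. M - {#b#}) ` F'. sc (c' N) (?S N))"
      unfolding sum.reindex[OF inj] o_def by (intro sum.cong refl) (simp add: c'_def F'_def)
    finally have rel': "(\<Sum>N\<in>(\<lambda>M. M - {#b#}) ` F'. sc (c' N) (?S N)) = 0" by simp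
    have "c' (M - {#b#}) = 0"
    proof (rule Suc.IH[OF _ _ rel'])
      show "finite ((\<lambda>M. M - {#b#}) ` F')" using fin by (simp add: F'_def)
      show "set_mset N \<subseteq> Bs \<and> size N < n" if N: "N \<in> (\<lambda>M. M - {#b#}) ` F'" for N
      proof -
        obtain M' where M': "M' \<in> F" "b \<in># M'" "N = M' - {#b#}"
          using N by (auto simp: F'_def)
        have "size M' = Suc (size N)" using M'(2,3) by (metis insert_DiffM size_add_mset)
        moreover have "set_mset N \<subseteq> set_mset M'" using M'(3) by (auto dest: in_diffD)
        ultimately show ?thesis using F[OF M'(1)] by auto
      qed
      show "M - {#b#} \<in> (\<lambda>M. M - {#b#}) ` F'" using M(1) b by (auto simp: F'_def)
    qed
    \<comment> \<open>The multiplicity of \<open>b\<close> in \<open>M\<close> is a positive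
      integer, hence nonzero in characteristic 0.\<close>
    then show "c M = 0" using b by (auto simp: c'_def count_eq_zero_iff)
  qed
  show "c M = 0"
  proof (cases "M = {#}")
    \<comment> \<open>Derivatives do not see the constant. At the empty tree the relation reduces to
      \<open>c {#}\<close>, because all other coefficients are 0 and the empty shuffle is 1.\<close>
    case True
    have "0 = (\<Sum>M\<in>F. sc (c M) (?S M)) None"
      by (simp only: rel zero_fun_apply)
    also have "\<dots> = (\<Sum>M\<in>F. c M * ?S M None)"
      by (simp only: sum_fun_apply sc_apply)
    also have "\<dots> = (\<Sum>M\<in>{{#}}. c M * ?S M None)"
      by (rule sum.mono_neutral_right[OF fin]) (use nonempty Suc.prems(4) True in auto)
    also have "\<dots> = c {#}" by simp
    finally have "c {#} = 0" by simp
    then show ?thesis using True by simp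
  qed (use nonempty Suc.prems(4) in blast)
qed

lemma shuffle_mset_independent:
  fixes Bs :: "('x mono \<Rightarrow> 'k::field_char_0) set"
  assumes indep: "fv.independent Bs" and prim: "\<And>b. b \<in> Bs \<Longrightarrow> prim omega b"
  shows "inj_on (shuffle_mset omega) {M. set_mset M \<subseteq> Bs}"
    and "fv.independent (shuffle_mset omega ` {M. set_mset M \<subseteq> Bs})"
proof -
  let ?S = "shuffle_mset omega"
  have triv: "c M = 0" if "finite F" "F \<subseteq> {M. set_mset M \<subseteq> Bs}" "(\<Sum>M\<in>F. sc (c M) (?S M)) = 0" "M \<in> F"
    for F c M
  proof (rule shuffle_mset_relation_trivial[OF indep prim that(1) _ that(3,4)])
    \<comment> \<open>The total size is a common bound for the finite family.\<close>
    show "set_mset M \<subseteq> Bs \<and> size M < Suc (\<Sum>M\<in>F. size M)" if "M \<in> F" for M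
      using that \<open>F \<subseteq> _\<close> member_le_sum[OF that, of size] \<open>finite F\<close> by (auto simp: less_Suc_eq_le)
  qed
  show inj: "inj_on ?S {M. set_mset M \<subseteq> Bs}"
  proof (rule inj_onI)
    fix M N assume MN: "M \<in> {M. set_mset M \<subseteq> Bs}" "N \<in> {M. set_mset M \<subseteq> Bs}" "?S M = ?S N"
    show "M = N"
    proof (rule ccontr)
      assume ne: "M \<noteq> N"
      let ?c = "\<lambda>L. if L = M then 1 else - 1 :: 'k"
      have "(\<Sum>L\<in>{M, N}. sc (?c L) (?S L)) = 0"
        using ne MN(3) by (simp add: fun_eq_iff)
      then have "?c M = 0" using triv[of "{M, N}" ?c M] MN by auto
      then show False by simp
    qed
  qed
  show "fv.independent (?S ` {M. set_mset M \<subseteq> Bs})"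
  proof
    assume "fv.dependent (?S ` {M. set_mset M \<subseteq> Bs})"
    then obtain T u v where T: "finite T" "T \<subseteq> ?S ` {M. set_mset M \<subseteq> Bs}" "v \<in> T" "u v \<noteq> 0"
        "(\<Sum>v\<in>T. sc (u v) v) = 0"
      unfolding fv.dependent_explicit by blast
    obtain F where F: "F \<subseteq> {M. set_mset M \<subseteq> Bs}" "finite F" "T = ?S ` F"
      using finite_subset_image[OF T(1,2)] by blast
    have "inj_on ?S F" using inj F(1) inj_on_subset by blast
    then have "(\<Sum>M\<in>F. sc (u (?S M)) (?S M)) = 0"
      using T(5) by (simp only: F(3) sum.reindex o_def)
    moreover obtain M where "M \<in> F" "v = ?S M" using T(3) F(3) by blast
    ultimately show False using triv[OF F(2,1), of "\<lambda>M. u (?S M)" M] T(4) by simp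
  qed
qed

section \<open>Generation by primitive elements, and graded projections\<close>

lemma sh_in_span:
  fixes f g :: "'x mono \<Rightarrow> 'k::field"
  assumes f: "f \<in> fv.span U" and g: "g \<in> fv.span V"
    and UV: "\<And>u v. u \<in> U \<Longrightarrow> v \<in> V \<Longrightarrow> sh omega u v \<in> fv.span W"
  shows "sh omega f g \<in> fv.span W"
proof -
  have *: "sh omega u g \<in> fv.span W" if u: "u \<in> U" for u
    using g
  proof (induction rule: fv.span_induct_alt)
    case base
    show ?case by (simp only: sh_zero_right fv.span_zero)
  next
    case (step c x y)
    then show ?case
      unfolding sh_add_right sh_sc_right using fv.span_add[OF fv.span_scale[OF UV[OF u]]] by blast
  qed
  show ?thesis
    using f
  proof (induction rule: fv.span_induct_alt)
    case base
    show ?case by (simp only: sh_zero_left fv.span_zero)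
  next
    case (step c x y)
    then show ?case
      unfolding sh_add_left sh_sc_left using fv.span_add[OF fv.span_scale[OF *]] by blast
  qed
qed

text \<open>The additive map \<open>\<gamma>\<close> coarsens the grading by leaf multisets: a constant map gives the
  ungraded statement, \<open>size\<close> the grading by degree.\<close>

lemma delta_in_span_shuffle_mset:
  fixes H :: "('x mono \<Rightarrow> 'k::field_char_0) set"
    and \<gamma> :: "'x multiset \<Rightarrow> 'g::comm_monoid_add" and \<delta> :: "('x mono \<Rightarrow> 'k) \<Rightarrow> 'g"
  assumes HA: "H \<subseteq> Aspace omega"
    and \<gamma>: "\<gamma> {#} = 0" "\<And>c d. \<gamma> (c + d) = \<gamma> c + \<gamma> d"
    and gen: "\<And>p c. prim omega p \<Longrightarrow> c \<subseteq># C \<Longrightarrow> \<forall>m\<in>supp p. cont m = c \<Longrightarrow>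
      p \<in> fv.span {h \<in> H. \<delta> h = \<gamma> c}"
    and m: "m \<in> mon_basis omega" "cont m \<subseteq># C"
  shows "delta m \<in> fv.span (shuffle_mset omega ` {M. set_mset M \<subseteq> H \<and> (\<Sum>h\<in>#M. \<delta> h) = \<gamma> (cont m)})"
  using m
proof (induction "mdeg m" arbitrary: m rule: less_induct)
  case less
  let ?X = "\<lambda>c. shuffle_mset omega ` {M. set_mset M \<subseteq> H \<and> (\<Sum>h\<in>#M. \<delta> h) = \<gamma> c}"
  show ?case
  proof (cases "m = None")
    case True
    have "shuffle_mset omega {#} \<in> ?X (cont m)" by (rule imageI) (simp add: True \<gamma>)
    then show ?thesis unfolding True by (intro fv.span_base) simp
  next
    case False
    let ?Pr = "{p :: 'x mono \<Rightarrow> 'k. prim omega p \<and> (\<forall>m'\<in>supp p. cont m' = cont m)}"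
    let ?De = "{sh omega (delta a) (delta b) | a b. a \<in> mon_basis omega \<and> b \<in> mon_basis omega
      \<and> a \<noteq> None \<and> b \<noteq> None \<and> cont a + cont b = cont m}"
    have "p \<in> fv.span (?X (cont m))" if "p \<in> ?Pr" for p
    proof -
      have "{h \<in> H. \<delta> h = \<gamma> (cont m)} \<subseteq> ?X (cont m)"
      proof
        fix h assume h: "h \<in> {h \<in> H. \<delta> h = \<gamma> (cont m)}"
        then have hA: "h \<in> Aspace omega" using HA by blast
        have "shuffle_mset omega {#h#} = sh omega h (delta None)"
          using hA by (simp add: shuffle_mset_add_sh)
        also have "\<dots> = h" using hA by (intro sh_unit_right Aspace_outside)
        finally have "h = shuffle_mset omega {#h#}" by simp
        then show "h \<in> ?X (cont m)" by (rule image_eqI) (use h in simp)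
      qed
      then show ?thesis
        using gen[of p "cont m"] that less.prems(2) fv.span_mono by blast
    qed
    moreover have "d \<in> fv.span (?X (cont m))" if dDe: "d \<in> ?De" for d
    proof -
      obtain a b where d: "d = sh omega (delta a) (delta b)" and ab: "a \<in> mon_basis omega" "b \<in> mon_basis omega"
          "a \<noteq> None" "b \<noteq> None" "cont a + cont b = cont m"
        using dDe by blast
      have deg: "mdeg a + mdeg b = mdeg m" using ab(5) by (metis size_cont size_union)
      have "mdeg a \<noteq> 0" "mdeg b \<noteq> 0" using ab mdeg_eq_0_iff by blast+
      then have "mdeg a < mdeg m" "mdeg b < mdeg m" using deg by linarith+
      \<comment> \<open>The bound \<open>C\<close> passes to the factors. It allows
        \<open>gen\<close> to be required only for primitive elements of bounded degree.\<close>
      moreover have "cont a \<subseteq># C" "cont b \<subseteq># C"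
        using ab(5) less.prems(2) by (metis mset_subset_eq_add_left mset_subset_eq_add_right subset_mset.order_trans)+
      ultimately have "delta a \<in> fv.span (?X (cont a))" "delta b \<in> fv.span (?X (cont b))"
        using less.hyps ab by blast+
      then show ?thesis unfolding d
      proof (rule sh_in_span)
        fix u v assume "u \<in> ?X (cont a)" "v \<in> ?X (cont b)"
        then obtain M N where M: "u = shuffle_mset omega M" "set_mset M \<subseteq> H" "(\<Sum>h\<in>#M. \<delta> h) = \<gamma> (cont a)"
          and N: "v = shuffle_mset omega N" "set_mset N \<subseteq> H" "(\<Sum>h\<in>#N. \<delta> h) = \<gamma> (cont b)"
          by blast
        have "sh omega u v = shuffle_mset omega (M + N)"
          unfolding M(1) N(1) by (rule shuffle_mset_union[symmetric]) (use M(2) N(2) HA in auto)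
        moreover have "M + N \<in> {M. set_mset M \<subseteq> H \<and> (\<Sum>h\<in>#M. \<delta> h) = \<gamma> (cont m)}"
          using M N ab(5)[symmetric] by (simp add: \<gamma>(2))
        ultimately show "sh omega u v \<in> fv.span (?X (cont m))"
          by (metis (no_types, lifting) fv.span_base image_eqI)
      qed
    qed
    ultimately have "?Pr \<union> ?De \<subseteq> fv.span (?X (cont m))" by blast
    then have "fv.span (?Pr \<union> ?De) \<subseteq> fv.span (?X (cont m))"
      by (rule fv.span_minimal[OF _ fv.subspace_span])
    then show ?thesis
      using delta_in_span_prim_decomposable[OF less.prems(1) False] by blast
  qed
qed

lemma in_span_deltas:
  fixes f :: "'m \<Rightarrow> 'k::field"
  assumes "finite (supp f)" "\<And>m. m \<in> supp f \<Longrightarrow> delta m \<in> fv.span X"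
  shows "f \<in> fv.span X"
proof -
  have "(\<Sum>m\<in>supp f. sc (f m) (delta m)) \<in> fv.span X"
    by (intro fv.span_sum fv.span_scale assms(2))
  then show ?thesis using finite_support_expansion[OF assms(1)] by simp
qed

text \<open>Projection onto part of the leaf-multiset grading; the predicate covers a single
  multiset as well as a whole degree.\<close>

definition restrict_cont :: "('x multiset \<Rightarrow> bool) \<Rightarrow> ('x mono \<Rightarrow> 'k::zero) \<Rightarrow> ('x mono \<Rightarrow> 'k)" where
  "restrict_cont P f = (\<lambda>m. if P (cont m) then f m else 0)"

lemma supp_restrict_cont: "supp (restrict_cont P f) = {m \<in> supp f. P (cont m)}"
  by (auto simp: supp_def restrict_cont_def)

lemma restrict_cont_add:
  "restrict_cont P (f + g) = restrict_cont P f + restrict_cont P (g :: _ \<Rightarrow> 'k::comm_ring_1)"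
  by (auto simp: restrict_cont_def fun_eq_iff)

lemma restrict_cont_sc:
  "restrict_cont P (sc c f) = sc c (restrict_cont P (f :: _ \<Rightarrow> 'k::comm_ring_1))"
  by (auto simp: restrict_cont_def fun_eq_iff)

lemma restrict_cont_zero: "restrict_cont P 0 = (0 :: _ \<Rightarrow> 'k::comm_ring_1)"
  by (auto simp: restrict_cont_def fun_eq_iff)

lemma restrict_cont_sum:
  "restrict_cont P (\<Sum>i\<in>I. f i) = (\<Sum>i\<in>I. restrict_cont P (f i :: _ \<Rightarrow> 'k::comm_ring_1))"
  by (induction I rule: infinite_finite_induct)
    (simp_all only: sum.infinite sum.empty sum.insert restrict_cont_zero restrict_cont_add not_False_eq_True)

lemma restrict_cont_in_Aspace: "f \<in> Aspace omega \<Longrightarrow> restrict_cont P f \<in> Aspace omega"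
  by (auto simp: Aspace_def supp_restrict_cont)

text \<open>Each equation defining primitive elements involves only monomials with leaf multiset
  \<open>cont a + cont b\<close>, so a projection either keeps the equation or makes it
  trivial.\<close>

lemma prim_restrict_cont:
  fixes f :: "'x mono \<Rightarrow> 'k::field"
  assumes "prim omega f"
  shows "prim omega (restrict_cont P f)"
proof -
  have A: "f \<in> Aspace omega" using assms by (rule prim_Aspace)
  have "pair (restrict_cont P f) (cnt a b) = 0" if ab: "a \<noteq> None" "b \<noteq> None" for a b
  proof -
    have "pair (restrict_cont P f) (cnt a b) = (\<Sum>m\<in>supp f. restrict_cont P f m * cnt a b m)"
      by (rule pair_superset) (auto simp: supp_restrict_cont Aspace_finite[OF A])
    also have "\<dots> = (\<Sum>m\<in>supp f. (if P (cont a + cont b) then 1 else 0) * (f m * cnt a b m))"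
    proof (rule sum.cong[OF refl])
      fix m
      show "restrict_cont P f m * cnt a b m = (if P (cont a + cont b) then 1 else 0) * (f m * cnt a b m)"
      proof (cases "(cnt a b m :: 'k) = 0")
        case False
        then have "cont a + cont b = cont m" by (intro copm_cont cnt_nonzero)
        then show ?thesis by (simp add: restrict_cont_def)
      qed simp
    qed
    also have "\<dots> = (if P (cont a + cont b) then 1 else 0) * pair f (cnt a b)"
      by (simp add: pair_def sum_distrib_left)
    finally show ?thesis using assms ab by (simp add: prim_iff)
  qed
  then show ?thesis
    using restrict_cont_in_Aspace[OF A] prim_None[OF assms] by (simp add: prim_iff restrict_cont_def)
qed

lemma PrimGr_iff:
  "f \<in> PrimGr omega k \<longleftrightarrow> prim omega f \<and> (\<forall>m\<in>supp f. size (cont m) = k)"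
  by (auto simp: PrimGr_def Agr_def size_cont prim_Aspace)

text \<open>Homogeneous components of primitive elements are primitive, and degree 0 contributes
  nothing because the constant term vanishes.\<close>

lemma span_PrimGr:
  "fv.span (\<Union>k\<in>{1..}. PrimGr omega k) = {f :: 'x mono \<Rightarrow> 'k::field. prim omega f}"
proof
  show "fv.span (\<Union>k\<in>{1..}. PrimGr omega k) \<subseteq> {f :: 'x mono \<Rightarrow> 'k::field. prim omega f}"
    by (rule fv.span_minimal[OF _ subspace_prim]) (auto simp: PrimGr_iff)
  show "{f :: 'x mono \<Rightarrow> 'k::field. prim omega f} \<subseteq> fv.span (\<Union>k\<in>{1..}. PrimGr omega k)"
  proof
    fix f :: "'x mono \<Rightarrow> 'k" assume "f \<in> {f. prim omega f}"
    then have f: "prim omega f" by simp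
    define K where "K = (\<lambda>m. size (cont m)) ` supp f"
    have K: "finite K" unfolding K_def using Aspace_finite[OF prim_Aspace[OF f]] by simp
    have "f = (\<Sum>k\<in>K. restrict_cont (\<lambda>c. size c = k) f)"
    proof
      fix m
      have "(\<Sum>k\<in>K. restrict_cont (\<lambda>c. size c = k) f m) = (\<Sum>k\<in>K. if size (cont m) = k then f m else 0)"
        by (intro sum.cong refl) (simp add: restrict_cont_def)
      also have "\<dots> = f m"
        using K by (auto simp: K_def supp_def)
      finally show "f m = (\<Sum>k\<in>K. restrict_cont (\<lambda>c. size c = k) f) m" by (simp add: sum_fun_apply)
    qed
    moreover have "restrict_cont (\<lambda>c. size c = k) f \<in> fv.span (\<Union>k\<in>{1..}. PrimGr omega k)" if k: "k \<in> K" for k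
    proof -
      obtain m where m: "m \<in> supp f" "k = size (cont m)" using k by (auto simp: K_def)
      then have "m \<noteq> None"
        using prim_None[OF f] unfolding supp_def by (metis mem_Collect_eq)
      moreover have "m \<in> mon_basis omega"
        using m(1) prim_Aspace[OF f] by (auto simp: Aspace_def)
      ultimately have "k \<ge> 1" using m(2) cont_eq_empty_iff[of m omega] by (auto simp: Suc_le_eq nonempty_has_size)
      moreover have "restrict_cont (\<lambda>c. size c = k) f \<in> PrimGr omega k"
        using prim_restrict_cont[OF f] by (simp add: PrimGr_iff supp_restrict_cont)
      ultimately show ?thesis by (intro fv.span_base) blast
    qed
    ultimately show "f \<in> fv.span (\<Union>k\<in>{1..}. PrimGr omega k)"
      by (metis (no_types, lifting) fv.span_sum)
  qed
qed

lemma shuffle_mset_free: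
  fixes Bs :: "('x mono \<Rightarrow> 'k::field_char_0) set"
  assumes indep: "fv.independent Bs" and span: "fv.span Bs = {f. prim omega f}"
  shows "fv.span (shuffle_mset omega ` {M. set_mset M \<subseteq> Bs}) = Aspace omega"
proof
  have prim: "prim omega b" if "b \<in> Bs" for b using that span fv.span_base by blast
  then have BA: "Bs \<subseteq> Aspace omega" by (auto intro: prim_Aspace)
  show "fv.span (shuffle_mset omega ` {M. set_mset M \<subseteq> Bs}) \<subseteq> Aspace omega"
    by (rule fv.span_minimal[OF _ subspace_Aspace]) (use BA in \<open>auto intro: shuffle_mset_in_Aspace\<close>)
  show "Aspace omega \<subseteq> fv.span (shuffle_mset omega ` {M. set_mset M \<subseteq> Bs})"
  proof
    fix f :: "'x mono \<Rightarrow> 'k" assume f: "f \<in> Aspace omega"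
    show "f \<in> fv.span (shuffle_mset omega ` {M. set_mset M \<subseteq> Bs})"
    proof (rule in_span_deltas[OF Aspace_finite[OF f]])
      fix m assume "m \<in> supp f"
      then have m: "m \<in> mon_basis omega" using f by (auto simp: Aspace_def)
      have "delta m \<in> fv.span (shuffle_mset omega ` {M. set_mset M \<subseteq> Bs \<and> (\<Sum>h\<in>#M. 0 :: nat) = 0})"
        by (rule delta_in_span_shuffle_mset[where \<gamma> = "\<lambda>_. 0" and C = "cont m", OF BA])
          (use span m in auto)
      then show "delta m \<in> fv.span (shuffle_mset omega ` {M. set_mset M \<subseteq> Bs})" by simp
    qed
  qed
qed

section \<open>The orthogonal complement of the primitive elements\<close>

text \<open>A primitive element splits only with an empty side, and there \<open>u\<close> or
  \<open>v\<close> vanishes.\<close>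

lemma pair_sh_prim:
  fixes u v :: "'x mono \<Rightarrow> 'k::field"
  assumes "u \<in> Aspace omega" "v \<in> Aspace omega" "u None = 0" "v None = 0" and p: "prim omega p"
  shows "pair (sh omega u v) p = 0"
proof -
  have "pair (sh omega u v) p = pair p (sh omega u v)"
    by (intro pair_commute Aspace_finite[where omega = omega] sh_in_Aspace assms(1,2) prim_Aspace[OF p])
  also have "\<dots> = pair p (\<lambda>m. \<Sum>x\<leftarrow>copm m. u (fst x) * v (snd x))"
    using prim_Aspace[OF p] by (intro pair_cong) (auto simp: Aspace_def sh_def case_prod_unfold)
  also have "\<dots> = 0"
    unfolding pair_prim_splittings[OF p] using assms(3,4) by simp
  finally show ?thesis .
qed

lemma shuffle_mset_None:
  assumes "M \<noteq> {#}" "\<And>b. b \<in># M \<Longrightarrow> prim omega b"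
  shows "shuffle_mset omega M None = 0"
proof -
  obtain b M' where M: "M = add_mset b M'" using assms(1) by (meson multiset_cases)
  have "shuffle_mset omega M = sh omega b (shuffle_mset omega M')"
    unfolding M by (rule shuffle_mset_add_sh) (use assms(2) M in \<open>auto intro: prim_Aspace\<close>)
  moreover have "b None = 0" using assms(2) M by (intro prim_None[of omega]) simp
  ultimately show ?thesis by simp
qed

lemma shuffle_mset_homogeneous:
  fixes \<gamma> :: "'x multiset \<Rightarrow> 'g::comm_monoid_add" and \<delta> :: "('x mono \<Rightarrow> 'k::field) \<Rightarrow> 'g"
  assumes \<gamma>: "\<gamma> {#} = 0" "\<And>c d. \<gamma> (c + d) = \<gamma> c + \<gamma> d"
    and M: "set_mset M \<subseteq> Aspace omega" "\<And>h m. h \<in># M \<Longrightarrow> m \<in> supp h \<Longrightarrow> \<gamma> (cont m) = \<delta> h"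
    and m: "m \<in> supp (shuffle_mset omega M)"
  shows "\<gamma> (cont m) = (\<Sum>h\<in>#M. \<delta> h)"
  using M m
proof (induction M arbitrary: m)
  case empty
  then show ?case by (simp add: \<gamma>)
next
  case (add h M)
  have "sh omega h (shuffle_mset omega M) m \<noteq> 0"
    using add.prems by (simp add: shuffle_mset_add_sh supp_def)
  then obtain a b where ab: "h a \<noteq> 0" "shuffle_mset omega M b \<noteq> 0" "cont a + cont b = cont m"
    by (rule sh_support)
  have "\<gamma> (cont a) = \<delta> h" using add.prems(2)[of h a] ab(1) by (simp add: supp_def)
  moreover have "\<gamma> (cont b) = (\<Sum>h\<in>#M. \<delta> h)"
    using add.IH[of b] add.prems ab(2) by (simp add: supp_def)
  ultimately show ?case using ab(3)[symmetric] by (simp add: \<gamma>(2))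
qed

text \<open>Projecting a linear combination to weight \<open>k\<close> fixes the elements of
  \<open>H\<close> of that weight, kills the others and leaves \<open>p\<close> unchanged.\<close>

lemma span_homogeneous:
  fixes H :: "('x mono \<Rightarrow> 'k::field) set"
  assumes H: "\<And>h m. h \<in> H \<Longrightarrow> m \<in> supp h \<Longrightarrow> \<gamma> (cont m) = \<delta> h"
    and p: "p \<in> fv.span H" "\<And>m. m \<in> supp p \<Longrightarrow> \<gamma> (cont m) = k"
  shows "p \<in> fv.span {h \<in> H. \<delta> h = k}"
proof -
  let ?R = "restrict_cont (\<lambda>c. \<gamma> c = k)"
  have "?R p \<in> fv.span {h \<in> H. \<delta> h = k}"
    using p(1)
  proof (induction rule: fv.span_induct_alt)
    case base
    show ?case by (simp only: restrict_cont_zero fv.span_zero)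
  next
    case (step c h y)
    have "?R h \<in> fv.span {h \<in> H. \<delta> h = k}"
    proof (cases "\<delta> h = k")
      case True
      then have "?R h = h"
        using H[OF step(1)] by (auto simp: restrict_cont_def fun_eq_iff supp_def)
      then show ?thesis using step(1) True by (simp add: fv.span_base)
    next
      case False
      then have "?R h m = 0" for m
        using H[OF step(1), of m] by (cases "h m = 0") (auto simp: restrict_cont_def supp_def)
      then have "?R h = 0" by (simp add: fun_eq_iff)
      then show ?thesis by (simp only: fv.span_zero)
    qed
    then show ?case
      unfolding restrict_cont_add restrict_cont_sc using step(2) by (intro fv.span_add fv.span_scale)
  qed
  moreover have "?R p = p"
    using p(2) by (auto simp: restrict_cont_def fun_eq_iff supp_def)
  ultimately show ?thesis by simp
qed

lemma subspace_PrimGr: "fv.subspace (PrimGr omega n :: ('x mono \<Rightarrow> 'k::field) set)"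
proof (rule fv.subspaceI)
  show "0 \<in> (PrimGr omega n :: ('x mono \<Rightarrow> 'k) set)"
    using fv.subspace_0[OF subspace_prim[of omega]] by (simp add: PrimGr_iff supp_def)
next
  fix f g :: "'x mono \<Rightarrow> 'k" assume "f \<in> PrimGr omega n" "g \<in> PrimGr omega n"
  then show "f + g \<in> PrimGr omega n"
    using fv.subspace_add[OF subspace_prim[of omega], of f g] supp_add[of f g]
    unfolding PrimGr_iff mem_Collect_eq by blast
next
  fix f :: "'x mono \<Rightarrow> 'k" and c assume "f \<in> PrimGr omega n"
  then show "sc c f \<in> PrimGr omega n"
    using fv.subspace_scale[OF subspace_prim[of omega], of f c] supp_sc[of c f]
    unfolding PrimGr_iff mem_Collect_eq by blast
qed

lemma subspace_orthogonal:
  "fv.subspace {g \<in> Agr omega n. \<forall>p \<in> (P :: ('x mono \<Rightarrow> 'k::field) set). pair g p = 0}"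
proof (rule fv.subspaceI)
  show "0 \<in> {g \<in> Agr omega n. \<forall>p \<in> P. pair g p = 0}"
    using fv.subspace_0[OF subspace_Aspace[of omega]] by (simp add: Agr_def supp_def pair_def)
next
  fix f g assume *: "f \<in> {g \<in> Agr omega n. \<forall>p \<in> P. pair g p = 0}" "g \<in> {g \<in> Agr omega n. \<forall>p \<in> P. pair g p = 0}"
  then have A: "f \<in> Aspace omega" "g \<in> Aspace omega" by (auto simp: Agr_def)
  have "f + g \<in> Agr omega n"
    using * fv.subspace_add[OF subspace_Aspace A] supp_add[of f g] unfolding Agr_def mem_Collect_eq by blast
  then show "f + g \<in> {g \<in> Agr omega n. \<forall>p \<in> P. pair g p = 0}"
    using * by (simp add: pair_add_left Aspace_finite[OF A(1)] Aspace_finite[OF A(2)])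
next
  fix f c assume *: "f \<in> {g \<in> Agr omega n. \<forall>p \<in> P. pair g p = 0}"
  then have A: "f \<in> Aspace omega" by (auto simp: Agr_def)
  have "sc c f \<in> Agr omega n"
    using * fv.subspace_scale[OF subspace_Aspace A] supp_sc[of c f] unfolding Agr_def mem_Collect_eq by blast
  then show "sc c f \<in> {g \<in> Agr omega n. \<forall>p \<in> P. pair g p = 0}"
    using * by (simp add: pair_sc_left Aspace_finite[OF A])
qed

text \<open>A shuffle monomial of degree \<open>n\<close> has at least two factors, hence is
  orthogonal to primitive elements. Conversely, primitive elements and these monomials together span
  degree \<open>n\<close>; for an element of the complement, the primitive part is itself orthogonal
  to all primitive elements, so it is 0 by nondegeneracy.\<close>

lemma shuffle_mset_basis_complement:
  fixes H :: "('x mono \<Rightarrow> 'k::field_char_0) set" and \<delta> :: "('x mono \<Rightarrow> 'k) \<Rightarrow> nat"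
  assumes n: "n \<ge> 2"
    and H: "\<And>h. h \<in> H \<Longrightarrow> h \<in> PrimGr omega (\<delta> h)" "\<And>h. h \<in> H \<Longrightarrow> 1 \<le> \<delta> h \<and> \<delta> h \<le> n - 1"
    and span: "(\<Union>k\<in>{1..n-1}. PrimGr omega k) \<subseteq> fv.span H"
  shows "fv.span (shuffle_mset omega ` {M. set_mset M \<subseteq> H \<and> (\<Sum>h\<in>#M. \<delta> h) = n})
    = {g \<in> Agr omega n. \<forall>p \<in> PrimGr omega n. pair g p = 0}"
proof -
  let ?S = "shuffle_mset omega"
  let ?X = "\<lambda>k. {M. set_mset M \<subseteq> H \<and> (\<Sum>h\<in>#M. \<delta> h) = k}"
  let ?B = "{g \<in> (Agr omega n :: ('x mono \<Rightarrow> 'k) set). \<forall>p \<in> PrimGr omega n. pair g p = 0}"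
  have prim: "prim omega h" if "h \<in> H" for h using H(1)[OF that] by (simp add: PrimGr_iff)
  have HA: "H \<subseteq> Aspace omega" using prim by (auto intro: prim_Aspace)
  have hom: "size (cont m) = \<delta> h" if "h \<in> H" "m \<in> supp h" for h m
    using H(1)[OF that(1)] that(2) by (simp add: PrimGr_iff)
  have "?S M \<in> ?B" if M: "M \<in> ?X n" for M
  proof -
    have "M \<noteq> {#}" using M n by auto
    then obtain b M' where M': "M = add_mset b M'" by (meson multiset_cases)
    \<comment> \<open>No single generator has degree \<open>n\<close>, so there is a further
      factor.\<close>
    have "\<delta> b \<le> n - 1" using H(2)[of b] M M' by auto
    then have M'0: "M' \<noteq> {#}" using M M' n by auto
    have in_H: "set_mset M \<subseteq> H" "b \<in> H" "set_mset M' \<subseteq> H" using M M' by auto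
    have A: "set_mset M \<subseteq> Aspace omega" "b \<in> Aspace omega" "set_mset M' \<subseteq> Aspace omega"
      using in_H HA by auto
    have "pair (?S M) p = 0" if "p \<in> PrimGr omega n" for p
      unfolding M' shuffle_mset_add_sh[OF A(2,3)]
      using that in_H prim M'0
      by (intro pair_sh_prim shuffle_mset_in_Aspace A prim_None[of omega] shuffle_mset_None)
        (auto simp: PrimGr_iff)
    moreover have "size (cont m) = n" if "m \<in> supp (?S M)" for m
    proof -
      have "size (cont m) = (\<Sum>h\<in>#M. \<delta> h)"
        by (rule shuffle_mset_homogeneous[OF _ _ A(1) _ that]) (use hom in_H(1) in auto)
      then show ?thesis using M by simp
    qed
    ultimately show ?thesis
      using shuffle_mset_in_Aspace[OF A(1)] by (simp add: Agr_def size_cont)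
  qed
  then have sub: "fv.span (?S ` ?X n) \<subseteq> ?B"
    by (intro fv.span_minimal subspace_orthogonal) blast
  \<comment> \<open>Generators of degree at most \<open>n - 1\<close> suffice below degree
    \<open>n\<close>, because only primitive elements with leaves among those of \<open>m\<close>
    are needed.\<close>
  have low: "delta m \<in> fv.span (?S ` ?X (mdeg m))" if m: "m \<in> mon_basis omega" "mdeg m < n" for m
  proof -
    have "delta m \<in> fv.span (?S ` ?X (size (cont m)))"
    proof (rule delta_in_span_shuffle_mset[where C = "cont m", OF HA])
      fix p :: "'x mono \<Rightarrow> 'k" and c
      assume p: "prim omega p" "c \<subseteq># cont m" "\<forall>m\<in>supp p. cont m = c"
      have "p \<in> fv.span H"
      proof (cases "p = 0")
        case False
        then obtain a where a: "a \<in> supp p" by (auto simp: supp_def fun_eq_iff)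
        then have "a \<in> mon_basis omega" "a \<noteq> None"
          using prim_Aspace[OF p(1)] prim_None[OF p(1)] unfolding Aspace_def supp_def
          by (blast, metis (mono_tags, lifting) mem_Collect_eq)
        then have "size c \<noteq> 0" using a p(3) cont_eq_empty_iff[of a omega] by auto
        moreover have "size c \<le> n - 1"
          using size_mset_mono[OF p(2)] m(2) by (simp add: size_cont)
        ultimately have "p \<in> (\<Union>k\<in>{1..n-1}. PrimGr omega k)"
          using p by (intro UN_I[of "size c"]) (auto simp: PrimGr_iff Suc_le_eq nonempty_has_size)
        then show ?thesis using span by blast
      qed (simp only: fv.span_zero)
      then show "p \<in> fv.span {h \<in> H. \<delta> h = size c}"
        by (rule span_homogeneous[where \<gamma> = size, rotated]) (use p(3) hom in auto)
    qed (use m in auto)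
    then show ?thesis by (simp only: size_cont)
  qed
  have top: "delta m \<in> fv.span (PrimGr omega n \<union> ?S ` ?X n)" if m: "m \<in> mon_basis omega" "mdeg m = n" for m
  proof -
    let ?Pr = "{p :: 'x mono \<Rightarrow> 'k. prim omega p \<and> (\<forall>m'\<in>supp p. cont m' = cont m)}"
    let ?De = "{sh omega (delta a) (delta b) | a b. a \<in> mon_basis omega \<and> b \<in> mon_basis omega
      \<and> a \<noteq> None \<and> b \<noteq> None \<and> cont a + cont b = cont m}"
    have mN: "m \<noteq> None" using m n by (cases m) (auto simp: mdeg_def)
    have "?Pr \<subseteq> PrimGr omega n" using m(2) by (auto simp: PrimGr_iff size_cont)
    then have "?Pr \<subseteq> fv.span (PrimGr omega n \<union> ?S ` ?X n)" using fv.span_superset by blast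
    moreover have "d \<in> fv.span (PrimGr omega n \<union> ?S ` ?X n)" if d: "d \<in> ?De" for d
    proof -
      obtain a b where d: "d = sh omega (delta a) (delta b)" and ab: "a \<in> mon_basis omega" "b \<in> mon_basis omega"
          "a \<noteq> None" "b \<noteq> None" "cont a + cont b = cont m"
        using d by blast
      have deg: "mdeg a + mdeg b = n" using ab(5) m(2) by (metis size_cont size_union)
      have "mdeg a \<noteq> 0" "mdeg b \<noteq> 0" using ab mdeg_eq_0_iff by blast+
      then have "mdeg a < n" "mdeg b < n" using deg by linarith+
      then have "delta a \<in> fv.span (?S ` ?X (mdeg a))" "delta b \<in> fv.span (?S ` ?X (mdeg b))"
        using low ab by blast+
      then have "d \<in> fv.span (?S ` ?X n)" unfolding d
      proof (rule sh_in_span)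
        fix u v assume "u \<in> ?S ` ?X (mdeg a)" "v \<in> ?S ` ?X (mdeg b)"
        then obtain M N where M: "u = ?S M" "set_mset M \<subseteq> H" "(\<Sum>h\<in>#M. \<delta> h) = mdeg a"
          and N: "v = ?S N" "set_mset N \<subseteq> H" "(\<Sum>h\<in>#N. \<delta> h) = mdeg b"
          by blast
        have "sh omega u v = ?S (M + N)"
          unfolding M(1) N(1) by (rule shuffle_mset_union[symmetric]) (use M(2) N(2) HA in auto)
        moreover have "M + N \<in> ?X n" using M N deg by simp
        ultimately show "sh omega u v \<in> fv.span (?S ` ?X n)"
          by (metis (no_types, lifting) fv.span_base image_eqI)
      qed
      then show ?thesis using fv.span_mono[of "?S ` ?X n" "PrimGr omega n \<union> ?S ` ?X n"] by blast
    qed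
    ultimately have "?Pr \<union> ?De \<subseteq> fv.span (PrimGr omega n \<union> ?S ` ?X n)" by blast
    then have "fv.span (?Pr \<union> ?De) \<subseteq> fv.span (PrimGr omega n \<union> ?S ` ?X n)"
      by (rule fv.span_minimal[OF _ fv.subspace_span])
    then show ?thesis
      using delta_in_span_prim_decomposable[OF m(1) mN] by blast
  qed
  have "?B \<subseteq> fv.span (?S ` ?X n)"
  proof
    fix g assume g: "g \<in> ?B"
    then have gA: "g \<in> Aspace omega" by (simp add: Agr_def)
    have "g \<in> fv.span (PrimGr omega n \<union> ?S ` ?X n)"
      by (rule in_span_deltas[OF Aspace_finite[OF gA] top]) (use g in \<open>auto simp: Agr_def Aspace_def\<close>)
    then obtain w s where ws: "g = w + s" "w \<in> fv.span (PrimGr omega n)" "s \<in> fv.span (?S ` ?X n)"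
      unfolding fv.span_Un by blast
    have w: "w \<in> PrimGr omega n"
      using ws(2) fv.span_eq_iff[THEN iffD2, OF subspace_PrimGr] by blast
    have "s \<in> ?B" using ws(3) sub by blast
    then have "g - s \<in> ?B" by (rule fv.subspace_diff[OF subspace_orthogonal g])
    moreover have "g - s = w" using ws(1) by simp
    ultimately have wB: "w \<in> ?B" by simp
    have "w = 0"
    proof (rule ccontr)
      assume "w \<noteq> 0"
      moreover have "prim omega w" using w by (simp add: PrimGr_iff)
      ultimately obtain p where p: "prim omega p" "supp p \<subseteq> supp w" "pair w p \<noteq> 0"
        using pair_nondegenerate by blast
      then have "p \<in> PrimGr omega n" using w by (auto simp: PrimGr_iff)
      then show False using wB p(3) by blast
    qed
    then show "g \<in> fv.span (?S ` ?X n)" using ws(1,3) by simp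
  qed
  then show ?thesis using sub by blast
qed

text \<open>As \<open>fs\<close> is distinct, sorted index lists correspond bijectively to multisets
  over its entries, and \<open>d\<close> becomes a degree function on the entries through the
  inverse of indexing.\<close>

lemma shuffle_list_basis_complement:
  fixes fs :: "('x mono \<Rightarrow> 'k::field_char_0) list" and d :: "nat \<Rightarrow> nat"
  assumes n: "2 \<le> n" and dist: "distinct fs"
    and fs: "\<forall>i < length fs. 1 \<le> d i \<and> d i \<le> n - 1 \<and> fs ! i \<in> PrimGr omega (d i)"
    and indep: "fv.independent (set fs)"
    and span: "fv.span (set fs) = fv.span (\<Union>k\<in>{1..n-1}. PrimGr omega k)"
  defines "I \<equiv> {is. sorted is \<and> set is \<subseteq> {..<length fs} \<and> sum_list (map d is) = n}"
    and "P \<equiv> (\<lambda>is. shuffle_list omega (map ((!) fs) is))"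
  shows "inj_on P I" and "fv.independent (P ` I)"
    and "fv.span (P ` I) = {g \<in> Agr omega n. \<forall>p \<in> PrimGr omega n. pair g p = 0}"
proof -
  define idx where "idx = the_inv_into {..<length fs} ((!) fs)"
  have inj: "inj_on ((!) fs) {..<length fs}" using dist by (simp add: inj_on_nth)
  have idx: "idx (fs ! i) = i" if "i < length fs" for i
    unfolding idx_def using inj that by (intro the_inv_into_f_f) auto
  have nth_idx: "idx h < length fs \<and> fs ! idx h = h" if "h \<in> set fs" for h
    using that idx by (auto simp: in_set_conv_nth)
  define \<delta> where "\<delta> h = d (idx h)" for h
  let ?X = "{M. set_mset M \<subseteq> set fs \<and> (\<Sum>h\<in>#M. \<delta> h) = n}"
  have prim: "prim omega h" if "h \<in> set fs" for h
    using fs nth_idx[OF that] by (metis PrimGr_iff)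
  define \<phi> where "\<phi> is = mset (map ((!) fs) is)" for "is"
  have P: "P is = shuffle_mset omega (\<phi> is)" for "is"
    by (simp add: P_def \<phi>_def shuffle_list_eq_mset)
  have idx_\<phi>: "image_mset idx (\<phi> is) = mset is" if "set is \<subseteq> {..<length fs}" for "is"
  proof -
    have "map idx (map ((!) fs) is) = is"
      using that idx by (simp add: map_idI subset_iff)
    then show ?thesis unfolding \<phi>_def by (metis mset_map)
  qed
  have inj_\<phi>: "inj_on \<phi> I"
  proof (rule inj_onI)
    fix xs ys assume xs: "xs \<in> I" and ys: "ys \<in> I" and "\<phi> xs = \<phi> ys"
    then have "mset xs = mset ys" using idx_\<phi> unfolding I_def by (metis (mono_tags, lifting) mem_Collect_eq)
    then show "xs = ys" using xs ys unfolding I_def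
      by (metis (mono_tags, lifting) mem_Collect_eq properties_for_sort sorted_sort_id)
  qed
  have im_\<phi>: "\<phi> ` I = ?X"
  proof (intro subset_antisym subsetI)
    fix M assume "M \<in> \<phi> ` I"
    then obtain xs where xs: "sorted xs" "set xs \<subseteq> {..<length fs}" "sum_list (map d xs) = n" "M = \<phi> xs"
      by (auto simp: I_def)
    have "(\<Sum>h\<in>#M. \<delta> h) = (\<Sum>i\<in>#image_mset idx M. d i)"
      by (simp add: \<delta>_def image_mset.compositionality o_def)
    also have "\<dots> = n"
      using xs idx_\<phi>[OF xs(2)] by (simp add: sum_mset_sum_list flip: mset_map)
    finally show "M \<in> ?X" using xs by (auto simp: \<phi>_def)
  next
    fix M assume M: "M \<in> ?X"
    define xs where "xs = sorted_list_of_multiset (image_mset idx M)"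
    have mset: "mset xs = image_mset idx M" by (simp add: xs_def)
    have "set xs \<subseteq> {..<length fs}"
      using M nth_idx unfolding set_mset_mset[symmetric] mset by auto
    moreover have "sum_list (map d xs) = n"
    proof -
      have "sum_list (map d xs) = (\<Sum>i\<in>#mset xs. d i)" by (simp add: sum_mset_sum_list flip: mset_map)
      also have "\<dots> = (\<Sum>h\<in>#M. \<delta> h)" by (simp add: mset \<delta>_def image_mset.compositionality o_def)
      finally show ?thesis using M by simp
    qed
    ultimately have "xs \<in> I" by (simp add: I_def xs_def)
    moreover have "\<phi> xs = M"
    proof -
      have "\<phi> xs = image_mset (\<lambda>h. fs ! idx h) M"
        by (simp add: \<phi>_def mset image_mset.compositionality o_def)
      also have "\<dots> = image_mset (\<lambda>h. h) M"
        by (rule image_mset_cong) (use M nth_idx in auto)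
      finally show ?thesis by simp
    qed
    ultimately show "M \<in> \<phi> ` I" by blast
  qed
  have PI: "P ` I = shuffle_mset omega ` ?X"
    unfolding im_\<phi>[symmetric] image_image P ..
  note free = shuffle_mset_independent[OF indep prim]
  have "inj_on (shuffle_mset omega) (\<phi> ` I)"
    using free(1) unfolding im_\<phi> by (rule inj_on_subset) auto
  then show "inj_on P I"
    using comp_inj_on[OF inj_\<phi>] unfolding P[abs_def] o_def by blast
  show "fv.independent (P ` I)"
    unfolding PI by (rule fv.independent_mono[OF free(2)]) auto
  show "fv.span (P ` I) = {g \<in> Agr omega n. \<forall>p \<in> PrimGr omega n. pair g p = 0}"
    unfolding PI
  proof (rule shuffle_mset_basis_complement[OF n])
    fix h assume "h \<in> set fs"
    then show "h \<in> PrimGr omega (\<delta> h)" "1 \<le> \<delta> h \<and> \<delta> h \<le> n - 1"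
      using fs nth_idx[of h] by (auto simp: \<delta>_def dest: spec[of _ "idx h"])
  next
    show "(\<Union>k\<in>{1..n-1}. PrimGr omega k) \<subseteq> fv.span (set fs)"
      unfolding span by (rule fv.span_superset)
  qed
qed

section \<open>Generating series\<close>

definition PrimCont :: "bool \<Rightarrow> 'x multiset \<Rightarrow> ('x mono \<Rightarrow> 'k::field) set" where
  "PrimCont omega c = {p. prim omega p \<and> (\<forall>m\<in>supp p. cont m = c)}"

definition prim_basis :: "bool \<Rightarrow> 'x multiset \<Rightarrow> ('x mono \<Rightarrow> 'k::field) set" where
  "prim_basis omega c = (SOME B. B \<subseteq> PrimCont omega c \<and> fv.independent B \<and> PrimCont omega c \<subseteq> fv.span B)"

lemma prim_basis:
  "(prim_basis omega c :: ('x mono \<Rightarrow> 'k::field) set) \<subseteq> PrimCont omega c"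
  "fv.independent (prim_basis omega c :: ('x mono \<Rightarrow> 'k::field) set)"
  "(PrimCont omega c :: ('x mono \<Rightarrow> 'k::field) set) \<subseteq> fv.span (prim_basis omega c)"
proof -
  have "\<exists>B :: ('x mono \<Rightarrow> 'k) set. B \<subseteq> PrimCont omega c \<and> fv.independent B \<and> PrimCont omega c \<subseteq> fv.span B"
    using fv.maximal_independent_subset by metis
  from someI_ex[OF this, folded prim_basis_def]
  show "(prim_basis omega c :: ('x mono \<Rightarrow> 'k::field) set) \<subseteq> PrimCont omega c"
    "fv.independent (prim_basis omega c :: ('x mono \<Rightarrow> 'k::field) set)"
    "(PrimCont omega c :: ('x mono \<Rightarrow> 'k::field) set) \<subseteq> fv.span (prim_basis omega c)"
    by blast+
qed

text \<open>A basis of the primitive elements adapted to the leaf-multiset grading, so that shuffle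
  monomials can be sorted by their leaves.\<close>

definition prim_gens :: "bool \<Rightarrow> ('x mono \<Rightarrow> 'k::field) set" where
  "prim_gens omega = (\<Union>c. prim_basis omega c)"

text \<open>For a generator all monomials of the support have the same leaf multiset, so the choice
  is immaterial.\<close>

definition gen_cont :: "('x mono \<Rightarrow> 'k::zero) \<Rightarrow> 'x multiset" where
  "gen_cont h = cont (SOME m. m \<in> supp h)"

lemma prim_basis_supp: "h \<in> prim_basis omega c \<Longrightarrow> m \<in> supp h \<Longrightarrow> cont m = c"
  using prim_basis(1) by (auto simp: PrimCont_def)

lemma gen_cont_prim_basis:
  assumes "(h :: 'x mono \<Rightarrow> 'k::field) \<in> prim_basis omega c"
  shows "gen_cont h = c"
proof -
  have "h \<noteq> 0" using assms prim_basis(2) fv.dependent_zero by metis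
  then have "\<exists>m. m \<in> supp h" by (auto simp: supp_def fun_eq_iff)
  then have "(SOME m. m \<in> supp h) \<in> supp h" by (rule someI_ex)
  then show ?thesis unfolding gen_cont_def by (rule prim_basis_supp[OF assms])
qed

lemma prim_gens_cont: "{h \<in> prim_gens omega. gen_cont h = c} = (prim_basis omega c :: ('x mono \<Rightarrow> 'k::field) set)"
  by (auto simp: prim_gens_def gen_cont_prim_basis)

lemma prim_gens_prim: "h \<in> prim_gens omega \<Longrightarrow> prim omega h"
  using prim_basis(1) by (auto simp: prim_gens_def PrimCont_def)

lemma prim_gens_supp: "(h :: 'x mono \<Rightarrow> 'k::field) \<in> prim_gens omega \<Longrightarrow> m \<in> supp h \<Longrightarrow> cont m = gen_cont h"
  by (auto simp: prim_gens_def gen_cont_prim_basis dest: prim_basis_supp)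

text \<open>Projecting a relation to the leaf multiset of one of its generators leaves a relation
  inside a single basis.\<close>

lemma prim_gens_independent: "fv.independent (prim_gens omega :: ('x mono \<Rightarrow> 'k::field) set)"
proof
  assume "fv.dependent (prim_gens omega :: ('x mono \<Rightarrow> 'k) set)"
  then obtain F u h where F: "finite F" "F \<subseteq> prim_gens omega" "h \<in> F" "u h \<noteq> (0 :: 'k)"
      and rel: "(\<Sum>h\<in>F. sc (u h) h) = (0 :: 'x mono \<Rightarrow> 'k)"
    unfolding fv.dependent_explicit by blast
  define c where "c = gen_cont h"
  let ?R = "restrict_cont (\<lambda>d. d = c)"
  define F' where "F' = {g \<in> F. gen_cont g = c}"
  have R: "?R g = (if gen_cont g = c then g else 0)" if "g \<in> F" for g
  proof
    fix m
    show "?R g m = (if gen_cont g = c then g else 0) m"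
      using prim_gens_supp[of g omega m] that F(2)
      by (cases "g m = 0") (auto simp: restrict_cont_def supp_def)
  qed
  have "0 = ?R (\<Sum>g\<in>F. sc (u g) g)" by (simp only: rel restrict_cont_zero)
  also have "\<dots> = (\<Sum>g\<in>F. sc (u g) (if gen_cont g = c then g else 0))"
    unfolding restrict_cont_sum restrict_cont_sc by (intro sum.cong refl) (simp only: R)
  also have "\<dots> = (\<Sum>g\<in>F'. sc (u g) g)"
    unfolding F'_def by (rule sum.mono_neutral_cong_right[OF F(1)]) (auto simp: fun_eq_iff)
  finally have rel': "(\<Sum>g\<in>F'. sc (u g) g) = 0" by simp
  have "u h = 0"
  proof (rule fv_independentD[OF prim_basis(2)[of omega c] _ _ rel'])
    show "finite F'" using F(1) by (simp add: F'_def)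
    show "F' \<subseteq> prim_basis omega c" using F(2) unfolding F'_def prim_gens_cont[symmetric] by blast
    show "h \<in> F'" using F(3) by (simp add: F'_def c_def)
  qed
  then show False using F(4) by simp
qed

definition gen_msets :: "bool \<Rightarrow> 'x multiset \<Rightarrow> ('x mono \<Rightarrow> 'k::field) multiset set" where
  "gen_msets omega c = {M. set_mset M \<subseteq> prim_gens omega \<and> (\<Sum>h\<in>#M. gen_cont h) = c}"

text \<open>Generation restricted to one leaf multiset, which is possible because the generators are
  homogeneous.\<close>

lemma span_gen_msets:
  "fv.span (shuffle_mset omega ` gen_msets omega c)
    = fv.span (delta ` {m \<in> mon_basis omega. cont m = c} :: ('x mono \<Rightarrow> 'k::field_char_0) set)"
proof (rule fv.span_eq[THEN iffD2], intro conjI subsetI)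
  let ?D = "{m \<in> mon_basis omega. cont m = c}"
  have HA: "prim_gens omega \<subseteq> (Aspace omega :: ('x mono \<Rightarrow> 'k) set)"
    using prim_gens_prim prim_Aspace by blast
  show "f \<in> fv.span (delta ` ?D)" if f: "f \<in> shuffle_mset omega ` gen_msets omega c" for f :: "'x mono \<Rightarrow> 'k"
  proof -
    obtain M where M: "set_mset M \<subseteq> prim_gens omega" "(\<Sum>h\<in>#M. gen_cont h) = c" "f = shuffle_mset omega M"
      using f by (auto simp: gen_msets_def)
    have MA: "set_mset M \<subseteq> Aspace omega" using M(1) HA by blast
    have fA: "f \<in> Aspace omega" unfolding M(3) using MA by (rule shuffle_mset_in_Aspace)
    show ?thesis
    proof (rule in_span_deltas[OF Aspace_finite[OF fA]])
      fix m assume m: "m \<in> supp f"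
      have "id (cont m) = (\<Sum>h\<in>#M. gen_cont h)"
        by (rule shuffle_mset_homogeneous[where \<gamma> = id, OF _ _ MA _ m[unfolded M(3)]])
          (use M(1) prim_gens_supp in auto)
      then have "m \<in> ?D" using m fA M(2) by (auto simp: Aspace_def)
      then show "delta m \<in> fv.span (delta ` ?D)" by (intro fv.span_base imageI)
    qed
  qed
  show "f \<in> fv.span (shuffle_mset omega ` gen_msets omega c)" if f: "f \<in> delta ` ?D" for f :: "'x mono \<Rightarrow> 'k"
  proof -
    obtain m where m: "m \<in> mon_basis omega" "cont m = c" "f = delta m" using f by blast
    have "(delta m :: 'x mono \<Rightarrow> 'k) \<in> fv.span (shuffle_mset omega `
        {M. set_mset M \<subseteq> prim_gens omega \<and> (\<Sum>h\<in>#M. gen_cont h) = id (cont m)})"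
    proof (rule delta_in_span_shuffle_mset[where C = "cont m" and \<gamma> = id and \<delta> = gen_cont, OF HA _ _ _ m(1)])
      fix p :: "'x mono \<Rightarrow> 'k" and d assume "prim omega p" "\<forall>m\<in>supp p. cont m = d"
      then show "p \<in> fv.span {h \<in> prim_gens omega. gen_cont h = id d}"
        using prim_basis(3)[of omega d] by (auto simp: prim_gens_cont PrimCont_def)
    qed simp_all
    then show ?thesis unfolding gen_msets_def m(3) using m(2) by simp
  qed
qed

lemma inj_delta: "inj_on (delta :: 'm \<Rightarrow> 'm \<Rightarrow> 'k::zero_neq_one) S"
  by (rule inj_onI) (metis supp_delta singleton_inject)

lemma independent_deltas: "fv.independent (delta ` S :: ('m \<Rightarrow> 'k::field) set)"
proof
  assume "fv.dependent (delta ` S :: ('m \<Rightarrow> 'k) set)"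
  then obtain T u v where T: "finite T" "T \<subseteq> delta ` S" "v \<in> T" "u v \<noteq> (0 :: 'k)" "(\<Sum>v\<in>T. sc (u v) v) = 0"
    unfolding fv.dependent_explicit by blast
  then obtain m where m: "v = delta m" by blast
  have "0 = (\<Sum>w\<in>T. sc (u w) w) m" by (simp only: T(5) zero_fun_apply)
  also have "\<dots> = (\<Sum>w\<in>T. u w * w m)" by (simp only: sum_fun_apply sc_apply)
  also have "\<dots> = (\<Sum>w\<in>T. if w = v then u v else 0)"
  proof (rule sum.cong[OF refl])
    fix w assume "w \<in> T"
    then obtain m' where "w = delta m'" using T(2) by blast
    then show "u w * w m = (if w = v then u v else 0)"
    proof (cases "m' = m")
      case False
      then have "w m = 0" using \<open>w = delta m'\<close> by (simp add: delta_def)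
      moreover have "v m = 1" by (simp add: m)
      ultimately show ?thesis by auto
    qed (simp add: m \<open>w = delta m'\<close>)
  qed
  also have "\<dots> = u v" using T(1,3) by simp
  finally show False using T(4) by simp
qed

lemma dim_deltas: "fv.dim (fv.span (delta ` S :: ('m \<Rightarrow> 'k::field) set)) = card S"
  by (simp add: fv.dim_eq_card[OF refl independent_deltas] card_image[OF inj_delta])

text \<open>Shuffle monomials and trees with the given leaves are two bases of the same
  finite-dimensional space.\<close>

lemma
  fixes c :: "'x multiset"
  shows finite_gen_msets: "finite (gen_msets omega c :: ('x mono \<Rightarrow> 'k::field_char_0) multiset set)"
    and card_gen_msets: "card (gen_msets omega c :: ('x mono \<Rightarrow> 'k) multiset set)
      = card {m \<in> mon_basis omega. cont m = c}"
proof -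
  let ?G = "gen_msets omega c :: ('x mono \<Rightarrow> 'k) multiset set"
  let ?D = "{m \<in> mon_basis omega. cont m = c}"
  have sub: "?G \<subseteq> {M. set_mset M \<subseteq> prim_gens omega}" by (auto simp: gen_msets_def)
  note free = shuffle_mset_independent[OF prim_gens_independent[of omega, where 'k = 'k] prim_gens_prim]
  have inj: "inj_on (shuffle_mset omega) ?G" using free(1) sub by (rule inj_on_subset)
  have indep: "fv.independent (shuffle_mset omega ` ?G)"
    by (rule fv.independent_mono[OF free(2) image_mono[OF sub]])
  have "shuffle_mset omega ` ?G \<subseteq> fv.span (delta ` ?D)"
    unfolding span_gen_msets[symmetric] by (rule fv.span_superset)
  then have "finite (shuffle_mset omega ` ?G)"
    using fv.independent_span_bound[OF finite_imageI[OF finite_cont] indep] by blast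
  then show "finite ?G" using inj by (rule finite_imageD)
  have "card ?G = card (shuffle_mset omega ` ?G)" by (rule card_image[OF inj, symmetric])
  also have "\<dots> = fv.dim (fv.span (shuffle_mset omega ` ?G))"
    by (rule fv.dim_span_eq_card_independent[OF indep, symmetric])
  also have "\<dots> = card ?D" unfolding span_gen_msets dim_deltas ..
  finally show "card ?G = card ?D" .
qed

lemma finite_prim_basis: "finite (prim_basis omega c :: ('x mono \<Rightarrow> 'k::field_char_0) set)"
proof -
  have "(\<lambda>h. {#h#}) ` (prim_basis omega c :: ('x mono \<Rightarrow> 'k) set) \<subseteq> gen_msets omega c"
    by (auto simp: gen_msets_def gen_cont_prim_basis prim_gens_def)
  then have "finite ((\<lambda>h. {#h#}) ` (prim_basis omega c :: ('x mono \<Rightarrow> 'k) set))"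
    using finite_gen_msets finite_subset by blast
  then show ?thesis by (rule finite_imageD) (simp add: inj_on_def)
qed

lemma mset_set_split:
  assumes "finite T" "a + b = mset_set T"
  obtains S where "S \<subseteq> T" "a = mset_set S" "b = mset_set (T - S)"
proof
  define S where "S = set_mset a"
  have le: "a \<subseteq># mset_set T" using assms(2) by (metis mset_subset_eq_add_left)
  then show S: "set_mset a \<subseteq> T"
    using assms(1) by (metis finite_set_mset_mset_set set_mset_mono)
  show a: "a = mset_set (set_mset a)"
  proof (rule multiset_eqI)
    fix x
    have "count a x \<le> count (mset_set T) x" using le by (simp add: subseteq_mset_def)
    also have "\<dots> \<le> 1" by (simp add: count_mset_set')
    finally show "count a x = count (mset_set (set_mset a)) x"
      by (cases "x \<in># a") (auto simp: count_mset_set' not_in_iff intro: antisym)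
  qed
  have "mset_set T = mset_set (set_mset a) + mset_set (T - set_mset a)"
    using S assms(1) by (metis Diff_disjoint Diff_partition finite_Diff finite_set_mset mset_set_Union)
  then show "b = mset_set (T - set_mset a)" using assms(2) a by (metis add_left_cancel)
qed

text \<open>Split off the factor containing \<open>t\<close>. Here \<open>U\<close> is the set of
  its other leaves, so that it runs through a power set.\<close>

lemma card_gen_msets_rec:
  fixes T :: "'x set"
  assumes T: "finite T" "t \<in> T"
  shows "card (gen_msets omega (mset_set T) :: ('x mono \<Rightarrow> 'k::field_char_0) multiset set)
    = (\<Sum>U\<in>Pow (T - {t}). card (prim_basis omega (mset_set (insert t U)) :: ('x mono \<Rightarrow> 'k) set)
        * card (gen_msets omega (mset_set (T - insert t U)) :: ('x mono \<Rightarrow> 'k) multiset set))"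
proof -
  let ?B = "\<lambda>U. prim_basis omega (mset_set (insert t U)) :: ('x mono \<Rightarrow> 'k) set"
  let ?G = "\<lambda>S. gen_msets omega (mset_set S) :: ('x mono \<Rightarrow> 'k) multiset set"
  let ?P = "Pow (T - {t})"
  let ?X = "SIGMA U:?P. ?B U \<times> ?G (T - insert t U)"
  let ?f = "\<lambda>(U, h, M). add_mset h M"
  have t_cont: "t \<in># gen_cont h" "t \<notin># (\<Sum>h\<in>#M. gen_cont h)" "gen_cont h = mset_set (insert t U)"
    if "(U, h, M) \<in> ?X" for U h M
  proof -
    have "U \<subseteq> T" using that by auto
    then have fin: "finite U" using T(1) by (rule finite_subset)
    show *: "gen_cont h = mset_set (insert t U)" using that by (auto simp: gen_cont_prim_basis)
    show "t \<in># gen_cont h" using fin by (simp add: *)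
    show "t \<notin># (\<Sum>h\<in>#M. gen_cont h)" using that T(1) by (auto simp: gen_msets_def)
  qed
  \<comment> \<open>This makes the split-off factor recoverable: no generator in the rest involves
    \<open>t\<close>.\<close>
  have not_mem: "h' \<notin># M" if "t \<notin># (\<Sum>h\<in>#M. gen_cont h)" "t \<in># gen_cont h'" for h' and M :: "('x mono \<Rightarrow> 'k) multiset"
    using that by (metis insert_DiffM image_mset_add_mset sum_mset.add_mset union_iff)
  have inj: "inj_on ?f ?X"
  proof (rule inj_onI)
    fix x y assume x: "x \<in> ?X" and y: "y \<in> ?X" and eq: "?f x = ?f y"
    obtain U h M U' h' M' where xy: "x = (U, h, M)" "y = (U', h', M')" by (metis prod_cases3)
    have eq': "add_mset h M = add_mset h' M'" using eq xy by simp
    have X: "(U, h, M) \<in> ?X" "(U', h', M') \<in> ?X" using x y xy by simp_all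
    have "h' \<notin># M" by (rule not_mem[OF t_cont(2)[OF X(1)] t_cont(1)[OF X(2)]])
    then have hh: "h = h'" using eq' by (metis insert_noteq_member)
    then have "mset_set (insert t U) = mset_set (insert t U')"
      using t_cont(3)[OF X(1)] t_cont(3)[OF X(2)] by simp
    moreover have "U \<subseteq> T" "U' \<subseteq> T" using X by auto
    then have "finite (insert t U)" "finite (insert t U')"
      using T(1) by (auto intro: finite_subset)
    ultimately have "insert t U = insert t U'" by (metis finite_set_mset_mset_set)
    moreover have "t \<notin> U" "t \<notin> U'" using X by auto
    ultimately have "U = U'" by (simp add: insert_ident)
    then show "x = y" using xy hh eq' by simp
  qed
  have im: "?f ` ?X = ?G T"
  proof (intro subset_antisym subsetI)
    fix N assume "N \<in> ?f ` ?X"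
    then obtain U h M where x: "(U, h, M) \<in> ?X" and N: "N = add_mset h M" by auto
    have "insert t U \<subseteq> T" using x T by auto
    with T(1) have U: "finite (insert t U)" "insert t U \<subseteq> T" by (auto intro: finite_subset)
    have "(\<Sum>h\<in>#N. gen_cont h) = mset_set (insert t U) + mset_set (T - insert t U)"
      using x t_cont(3)[OF x] by (simp add: N gen_msets_def)
    also have "\<dots> = mset_set T"
      using U T(1) by (metis Diff_disjoint Diff_partition finite_Diff mset_set_Union)
    finally show "N \<in> ?G T"
      using x by (auto simp: N gen_msets_def prim_gens_def)
  next
    fix N assume N: "N \<in> ?G T"
    then have "t \<in># (\<Sum>h\<in>#N. gen_cont h)" using T by (simp add: gen_msets_def)
    then obtain h where h: "h \<in># N" "t \<in># gen_cont h" by auto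
    then obtain M where M: "N = add_mset h M" by (metis insert_DiffM)
    have "gen_cont h + (\<Sum>h\<in>#M. gen_cont h) = mset_set T" using N by (simp add: M gen_msets_def)
    then obtain S where S: "S \<subseteq> T" "gen_cont h = mset_set S" "(\<Sum>h\<in>#M. gen_cont h) = mset_set (T - S)"
      by (rule mset_set_split[OF T(1)])
    have "finite S" using S(1) T(1) by (rule finite_subset)
    then have "t \<in> S" using h(2) S(2) by simp
    then have ins: "insert t (S - {t}) = S" by blast
    have "h \<in> prim_basis omega (mset_set S)"
      using N S(2) unfolding M prim_gens_cont[symmetric] by (simp add: gen_msets_def)
    moreover have "M \<in> ?G (T - S)" using N S(3) by (simp add: M gen_msets_def)
    ultimately have "(S - {t}, h, M) \<in> ?X" using S(1) ins by auto
    then show "N \<in> ?f ` ?X" unfolding M by (rule rev_image_eqI) simp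
  qed
  have "card (?G T) = card ?X" unfolding im[symmetric] by (rule card_image[OF inj])
  also have "\<dots> = (\<Sum>U\<in>?P. card (?B U \<times> ?G (T - insert t U)))"
    using T(1) by (intro card_SigmaI ballI finite_cartesian_product finite_prim_basis finite_gen_msets) auto
  finally show ?thesis by (simp only: card_cartesian_product)
qed

section \<open>Independence of the names of the leaves; the numerical recursion\<close>

lemma set_ptree_leaves: "set_ptree t = set (leaves t)"
  by (induction t) auto

lemma leaves_map_ptree: "leaves (map_ptree f t) = map f (leaves t)"
proof (induction t)
  case (Nd ts)
  then have "map (leaves \<circ> map_ptree f) ts = map (map f \<circ> leaves) ts" by simp
  then show ?case by (simp add: map_concat o_def cong: map_cong)
qed simp

lemma mon_basis_map_ptree: "Some t \<in> mon_basis omega \<Longrightarrow> Some (map_ptree f t) \<in> mon_basis omega"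
  by (induction t) (auto simp: mon_basis_Nd)

text \<open>Relabelling along a bijection is injective on trees; exchanging \<open>S\<close> and
  \<open>T\<close> gives the reverse inequality.\<close>

lemma card_monomials_le:
  assumes "finite S" "finite T" "card S = card T"
  shows "card {m \<in> mon_basis omega. cont m = mset_set S} \<le> card {m \<in> mon_basis omega. cont m = mset_set T}"
proof -
  obtain f where f: "bij_betw f S T" using assms finite_same_card_bij by blast
  let ?f = "map_option (map_ptree f)"
  have set: "set_ptree t = S" if "mset (leaves t) = mset_set S" for t
    using that assms(1) by (metis finite_set_mset_mset_set set_mset_mset set_ptree_leaves)
  have "inj_on ?f {m \<in> mon_basis omega. cont m = mset_set S}"
  proof (rule inj_onI)
    fix m m' assume m: "m \<in> {m \<in> mon_basis omega. cont m = mset_set S}"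
      and m': "m' \<in> {m \<in> mon_basis omega. cont m = mset_set S}" and eq: "?f m = ?f m'"
    show "m = m'"
    proof (cases m)
      case (Some t)
      then obtain t' where t': "m' = Some t'" "map_ptree f t = map_ptree f t'" using eq by (cases m') auto
      have "t = t'"
        by (rule ptree.inj_map_strong[OF _ t'(2)])
          (use f set[of t] set[of t'] m m' Some t'(1) in \<open>auto simp: bij_betw_def inj_on_def\<close>)
      then show ?thesis using Some t' by simp
    qed (use eq in \<open>cases m'; simp\<close>)
  qed
  moreover have "?f m \<in> {m \<in> mon_basis omega. cont m = mset_set T}"
    if "m \<in> {m \<in> mon_basis omega. cont m = mset_set S}" for m
  proof -
    have "cont (?f m) = image_mset f (cont m)" by (cases m) (simp_all add: leaves_map_ptree)
    also have "\<dots> = mset_set T"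
      using that f by (simp add: image_mset_mset_set bij_betw_def)
    finally show ?thesis using that mon_basis_map_ptree by (cases m) auto
  qed
  ultimately show ?thesis
    by (intro card_inj_on_le[where f = ?f] finite_cont) auto
qed

lemma card_monomials_cong:
  assumes "finite S" "finite T" "card S = card T"
  shows "card {m \<in> mon_basis omega. cont m = mset_set S} = card {m \<in> mon_basis omega. cont m = mset_set T}"
  by (rule antisym; rule card_monomials_le) (use assms in simp_all)

lemma sum_Pow_card:
  fixes g :: "nat \<Rightarrow> nat"
  assumes "finite A"
  shows "(\<Sum>U\<in>Pow A. g (card U)) = (\<Sum>k\<le>card A. (card A choose k) * g k)"
proof -
  have "(\<Sum>U\<in>Pow A. g (card U)) = (\<Sum>k\<le>card A. \<Sum>U\<in>{U \<in> Pow A. card U = k}. g (card U))"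
    using assms by (intro sum.group[symmetric]) (auto intro: card_mono)
  also have "\<dots> = (\<Sum>k\<le>card A. (card A choose k) * g k)"
    using n_subsets[OF assms] by (intro sum.cong refl) (simp add: Pow_def)
  finally show ?thesis .
qed

definition num_monos :: "bool \<Rightarrow> nat \<Rightarrow> nat" where
  "num_monos omega n = card {m :: nat mono. m \<in> mon_basis omega \<and> cont m = mset_set {1..n}}"

text \<open>The type argument fixes the field, which the type of the resulting number does not
  show.\<close>

definition num_prims :: "'k::field itself \<Rightarrow> bool \<Rightarrow> nat \<Rightarrow> nat" where
  "num_prims K omega n = card (prim_basis omega (mset_set {1..n}) :: (nat mono \<Rightarrow> 'k) set)"

lemma num_monos_0: "num_monos omega 0 = 1"
proof -
  have "{m :: nat mono. m \<in> mon_basis omega \<and> cont m = mset_set {1..0}} = {None}"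
    by (auto simp: cont_eq_empty_iff[of _ omega])
  then show ?thesis by (simp only: num_monos_def card.insert) simp
qed

lemma card_gen_msets_num_monos:
  assumes "finite S"
  shows "card (gen_msets omega (mset_set S) :: (nat mono \<Rightarrow> 'k::field_char_0) multiset set) = num_monos omega (card S)"
  unfolding card_gen_msets num_monos_def using assms by (intro card_monomials_cong) auto

text \<open>The recursion determines the dimension for \<open>T\<close> from those for smaller sets, so it depends
  only on the cardinality.\<close>

lemma card_prim_basis_num_prims:
  assumes "finite T" "T \<noteq> {}"
  shows "card (prim_basis omega (mset_set T) :: (nat mono \<Rightarrow> 'k::field_char_0) set)
    = num_prims TYPE('k) omega (card T)"
  using assms
proof (induction "card T" arbitrary: T rule: less_induct)
  case less
  let ?w = "\<lambda>S. card (prim_basis omega (mset_set S) :: (nat mono \<Rightarrow> 'k) set)"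
  let ?a = "num_monos omega" and ?b = "num_prims TYPE('k) omega"
  define n where "n = card T - 1"
  have card_T: "card T = Suc n" using less.prems by (simp add: n_def card_gt_0_iff)
  define g where "g k = ?b (Suc k) * ?a (n - k)" for k
  \<comment> \<open>The recursion contains \<open>?w S\<close> only in the term
    \<open>U = S - {t}\<close>, with factor \<open>num_monos omega 0 = 1\<close>. Adding
    \<open>g n\<close>, which is \<open>?b (Suc n)\<close>, to both sides completes the sum over the
    power set before it is known that \<open>?w S\<close> has this value.\<close>
  have main: "?a (Suc n) + ?b (Suc n) = ?w S + (\<Sum>k\<le>n. (n choose k) * g k)"
    if S: "finite S" "card S = Suc n" for S
  proof -
    obtain t where t: "t \<in> S" using S by fastforce
    have cU: "card (S - insert t U) = n - card U" "card (insert t U) = Suc (card U)" "finite U"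
      if "U \<in> Pow (S - {t})" for U
    proof -
      show U: "finite U" using that S(1) finite_subset by auto
      have "t \<notin> U" using that by auto
      then show ins: "card (insert t U) = Suc (card U)" using U by simp
      have "insert t U \<subseteq> S" using that t by auto
      then show "card (S - insert t U) = n - card U"
        using card_Diff_subset[of "insert t U" S] U ins S(2) by simp
    qed
    \<comment> \<open>For the other \<open>U\<close>, the set \<open>insert t U\<close> is smaller
      than \<open>S\<close>, so the induction hypothesis applies.\<close>
    have wU: "?w (insert t U) = ?b (Suc (card U))" if U: "U \<in> Pow (S - {t}) - {S - {t}}" for U
    proof -
      have "U \<subset> S - {t}" using U by auto
      then have "card U < card (S - {t})" using S(1) by (intro psubset_card_mono) auto
      then have "card U < n" using S t by simp
      then have "card (insert t U) < card T" using cU(2)[of U] U card_T by simp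
      then show ?thesis using less.hyps[of "insert t U"] cU(2,3)[of U] U by simp
    qed
    have fin: "finite (Pow (S - {t}))" and mem: "S - {t} \<in> Pow (S - {t})" using S(1) by auto
    have ct: "card (S - {t}) = n" "insert t (S - {t}) = S" using S t by auto
    have "?a (Suc n) = (\<Sum>U\<in>Pow (S - {t}). ?w (insert t U) * ?a (n - card U))"
      using card_gen_msets_rec[OF S(1) t, of omega, where 'k = 'k] S cU(1)
      by (simp add: card_gen_msets_num_monos)
    also have "\<dots> = ?w S + (\<Sum>U\<in>Pow (S - {t}) - {S - {t}}. ?w (insert t U) * ?a (n - card U))"
      by (subst sum.remove[OF fin mem]) (simp add: ct insert_absorb[OF t] num_monos_0)
    also have "\<dots> = ?w S + (\<Sum>U\<in>Pow (S - {t}) - {S - {t}}. g (card U))"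
      by (simp add: wU g_def)
    finally have "?a (Suc n) + g n = ?w S + (\<Sum>U\<in>Pow (S - {t}). g (card U))"
      by (subst sum.remove[OF fin mem]) (simp add: ct)
    then show ?thesis
      using S(1) by (subst (asm) sum_Pow_card) (simp_all add: ct g_def num_monos_0)
  qed
  \<comment> \<open>Both sets satisfy \<open>main\<close> with the same remaining terms, which
    cancel.\<close>
  have "?w T = ?w {1..Suc n}"
    using main[OF less.prems(1) card_T] main[of "{1..Suc n}"] by simp
  then show ?case by (simp add: num_prims_def card_T)
qed

text \<open>The leaf \<open>Suc n\<close> is the distinguished one; grouping the other leaves of its
  factor by their number gives the binomial coefficient.\<close>

lemma num_monos_rec:
  "num_monos omega (Suc n)
    = (\<Sum>k\<le>n. (n choose k) * (num_prims TYPE('k::field_char_0) omega (Suc k) * num_monos omega (n - k)))"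
proof -
  let ?T = "{1..Suc n}" let ?A = "?T - {Suc n}"
  have *: "card (prim_basis omega (mset_set (insert (Suc n) U)) :: (nat mono \<Rightarrow> 'k) set)
      * card (gen_msets omega (mset_set (?T - insert (Suc n) U)) :: (nat mono \<Rightarrow> 'k) multiset set)
      = num_prims TYPE('k) omega (Suc (card U)) * num_monos omega (n - card U)"
    if "U \<in> Pow ?A" for U
  proof -
    have U: "finite U" "Suc n \<notin> U" "insert (Suc n) U \<subseteq> ?T" using that finite_subset by auto
    have "card (?T - insert (Suc n) U) = n - card U"
      using card_Diff_subset[OF _ U(3)] U by simp
    moreover have "card (insert (Suc n) U) = Suc (card U)" using U by simp
    moreover have "finite (insert (Suc n) U)" "finite (?T - insert (Suc n) U)" using U by auto
    ultimately show ?thesis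
      by (simp only: card_prim_basis_num_prims card_gen_msets_num_monos insert_not_empty not_False_eq_True)
  qed
  have "num_monos omega (Suc n) = (\<Sum>U\<in>Pow ?A. num_prims TYPE('k) omega (Suc (card U)) * num_monos omega (n - card U))"
    using card_gen_msets_rec[of ?T "Suc n" omega, where 'k = 'k] *
    by (simp add: card_gen_msets_num_monos)
  also have "\<dots> = (\<Sum>k\<le>n. (n choose k) * (num_prims TYPE('k) omega (Suc k) * num_monos omega (n - k)))"
    by (subst sum_Pow_card) simp_all
  finally show ?thesis .
qed

section \<open>From cardinalities to generating series\<close>

lemma multilin_monos_eq: "multilin_monos omega n = {m \<in> mon_basis omega. cont m = mset_set {1..n}}" if "n \<ge> 1"
proof -
  have "mset_set {1..n} = mset [1..<n+1]"
    by (metis Suc_eq_plus1 atLeastLessThanSuc_atLeastAtMost mset_upt)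
  moreover have "mset_set {1..n} \<noteq> {#}" using that by (simp add: mset_set_empty_iff)
  ultimately show ?thesis
    unfolding multilin_monos_def by (auto simp: cont_def split: option.splits)
qed

lemma OpComp_eq:
  assumes "n \<ge> 1"
  shows "(OpComp omega n :: (nat mono \<Rightarrow> 'k::field) set)
    = {f \<in> Aspace omega. \<forall>m\<in>supp f. cont m = mset_set {1..n}}"
proof (intro subset_antisym subsetI)
  fix f assume f: "f \<in> {f \<in> Aspace omega. \<forall>m\<in>supp f. cont m = mset_set {1..n}}"
  show "f \<in> OpComp omega n"
    unfolding OpComp_def multilin_monos_eq[OF assms]
    by (rule in_span_deltas) (use f in \<open>auto simp: Aspace_def intro!: fv.span_base\<close>)
next
  let ?D = "{m \<in> mon_basis omega. cont m = mset_set {1..n}}"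
  fix f :: "nat mono \<Rightarrow> 'k" assume "f \<in> OpComp omega n"
  then have "f \<in> fv.span (delta ` ?D)" by (simp only: OpComp_def multilin_monos_eq[OF assms])
  then show "f \<in> {f \<in> Aspace omega. \<forall>m\<in>supp f. cont m = mset_set {1..n}}"
  proof (induction rule: fv.span_induct_alt)
    case base
    show ?case
      by (intro CollectI conjI fv.subspace_0[OF subspace_Aspace]) (simp add: supp_def)
  next
    case (step c x y)
    then obtain m where m: "x = delta m" "m \<in> ?D" by blast
    have "sc c x + y \<in> Aspace omega"
      using step m by (intro fv.subspace_add[OF subspace_Aspace] fv.subspace_scale[OF subspace_Aspace]) auto
    moreover have "supp (sc c x + y) \<subseteq> insert m (supp y)"
      by (auto simp: supp_def m delta_def)
    ultimately show ?case using step(2) m by blast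
  qed
qed

lemma dim_OpComp: "n \<ge> 1 \<Longrightarrow> fv.dim (OpComp omega n :: (nat mono \<Rightarrow> 'k::field) set) = num_monos omega n"
  by (simp only: OpComp_def multilin_monos_eq dim_deltas num_monos_def)

lemma dim_PrimOpComp:
  assumes "n \<ge> 1"
  shows "fv.dim (PrimOpComp omega n :: (nat mono \<Rightarrow> 'k::field) set) = num_prims TYPE('k) omega n"
proof -
  have "(PrimOpComp omega n :: (nat mono \<Rightarrow> 'k) set) = PrimCont omega (mset_set {1..n})"
    by (auto simp: PrimOpComp_def OpComp_eq[OF assms] PrimCont_def prim_Aspace)
  then show ?thesis
    using fv.dim_unique[OF prim_basis(1) prim_basis(3) prim_basis(2) refl] by (simp add: num_prims_def)
qed

text \<open>The hypothesis says that \<open>g\<close> has the logarithmic derivative of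
  \<open>1 + f\<close> as its derivative. \<open>fps_ln 1\<close> is the series of log(1 + X), and
  both constant terms are 0.\<close>

lemma fps_eq_ln_composeI:
  fixes f g :: "'k::field_char_0 fps"
  assumes "fps_nth f 0 = 0" "fps_nth g 0 = 0" and deriv: "fps_deriv f = fps_deriv g * (1 + f)"
  shows "g = fps_ln 1 oo f"
proof -
  have nz: "fps_nth (1 + f) 0 \<noteq> 0" using assms(1) by simp
  have "fps_deriv (fps_ln 1 oo f) = (inverse (1 + fps_X) oo f) * fps_deriv f"
    using assms(1) by (simp add: fps_compose_deriv fps_ln_deriv)
  also have "inverse (1 + fps_X) oo f = inverse (1 + f)"
    using assms(1) by (simp add: fps_inverse_compose fps_compose_add_distrib)
  also have "inverse (1 + f) * fps_deriv f = fps_deriv g"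
    unfolding deriv using inverse_mult_eq_1[OF nz] by (simp add: mult.left_commute)
  finally have "fps_deriv g = fps_deriv (fps_ln 1 oo f)" by simp
  moreover have "fps_nth (fps_ln 1 oo f) 0 = (0 :: 'k)" by (simp add: fps_ln_def)
  ultimately show ?thesis using assms(2) by (simp add: fps_deriv_eq_iff)
qed

text \<open>The coefficients are rational, so the field \<open>'c\<close> of the series may differ
  from the field \<open>'k\<close> of the algebra.\<close>

lemma gen_series_prim_eq_ln:
  "gen_series (\<lambda>n. fv.dim (PrimOpComp omega n :: (nat mono \<Rightarrow> 'k::field_char_0) set))
    = fps_ln 1 oo (gen_series (\<lambda>n. fv.dim (OpComp omega n :: (nat mono \<Rightarrow> 'k) set)) :: 'c::field_char_0 fps)"
proof (rule fps_eq_ln_composeI)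
  let ?a = "num_monos omega" and ?b = "num_prims TYPE('k) omega"
  define f where "f = (gen_series (\<lambda>n. fv.dim (OpComp omega n :: (nat mono \<Rightarrow> 'k) set)) :: 'c fps)"
  define g where "g = (gen_series (\<lambda>n. fv.dim (PrimOpComp omega n :: (nat mono \<Rightarrow> 'k) set)) :: 'c fps)"
  show "fps_nth f 0 = 0" "fps_nth g 0 = 0" by (simp_all add: f_def g_def gen_series_def)
  have f: "fps_nth (1 + f) n = of_nat (?a n) / fact n" for n
    by (cases n) (simp_all add: f_def gen_series_def dim_OpComp num_monos_0)
  have g': "fps_nth (fps_deriv g) n = of_nat (?b (Suc n)) / fact n" for n
    by (simp add: g_def gen_series_def dim_PrimOpComp field_simps del: of_nat_Suc)
  have "fps_deriv f = fps_deriv (1 + f)" by simp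
  also have "\<dots> = fps_deriv g * (1 + f)"
  proof (rule fps_ext)
    fix n
    have "fps_nth (fps_deriv (1 + f)) n = of_nat (?a (Suc n)) / fact n"
      unfolding fps_deriv_nth Suc_eq_plus1[symmetric] f by (simp add: field_simps del: of_nat_Suc)
    also have "\<dots> = (\<Sum>k\<le>n. of_nat (n choose k) / fact n * (of_nat (?b (Suc k)) * of_nat (?a (n - k))))"
      unfolding num_monos_rec[where 'k = 'k] by (simp add: sum_divide_distrib)
    \<comment> \<open>The quotient of the binomial coefficient by \<open>fact n\<close> is the
      product of the inverses of \<open>fact k\<close> and \<open>fact (n - k)\<close>, which turns
      the recursion into a Cauchy product.\<close>
    also have "\<dots> = (\<Sum>k\<le>n. fps_nth (fps_deriv g) k * fps_nth (1 + f) (n - k))"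
      unfolding f g' by (intro sum.cong refl) (simp add: binomial_fact)
    finally show "fps_nth (fps_deriv (1 + f)) n = fps_nth (fps_deriv g * (1 + f)) n"
      by (simp add: fps_mult_nth atLeast0AtMost)
  qed
  finally show "fps_deriv f = fps_deriv g * (1 + f)" .
qed

theorem theorem4p7p5:
  fixes omega :: bool
  defines "W \<equiv> module.span (sc :: 'k::field_char_0 \<Rightarrow> _)
                  (\<Union>k\<in>{1..}. (PrimGr omega k :: ('x::countable mono \<Rightarrow> 'k) set))"
  shows
    \<comment> \<open>(i) (A, shuffle) is freely generated by W: shuffle monomials in a basis of W form a basis of A\<close>
    "(\<forall>Bs. \<not> module.dependent sc Bs \<and> module.span sc Bs = W \<longrightarrow>
        inj_on (shuffle_mset omega) {M. set_mset M \<subseteq> Bs}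
      \<and> \<not> module.dependent sc (shuffle_mset omega ` {M. set_mset M \<subseteq> Bs})
      \<and> module.span sc (shuffle_mset omega ` {M. set_mset M \<subseteq> Bs}) = Aspace omega)
   \<and>
    \<comment> \<open>(ii) generating series\<close>
    (gen_series (\<lambda>n. vector_space.dim (sc :: 'k \<Rightarrow> _) (PrimOpComp omega n :: (nat mono \<Rightarrow> 'k) set))
       = fps_ln 1 oo gen_series (\<lambda>n. vector_space.dim (sc :: 'k \<Rightarrow> _) (OpComp omega n :: (nat mono \<Rightarrow> 'k) set)))
   \<and>
    \<comment> \<open>(iii) basis of the orthogonal complement B^(n) of Prim A^(n) in A^(n)\<close>
    (\<forall>n (fs :: ('x mono \<Rightarrow> 'k) list) (d :: nat \<Rightarrow> nat).
        2 \<le> n \<and> distinct fs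
        \<and> (\<forall>i < length fs. 1 \<le> d i \<and> d i \<le> n - 1 \<and> fs ! i \<in> PrimGr omega (d i))
        \<and> \<not> module.dependent sc (set fs)
        \<and> module.span sc (set fs) = module.span sc (\<Union>k\<in>{1..n-1}. PrimGr omega k)
      \<longrightarrow> (let I = {is. sorted is \<and> set is \<subseteq> {..<length fs} \<and> sum_list (map d is) = n};
               P = (\<lambda>is. shuffle_list omega (map ((!) fs) is));
               Bn = {g \<in> Agr omega n. \<forall>p \<in> PrimGr omega n. pair g p = 0}
           in inj_on P I \<and> \<not> module.dependent sc (P ` I) \<and> module.span sc (P ` I) = Bn))"
proof (intro conjI allI impI)
  fix Bs :: "('x mono \<Rightarrow> 'k) set"
  assume "\<not> module.dependent sc Bs \<and> module.span sc Bs = W"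
  \<comment> \<open>The span of the homogeneous primitive elements of positive degree is the space
    of all primitive elements, so degrees disappear from this part.\<close>
  then have Bs: "fv.independent Bs" "fv.span Bs = {f. prim omega f}"
    unfolding W_def span_PrimGr by blast+
  have prim: "prim omega b" if "b \<in> Bs" for b using that Bs(2) fv.span_base by blast
  show "inj_on (shuffle_mset omega) {M. set_mset M \<subseteq> Bs}"
    "\<not> module.dependent sc (shuffle_mset omega ` {M. set_mset M \<subseteq> Bs})"
    using shuffle_mset_independent[OF Bs(1) prim] by blast+
  show "module.span sc (shuffle_mset omega ` {M. set_mset M \<subseteq> Bs}) = Aspace omega"
    by (rule shuffle_mset_free[OF Bs])
next
  show "gen_series (\<lambda>n. vector_space.dim (sc :: 'k \<Rightarrow> _) (PrimOpComp omega n :: (nat mono \<Rightarrow> 'k) set))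
       = fps_ln 1 oo gen_series (\<lambda>n. vector_space.dim (sc :: 'k \<Rightarrow> _) (OpComp omega n :: (nat mono \<Rightarrow> 'k) set))"
    by (rule gen_series_prim_eq_ln)
next
  fix n :: nat and fs :: "('x mono \<Rightarrow> 'k) list" and d :: "nat \<Rightarrow> nat"
  assume "2 \<le> n \<and> distinct fs
        \<and> (\<forall>i < length fs. 1 \<le> d i \<and> d i \<le> n - 1 \<and> fs ! i \<in> PrimGr omega (d i))
        \<and> \<not> module.dependent sc (set fs)
        \<and> module.span sc (set fs) = module.span sc (\<Union>k\<in>{1..n-1}. PrimGr omega k)"
  then show "let I = {is. sorted is \<and> set is \<subseteq> {..<length fs} \<and> sum_list (map d is) = n};
               P = (\<lambda>is. shuffle_list omega (map ((!) fs) is));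
               Bn = {g \<in> Agr omega n. \<forall>p \<in> PrimGr omega n. pair g p = 0}
           in inj_on P I \<and> \<not> module.dependent sc (P ` I) \<and> module.span sc (P ` I) = Bn"
    unfolding Let_def using shuffle_list_basis_complement[of n fs d omega] by blast
qed

end
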